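(* Let $\gamma:\mathbb{R}\to\mathbb{R}^2$ be a monomial curve with exponent vector $\beta$, let $p,q\in(1,\infty)$ be arbitrary, let $\mu\in A^\gamma_{p,p}(\mathbb{R}^2)$ and $\lambda\in A^\gamma_{q,q}(\mathbb{R}^2)$, and set $$\alpha/|\beta|=1/p-1/q,\qquad \nu=(\mu/\lambda)^{(1+\alpha/|\beta|)^{-1}}.$$ Then, for all locally integrable $b:\mathbb{R}^2\to\mathbb{C}$, $$\|b\|_{\mathrm{BMO}^{\gamma,\alpha}_\nu(\mathbb{R}^2)}\lesssim\|[b,H_\gamma]\|_{L^p_\mu(\mathbb{R}^2)\to L^q_\lambda(\mathbb{R}^2)},$$ where the implied constant depends only on $\gamma,p,q,\mu,\lambda$.
   Context: A monomial curve $\gamma:\mathbb{R}\to\mathbb{R}^2$ is given by parameters $\beta=(\beta_1,\beta_2)$ with $0<\beta_1<\beta_2$ and $\varepsilon,\delta\in\{-1,1\}^2$ with $\varepsilon_i\neq\delta_i$ for at least one $i$, through $\gamma(t)=(\varepsilon_1|t|^{\beta_1},\varepsilon_2|t|^{\beta_2})$ for $t>0$ and $\gamma(t)=(\delta_1|t|^{\beta_1},\delta_2|t|^{\beta_2})$ for $t\le 0$. Denote $|\beta|=\beta_1+\beta_2$. The Hilbert transform along $\gamma$ is $H_\gamma f(x)=\mathrm{p.v.}\int_{\mathbb{R}}f(x-\gamma(t))\frac{dt}{t}$, and the commutator is $[b,H_\gamma]f=bH_\gamma f-H_\gamma(bf)$. Operator norms are allowed to be $+\infty$. A $\gamma$-cube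 is a rectangle $Q=I_1\times I_2$ parallel to the coordinate axes with $\ell(Q):=\ell(I_1)^{1/\beta_1}=\ell(I_2)^{1/\beta_2}$, where $\ell(I_j)$ is the length of $I_j$; their collection is $\mathcal{R}^\gamma$. A weight is a positive locally integrable function, treated as a multiplier: $\|f\|_{L^s_w}=\big(\int|fw|^s\big)^{1/s}$. The class $A^\gamma_{p,p}$ consists of the weights $w$ with $[w]_{A^\gamma_{p,p}}=\sup_{Q\in\mathcal{R}^\gamma}\langle w^p\rangle_Q^{1/p}\langle w^{-p'}\rangle_Q^{1/p'}<\infty$, where $p'$ is the Hölder conjugate and $\langle f\rangle_Q=\frac1{|Q|}\int_Q f$. For a weight $w$ and $\alpha\in\mathbb{R}$, with $w(Q)=\int_Q w$, $$\|b\|_{\mathrm{BMO}^{\gamma,\alpha}_w}=\sup_{Q\in\mathcal{R}^\gamma}w(Q)^{-\alpha/|\beta|}\Big(\frac1{w(Q)}\int_Q|b-\langle b\rangle_Q|\Big).$$ *)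

theory Defs
  imports "HOL-Analysis.Analysis"
begin

type_synonym plane = "real \<times> real"

definition monomial_data :: "plane \<Rightarrow> plane \<Rightarrow> plane \<Rightarrow> bool" where
  "monomial_data \<beta> \<epsilon> \<delta> \<longleftrightarrow>
     0 < fst \<beta> \<and> fst \<beta> < snd \<beta> \<and>
     fst \<epsilon> \<in> {-1, 1} \<and> snd \<epsilon> \<in> {-1, 1} \<and> fst \<delta> \<in> {-1, 1} \<and> snd \<delta> \<in> {-1, 1} \<and>
     (fst \<epsilon> \<noteq> fst \<delta> \<or> snd \<epsilon> \<noteq> snd \<delta>)"

definition monomial_curve :: "plane \<Rightarrow> plane \<Rightarrow> plane \<Rightarrow> real \<Rightarrow> plane" where
  "monomial_curve \<beta> \<epsilon> \<delta> t =
     (if t > 0 then (fst \<epsilon> * \<bar>t\<bar> powr fst \<beta>, snd \<epsilon> * \<bar>t\<bar> powr snd \<beta>)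
      else (fst \<delta> * \<bar>t\<bar> powr fst \<beta>, snd \<delta> * \<bar>t\<bar> powr snd \<beta>))"

definition homdim :: "plane \<Rightarrow> real" where
  "homdim \<beta> = fst \<beta> + snd \<beta>"

definition locally_integrable :: "(plane \<Rightarrow> 'a::{banach, second_countable_topology}) \<Rightarrow> bool" where
  "locally_integrable f \<longleftrightarrow> (\<forall>K. compact K \<longrightarrow> set_integrable lebesgue K f)"

definition weight :: "(plane \<Rightarrow> real) \<Rightarrow> bool" where
  "weight w \<longleftrightarrow> (\<forall>x. 0 < w x) \<and> locally_integrable w"

definition conj_exponent :: "real \<Rightarrow> real" where
  "conj_exponent p = p / (p - 1)"

text \<open>Real powers of extended nonnegative reals, used only with positive exponents.\<close>

definition ennreal_powr :: "ennreal \<Rightarrow> real \<Rightarrow> ennreal" where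
  "ennreal_powr a s = (if a = \<infinity> then \<infinity> else ennreal (enn2real a powr s))"

definition gamma_cubes :: "plane \<Rightarrow> plane set set" where
  "gamma_cubes \<beta> = {{a1..b1} \<times> {a2..b2} | a1 b1 a2 b2.
     a1 < b1 \<and> a2 < b2 \<and> (b1 - a1) powr (1 / fst \<beta>) = (b2 - a2) powr (1 / snd \<beta>)}"

definition nn_average :: "plane set \<Rightarrow> (plane \<Rightarrow> real) \<Rightarrow> ennreal" where
  "nn_average Q f = (\<integral>\<^sup>+x\<in>Q. ennreal (f x) \<partial>lebesgue) / emeasure lebesgue Q"

definition A_const :: "plane \<Rightarrow> real \<Rightarrow> (plane \<Rightarrow> real) \<Rightarrow> ennreal" where
  "A_const \<beta> p w = (SUP Q \<in> gamma_cubes \<beta>.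
     ennreal_powr (nn_average Q (\<lambda>x. w x powr p)) (1 / p) *
     ennreal_powr (nn_average Q (\<lambda>x. w x powr (- conj_exponent p))) (1 / conj_exponent p))"

definition A_class :: "plane \<Rightarrow> real \<Rightarrow> (plane \<Rightarrow> real) set" where
  "A_class \<beta> p = {w. weight w \<and> A_const \<beta> p w < \<infinity>}"

definition average :: "plane set \<Rightarrow> (plane \<Rightarrow> complex) \<Rightarrow> complex" where
  "average Q f = (LINT x:Q|lebesgue. f x) /\<^sub>R measure lebesgue Q"

text \<open>The inner integrals are Bochner integrals, hence meaningful for a locally integrable
  \<open>w\<close> and a locally integrable \<open>b\<close>; the supremum is taken in the extended reals.\<close>

definition BMO_norm ::
  "plane \<Rightarrow> real \<Rightarrow> (plane \<Rightarrow> real) \<Rightarrow> (plane \<Rightarrow> complex) \<Rightarrow> ennreal" where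
  "BMO_norm \<beta> \<alpha> w b = (SUP Q \<in> gamma_cubes \<beta>.
     let wQ = (LINT x:Q|lebesgue. w x) in
     ennreal (wQ powr (- \<alpha> / homdim \<beta>) *
       (1 / wQ * (LINT x:Q|lebesgue. cmod (b x - average Q b)))))"

definition Lp_norm :: "real \<Rightarrow> (plane \<Rightarrow> real) \<Rightarrow> (plane \<Rightarrow> complex) \<Rightarrow> ennreal" where
  "Lp_norm s w f = ennreal_powr (\<integral>\<^sup>+x. ennreal ((cmod (f x) * w x) powr s) \<partial>lebesgue) (1 / s)"

definition Lp_space :: "real \<Rightarrow> (plane \<Rightarrow> real) \<Rightarrow> (plane \<Rightarrow> complex) set" where
  "Lp_space s w = {f. f \<in> borel_measurable lebesgue \<and> Lp_norm s w f < \<infinity>}"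

definition op_norm :: "real \<Rightarrow> (plane \<Rightarrow> real) \<Rightarrow> real \<Rightarrow> (plane \<Rightarrow> real) \<Rightarrow>
    ((plane \<Rightarrow> complex) \<Rightarrow> plane \<Rightarrow> complex) \<Rightarrow> ennreal" where
  "op_norm p u q v T = (SUP f \<in> {f \<in> Lp_space p u. Lp_norm p u f \<le> 1}. Lp_norm q v (T f))"

definition has_pv :: "(real \<Rightarrow> complex) \<Rightarrow> complex \<Rightarrow> bool" where
  "has_pv \<phi> I \<longleftrightarrow>
     (\<forall>r>0. set_integrable lebesgue {t. r < \<bar>t\<bar>} \<phi>) \<and>
     ((\<lambda>r. LINT t:{t. r < \<bar>t\<bar>}|lebesgue. \<phi> t) \<longlongrightarrow> I) (at_right 0)"

definition hilbert_integrand ::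
  "(real \<Rightarrow> plane) \<Rightarrow> (plane \<Rightarrow> complex) \<Rightarrow> plane \<Rightarrow> real \<Rightarrow> complex" where
  "hilbert_integrand \<gamma> f x t = f (x - \<gamma> t) / complex_of_real t"

definition hilbert_defined_at ::
  "(real \<Rightarrow> plane) \<Rightarrow> (plane \<Rightarrow> complex) \<Rightarrow> plane \<Rightarrow> bool" where
  "hilbert_defined_at \<gamma> f x \<longleftrightarrow> (\<exists>I. has_pv (hilbert_integrand \<gamma> f x) I)"

definition hilbert :: "(real \<Rightarrow> plane) \<Rightarrow> (plane \<Rightarrow> complex) \<Rightarrow> plane \<Rightarrow> complex" where
  "hilbert \<gamma> f x = (THE I. has_pv (hilbert_integrand \<gamma> f x) I)"

text \<open>For a merely locally integrable \<open>b\<close> the principal values need not exist at every point.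
  The commutator is evaluated exactly where both of them exist and is set to 0 elsewhere, so
  that points outside its domain never enlarge its operator norm.\<close>

definition commutator ::
  "(plane \<Rightarrow> complex) \<Rightarrow> (real \<Rightarrow> plane) \<Rightarrow> (plane \<Rightarrow> complex) \<Rightarrow> plane \<Rightarrow> complex" where
  "commutator b \<gamma> f x =
     (if hilbert_defined_at \<gamma> f x \<and> hilbert_defined_at \<gamma> (\<lambda>y. b y * f y) x
      then b x * hilbert \<gamma> f x - hilbert \<gamma> (\<lambda>y. b y * f y) x
      else 0)"

end

theory Submission
  imports Defs
begin

text \<open>The commutator sees \<open>b\<close> only through the differences \<open>b x - b (x - \<gamma> t)\<close> along the curve,
  whereas \<open>BMO\<close> asks for \<open>b x - b w\<close> averaged over a two-dimensional set of points \<open>w\<close>. Two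
  steps along the curve fill an open set: put \<open>y = x - \<gamma> t\<close> and \<open>w = y - \<gamma> s\<close>. Since
  \<open>\<gamma>\<^sub>i'(t) = \<beta>\<^sub>i \<gamma>\<^sub>i(t) / t\<close>, the Jacobian of \<open>(t, s) \<mapsto> \<gamma> t + \<gamma> s\<close> is
  \<open>\<beta>\<^sub>1 \<beta>\<^sub>2 (\<gamma>\<^sub>1(t) \<gamma>\<^sub>2(s) - \<gamma>\<^sub>2(t) \<gamma>\<^sub>1(s)) / (t s)\<close>. This is the measure \<open>dt/t ds/s\<close> of the iterated
  Hilbert transform times a polynomial in the coordinates of \<open>x - y\<close> and \<open>y - w\<close>. Therefore, for a
  cube \<open>Q\<close>, an intermediate rectangle \<open>P\<close> and a target rectangle \<open>W\<close>, suitably placed, the number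
  \<open>|W| b(x) - \<integral>\<^sub>W b\<close> is \<^emph>\<open>exactly\<close> a constant times the double integral of
  \<open>(b x - b w) (\<gamma>\<^sub>1(t) \<gamma>\<^sub>2(s) - \<gamma>\<^sub>2(t) \<gamma>\<^sub>1(s)) dt/t ds/s\<close> over \<open>y \<in> P\<close>, \<open>w \<in> W\<close>; this is
  \<open>has_bochner_integral_double_step\<close>. Splitting
  \<open>b x - b w = (b x - b y) + (b y - b w)\<close> and writing \<open>\<gamma>\<^sub>i(t) = x\<^sub>i - y\<^sub>i\<close> expresses it
  through finitely many integrals \<open>\<integral> (b x - b (x - \<gamma> t)) f (x - \<gamma> t) dt/t\<close> with bounded \<open>f\<close>
  (\<open>oscillation_decomposition\<close>, \<open>oscillation_le_curve_tests\<close>).\<close>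

text \<open>Because \<open>Q\<close>, \<open>P\<close> and \<open>W\<close> are separated along the curve, each of these integrals is a value
  of \<open>[b, H\<^sub>\<gamma>] f\<close> without any principal value (\<open>commutator_eq_curve_osc\<close>), and Hoelder's
  inequality bounds its \<open>L\<^sup>1\<close> norm over \<open>Q\<close> or \<open>P\<close> by the operator norm times
  \<open>(\<integral>\<^sub>R \<mu>\<^sup>p)\<close> to the power \<open>1/p\<close> and \<open>(\<integral>\<^sub>R \<lambda> powr (- q'))\<close> to the power \<open>1/q'\<close>, where \<open>R\<close>
  is a cube around everything (\<open>curve_tests_of_op_norm\<close>). The \<open>A\<^sub>p\<close> conditions and one more
  application of Hoelder's inequality turn this product into \<open>\<nu>(Q) powr (1 + \<alpha>/|\<beta>|)\<close>
  (\<open>weight_product_bound\<close>), which is the normalisation of \<open>BMO\<close>.\<close>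

text \<open>The sets \<open>P\<close> and \<open>W\<close> are found once at unit scale and carried to every cube by the anisotropic
  dilations that preserve the curve (\<open>exists_transversal_triple\<close>,
  \<open>transversal_triple_dilate\<close>).\<close>

section \<open>Change of variables in the plane\<close>

text \<open>The change of variables theorem concerns vectors \<open>real^n\<close>; this identification, which
  preserves Lebesgue measure, carries it over to pairs.\<close>

definition plane_of_vec :: "real^2 \<Rightarrow> plane" where
  "plane_of_vec v = (v $ 1, v $ 2)"

definition vec_of_plane :: "plane \<Rightarrow> real^2" where
  "vec_of_plane z = (\<chi> i. if i = 1 then fst z else snd z)"

lemma plane_of_vec_inverse [simp]:
  "plane_of_vec (vec_of_plane z) = z" "vec_of_plane (plane_of_vec v) = v"
  by (auto simp: plane_of_vec_def vec_of_plane_def vec_eq_iff forall_2)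

lemma linear_plane_of_vec: "linear plane_of_vec" and linear_vec_of_plane: "linear vec_of_plane"
  by (auto intro!: linearI simp: plane_of_vec_def vec_of_plane_def vec_eq_iff forall_2)

lemma borel_measurable_plane_of_vec [measurable]: "plane_of_vec \<in> borel_measurable borel"
  by (intro borel_measurable_continuous_onI linear_continuous_on)
    (simp add: linear_plane_of_vec flip: linear_conv_bounded_linear)

lemma distr_plane_of_vec: "distr lborel borel plane_of_vec = lborel"
proof (rule lborel_eqI[symmetric])
  fix l u :: plane
  assume lu: "\<And>b. b \<in> Basis \<Longrightarrow> l \<bullet> b \<le> u \<bullet> b"
  have "fst l \<le> fst u" "snd l \<le> snd u"
    using lu[of "(1,0)"] lu[of "(0,1)"] by (auto simp: Basis_prod_def inner_prod_def)
  have eq: "plane_of_vec -` box l u = box (vec_of_plane l) (vec_of_plane u)"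
    by (auto simp: box_def plane_of_vec_def vec_of_plane_def Basis_vec_def Basis_prod_def inner_axis
        inner_prod_def forall_2)
  have le: "\<And>b. b \<in> Basis \<Longrightarrow> vec_of_plane l \<bullet> b \<le> vec_of_plane u \<bullet> b"
    using \<open>fst l \<le> fst u\<close> \<open>snd l \<le> snd u\<close> 
    by (auto simp: Basis_vec_def vec_of_plane_def inner_axis)
  have "emeasure lborel (box (vec_of_plane l) (vec_of_plane u))
     = (\<Prod>b\<in>Basis. (vec_of_plane u - vec_of_plane l) \<bullet> b)"
    using le by (rule emeasure_lborel_box)
  also have "(\<Prod>b\<in>Basis. (vec_of_plane u - vec_of_plane l) \<bullet> b)
     = (fst u - fst l) * (snd u - snd l)"
  proof -
    have B: "Basis = {axis 1 1, axis 2 1 :: real^2}"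
      by (auto simp: Basis_vec_def UNIV_2)
    have "axis 1 1 \<noteq> (axis 2 1 :: real^2)" by (simp add: axis_eq_axis)
    then show ?thesis unfolding B by (simp add: inner_axis vec_of_plane_def)
  qed
  also have "\<dots> = (\<Prod>b\<in>Basis. (u - l) \<bullet> b)"
  proof -
    have B: "Basis = {(1,0), (0,1::real)::plane}" by (auto simp: Basis_prod_def)
    show ?thesis unfolding B by (simp add: inner_prod_def)
  qed
  finally show "emeasure (distr lborel borel plane_of_vec) (box l u) = (\<Prod>b\<in>Basis. (u - l) \<bullet> b)"
    by (simp add: emeasure_distr eq)
qed simp

text \<open>The determinant of a linear map of the plane in terms of the images of the two unit
  vectors.\<close>

definition jacobian2 :: "(plane \<Rightarrow> plane) \<Rightarrow> real" where
  "jacobian2 L = fst (L (1, 0)) * snd (L (0, 1)) - fst (L (0, 1)) * snd (L (1, 0))"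

lemma nn_integral_jacobian2:
  fixes \<Phi> :: "plane \<Rightarrow> plane"
  assumes S: "S \<in> sets borel" and img: "\<Phi> ` S \<in> sets borel" "emeasure lborel (\<Phi> ` S) < \<infinity>"
    and der: "\<And>z. z \<in> S \<Longrightarrow> (\<Phi> has_derivative \<Phi>' z) (at z)"
    and inj: "inj_on \<Phi> S"
    and meas: "(\<lambda>z. jacobian2 (\<Phi>' z)) \<in> borel_measurable borel"
  shows "(\<integral>\<^sup>+z\<in>S. ennreal \<bar>jacobian2 (\<Phi>' z)\<bar> \<partial>lborel) = emeasure lborel (\<Phi> ` S)"
proof -
  define S' where "S' = plane_of_vec -` S"
  define G where "G = vec_of_plane \<circ> \<Phi> \<circ> plane_of_vec"
  define G' where "G' v = vec_of_plane \<circ> \<Phi>' (plane_of_vec v) \<circ> plane_of_vec" for v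
  have bl: "bounded_linear plane_of_vec" "bounded_linear vec_of_plane"
    using linear_plane_of_vec linear_vec_of_plane by (auto simp: linear_conv_bounded_linear)
  have S'b: "S' \<in> sets borel"
    using measurable_sets[OF borel_measurable_plane_of_vec S] by (simp add: S'_def)
  have S'l: "S' \<in> sets lebesgue" using S'b by (simp)
  have derG: "(G has_derivative G' v) (at v within S')" if "v \<in> S'" for v
  proof -
    have 1: "(plane_of_vec has_derivative plane_of_vec) (at v within S')"
      using bl(1) by (rule bounded_linear_imp_has_derivative)
    have 2: "(\<Phi> has_derivative \<Phi>' (plane_of_vec v)) (at (plane_of_vec v) within plane_of_vec ` S')"
      using der[of "plane_of_vec v"] that has_derivative_at_withinI by (auto simp: S'_def)
    have 3: "(\<Phi> \<circ> plane_of_vec has_derivative \<Phi>' (plane_of_vec v) \<circ> plane_of_vec) (at v within S')"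
      using diff_chain_within[OF 1 2] .
    have 4: "(vec_of_plane has_derivative vec_of_plane)
       (at ((\<Phi> \<circ> plane_of_vec) v) within (\<Phi> \<circ> plane_of_vec) ` S')"
      using bl(2) by (rule bounded_linear_imp_has_derivative)
    from diff_chain_within[OF 3 4] show ?thesis by (simp add: G_def G'_def comp_def)
  qed
  have injG: "inj_on G S'"
    unfolding G_def S'_def inj_on_def
    by (metis comp_apply inj inj_onD plane_of_vec_inverse vimageE)
  have imgG: "G ` S' = plane_of_vec -` (\<Phi> ` S)"
  proof -
    have "plane_of_vec ` S' = S"
      unfolding S'_def by (metis plane_of_vec_inverse(1) surjI surj_image_vimage_eq)
    moreover have "vec_of_plane ` A = plane_of_vec -` A" for A
      by (auto simp: image_iff) (metis plane_of_vec_inverse(2))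
    ultimately show ?thesis by (metis G_def image_comp)
  qed
  have em: "emeasure lborel (plane_of_vec -` A) = emeasure lborel A" if "A \<in> sets borel" for A
    using emeasure_distr[OF _ , of plane_of_vec lborel borel A] that by (simp add: distr_plane_of_vec)
  have det: "det (matrix (G' v)) = jacobian2 (\<Phi>' (plane_of_vec v))" for v
    by (simp add: det_2 matrix_def jacobian2_def G'_def vec_of_plane_def plane_of_vec_def axis_def)
  have Gb: "G ` S' \<in> sets borel"
    using measurable_sets[OF borel_measurable_plane_of_vec img(1)] by (simp add: imgG)
  have "G ` S' \<in> lmeasurable"
    using img em Gb by (simp add: fmeasurable_def imgG)
  then have "((\<lambda>x. \<bar>det (matrix (G' x))\<bar>) has_integral (measure lebesgue (G ` S'))) S'"
    using has_measure_differentiable_image[OF S'l derG injG] by blast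
  then have "((\<lambda>x. \<bar>jacobian2 (\<Phi>' (plane_of_vec x))\<bar>) has_integral (measure lebesgue (G ` S'))) S'"
    by (simp add: det)
  moreover have "(\<lambda>x. if x \<in> S' then \<bar>jacobian2 (\<Phi>' (plane_of_vec x))\<bar> else 0)
      = (\<lambda>x. indicator S' x * \<bar>jacobian2 (\<Phi>' (plane_of_vec x))\<bar>)" by auto
  ultimately have hi: "((\<lambda>x. indicator S' x * \<bar>jacobian2 (\<Phi>' (plane_of_vec x))\<bar>) has_integral (measure lebesgue (G ` S'))) UNIV"
    by (subst (asm) has_integral_restrict_UNIV[symmetric]) simp
  have m2: "(\<lambda>x. \<bar>jacobian2 (\<Phi>' (plane_of_vec x))\<bar>) \<in> borel_measurable borel"
    using meas by measurable
  have "(\<integral>\<^sup>+x. ennreal (indicator S' x * \<bar>jacobian2 (\<Phi>' (plane_of_vec x))\<bar>) \<partial>lborel)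
      = ennreal (measure lebesgue (G ` S'))"
    by (rule nn_integral_has_integral_lborel[OF _ _ hi]) (use m2 S'b in auto)
  also have "\<dots> = emeasure lborel (G ` S')"
  proof -
    have "emeasure lebesgue (G ` S') = ennreal (measure lebesgue (G ` S'))"
      using \<open>G ` S' \<in> lmeasurable\<close> by (rule emeasure_eq_measure2)
    moreover have "emeasure lebesgue (G ` S') = emeasure lborel (G ` S')"
      using Gb by simp
    ultimately show ?thesis by simp
  qed
  also have "\<dots> = emeasure lborel (\<Phi> ` S)"
    using em img(1) by (simp add: imgG)
  finally have *: "(\<integral>\<^sup>+x. ennreal (indicator S' x * \<bar>jacobian2 (\<Phi>' (plane_of_vec x))\<bar>) \<partial>lborel) = emeasure lborel (\<Phi> ` S)" .
  have "(\<integral>\<^sup>+z\<in>S. ennreal \<bar>jacobian2 (\<Phi>' z)\<bar> \<partial>lborel)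
     = (\<integral>\<^sup>+z\<in>S. ennreal \<bar>jacobian2 (\<Phi>' z)\<bar> \<partial>distr lborel borel plane_of_vec)"
    by (simp add: distr_plane_of_vec)
  also have "\<dots> = (\<integral>\<^sup>+x. ennreal \<bar>jacobian2 (\<Phi>' (plane_of_vec x))\<bar> * indicator S (plane_of_vec x) \<partial>lborel)"
    using meas S by (subst nn_integral_distr) auto
  also have "\<dots> = (\<integral>\<^sup>+x. ennreal (indicator S' x * \<bar>jacobian2 (\<Phi>' (plane_of_vec x))\<bar>) \<partial>lborel)"
    by (intro nn_integral_cong) (auto simp: S'_def indicator_def)
  finally show ?thesis using * by simp
qed

text \<open>The change of variables as an identity of measures, from which it follows for vector-valued
  integrands at once. The density is cut down to the preimage of a set \<open>C\<close> of finite measure, so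
  that every set that occurs has finite measure.\<close>

lemma distr_density_jacobian2:
  fixes \<Phi> :: "plane \<Rightarrow> plane"
  assumes U: "U \<in> sets borel" and C: "C \<in> sets borel" "emeasure lborel C < \<infinity>" "C \<subseteq> \<Phi> ` U"
    and der: "\<And>z. z \<in> U \<Longrightarrow> (\<Phi> has_derivative \<Phi>' z) (at z)"
    and inj: "inj_on \<Phi> U"
    and meas: "(\<lambda>z. jacobian2 (\<Phi>' z)) \<in> borel_measurable borel" and meas\<Phi>: "\<Phi> \<in> borel_measurable borel"
  shows "distr (density lborel (\<lambda>z. ennreal (indicator U z * indicator C (\<Phi> z) * \<bar>jacobian2 (\<Phi>' z)\<bar>))) borel \<Phi>
     = density lborel (indicator C)"
proof (rule measure_eqI)
  fix B assume "B \<in> sets (distr (density lborel (\<lambda>z. ennreal (indicator U z * indicator C (\<Phi> z) * \<bar>jacobian2 (\<Phi>' z)\<bar>))) borel \<Phi>)"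
  then have B: "B \<in> sets borel" by simp
  define S where "S = U \<inter> \<Phi> -` (C \<inter> B)"
  have Sb: "S \<in> sets borel"
    using U B C measurable_sets[OF meas\<Phi>, of "C \<inter> B"] by (auto simp: S_def)
  have im: "\<Phi> ` S = C \<inter> B" using C by (auto simp: S_def)
  have pre: "\<Phi> -` B \<in> sets borel" using measurable_sets[OF meas\<Phi>, of "B"] B by simp
  have mi: "(\<lambda>z. indicator C (\<Phi> z) :: real) \<in> borel_measurable borel"
    using meas\<Phi> C(1) by measurable
  have "emeasure (distr (density lborel (\<lambda>z. ennreal (indicator U z * indicator C (\<Phi> z) * \<bar>jacobian2 (\<Phi>' z)\<bar>))) borel \<Phi>) B
     = (\<integral>\<^sup>+z. ennreal (indicator U z * indicator C (\<Phi> z) * \<bar>jacobian2 (\<Phi>' z)\<bar>) * indicator (\<Phi> -` B) z \<partial>lborel)"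
    using B meas meas\<Phi> mi U C(1) pre by (simp add: emeasure_distr emeasure_density)
  also have "\<dots> = (\<integral>\<^sup>+z\<in>S. ennreal \<bar>jacobian2 (\<Phi>' z)\<bar> \<partial>lborel)"
    by (intro nn_integral_cong) (auto simp: S_def indicator_def)
  also have "\<dots> = emeasure lborel (\<Phi> ` S)"
  proof (rule nn_integral_jacobian2[OF Sb _ _ _ _ meas])
    show "\<Phi> ` S \<in> sets borel" using C(1) B by (simp add: im)
    have "emeasure lborel (C \<inter> B) \<le> emeasure lborel C"
      using C(1) by (intro emeasure_mono) auto
    then show "emeasure lborel (\<Phi> ` S) < \<infinity>" using C(2) im by simp
    show "inj_on \<Phi> S" using inj by (rule inj_on_subset) (auto simp: S_def)
  qed (use der S_def in auto)
  also have "\<dots> = emeasure (density lborel (indicator C)) B"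
    using C(1) B by (simp add: im emeasure_density indicator_inter_arith[symmetric] )
  finally show "emeasure (distr (density lborel (\<lambda>z. ennreal (indicator U z * indicator C (\<Phi> z) * \<bar>jacobian2 (\<Phi>' z)\<bar>))) borel \<Phi>) B = emeasure (density lborel (indicator C)) B" .
qed simp

section \<open>The geometry of two steps along the curve\<close>

text \<open>A convexity argument: for \<open>u = t powr a\<close> the function \<open>u \<mapsto> u powr (b / a)\<close> is strictly convex,
  so moving two numbers with fixed sum towards each other strictly decreases the sum of their
  images. Here \<open>(t, s)\<close> is the wider and \<open>(t', s')\<close> the narrower pair.\<close>

lemma powr_pair_sum_unique_less:
  fixes t s t' s' a b :: real
  assumes ab: "0 < a" "a < b" and pos: "0 < t" "t < t'" "t' < s'" 
    and 1: "t powr a + s powr a = t' powr a + s' powr a"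
    and 2: "t powr b + s powr b = t' powr b + s' powr b" and s: "0 < s"
  shows False
proof -
  define k where "k = b / a"
  have k: "1 < k" using ab by (simp add: k_def)
  have pk: "x powr b = (x powr a) powr k" for x :: real
    using ab by (simp add: powr_powr k_def)
  have lt: "t powr a < t' powr a" "t' powr a < s' powr a" using pos ab by (auto intro!: powr_less_mono2)
  have v: "s' powr a < s powr a" using 1 lt by linarith
  have p0: "0 < t powr a" using pos by simp
  have d: "((\<lambda>x. x powr k) has_real_derivative k * x powr (k - 1)) (at x)" if "0 < x" for x
    using that by (rule has_real_derivative_powr)
  obtain x where x: "t powr a < x" "x < t' powr a"
    "(t' powr a) powr k - (t powr a) powr k = (t' powr a - t powr a) * (k * x powr (k - 1))"
    using MVT2[OF lt(1), of "\<lambda>x. x powr k" "\<lambda>x. k * x powr (k - 1)"] d p0 by force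
  obtain y where y: "s' powr a < y" "y < s powr a"
    "(s powr a) powr k - (s' powr a) powr k = (s powr a - s' powr a) * (k * y powr (k - 1))"
    using MVT2[OF v, of "\<lambda>x. x powr k" "\<lambda>x. k * x powr (k - 1)"] d p0 lt by force
  have "x < y" using x y lt by linarith
  moreover have "0 < x" using x p0 by linarith
  ultimately have "x powr (k - 1) < y powr (k - 1)" using k by (intro powr_less_mono2) auto
  moreover have "(t' powr a - t powr a) * (k * x powr (k - 1)) = (t' powr a - t powr a) * (k * y powr (k - 1))"
    using x(3) y(3) 1 2 unfolding pk by (smt (verit))
  ultimately show False using lt(1) k by simp
qed

lemma powr_pair_sum_unique:
  fixes t s t' s' a b :: real
  assumes ab: "0 < a" "a < b" and pos: "0 < t" "t < s" "0 < t'" "t' < s'" 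
    and 1: "t powr a + s powr a = t' powr a + s' powr a"
    and 2: "t powr b + s powr b = t' powr b + s' powr b"
  shows "t = t'" "s = s'"
proof -
  show "t = t'"
    using powr_pair_sum_unique_less[OF ab, of t t' s' s] powr_pair_sum_unique_less[OF ab, of t' t s s'] assms
    by (metis linorder_neqE_linordered_idom order.strict_trans)
  then have "s powr a = s' powr a" using 1 by simp
  then show "s = s'" using ab pos
    by (metis less_trans linorder_neqE_linordered_idom nless_le powr_less_mono2)
qed

definition dilate :: "plane \<Rightarrow> real \<Rightarrow> plane \<Rightarrow> plane" where
  "dilate \<beta> \<rho> x = (\<rho> powr fst \<beta> * fst x, \<rho> powr snd \<beta> * snd x)"

definition rectangle :: "plane \<Rightarrow> plane \<Rightarrow> plane set" where
  "rectangle l u = {fst l..fst u} \<times> {snd l..snd u}"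

lemma mem_rectangle_centered:
  "y \<in> rectangle (- c - (k, k)) (- c + (k, k)) \<longleftrightarrow> \<bar>fst y + fst c\<bar> \<le> k \<and> \<bar>snd y + snd c\<bar> \<le> k"
  by (cases y; cases c) (auto simp: rectangle_def abs_le_iff)

text \<open>The configuration in which two steps lead from \<open>Q\<close> through \<open>P\<close> to \<open>W\<close>. The parameters of
  both steps stay in a compact interval, away from the singularity at \<open>0\<close> once \<open>0 < a\<close>, and
  every point of \<open>W\<close> is reached from every point of \<open>Q\<close>. The order \<open>t < s\<close> selects one of the
  two solutions \<open>(t, s)\<close>, \<open>(s, t)\<close>: the Jacobian changes sign under the exchange, so that their
  contributions would cancel.\<close>

definition transversal_triple ::
    "(real \<Rightarrow> plane) \<Rightarrow> real \<Rightarrow> real \<Rightarrow> plane set \<Rightarrow> plane set \<Rightarrow> plane set \<Rightarrow> bool" where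
  "transversal_triple \<gamma> a c Q P W \<longleftrightarrow>
     (\<forall>x\<in>Q. \<forall>t. x - \<gamma> t \<in> P \<longrightarrow> t \<in> {a..c}) \<and>
     (\<forall>y\<in>P. \<forall>s. y - \<gamma> s \<in> W \<longrightarrow> s \<in> {a..c}) \<and>
     (\<forall>x\<in>Q. \<forall>t s. x - \<gamma> t \<in> P \<longrightarrow> x - \<gamma> t - \<gamma> s \<in> W \<longrightarrow> t < s) \<and>
     (\<forall>x\<in>Q. \<forall>w\<in>W. \<exists>t s. 0 < t \<and> t < s \<and> x - \<gamma> t \<in> P \<and> x - \<gamma> t - \<gamma> s = w)"

locale monomial =
  fixes \<beta> \<epsilon> \<delta> :: plane
  assumes data: "monomial_data \<beta> \<epsilon> \<delta>"
begin

abbreviation \<gamma> :: "real \<Rightarrow> plane" where "\<gamma> \<equiv> monomial_curve \<beta> \<epsilon> \<delta>"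

lemma exponents: "0 < fst \<beta>" "fst \<beta> < snd \<beta>" "0 < snd \<beta>"
  using data by (auto simp: monomial_data_def)

lemma signs: "\<bar>fst \<epsilon>\<bar> = 1" "\<bar>snd \<epsilon>\<bar> = 1" "\<bar>fst \<delta>\<bar> = 1" "\<bar>snd \<delta>\<bar> = 1"
  "fst \<epsilon> \<noteq> 0" "snd \<epsilon> \<noteq> 0"
  using data by (auto simp: monomial_data_def)

lemma curve_pos: "0 < t \<Longrightarrow> \<gamma> t = (fst \<epsilon> * t powr fst \<beta>, snd \<epsilon> * t powr snd \<beta>)"
  by (simp add: monomial_curve_def)

lemma abs_curve: "\<bar>fst (\<gamma> t)\<bar> = \<bar>t\<bar> powr fst \<beta>" "\<bar>snd (\<gamma> t)\<bar> = \<bar>t\<bar> powr snd \<beta>"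
  using signs by (auto simp: monomial_curve_def abs_mult)

lemma borel_measurable_curve [measurable]: "\<gamma> \<in> borel_measurable borel"
  unfolding monomial_curve_def by measurable

lemma curve_dilate:
  assumes "0 < \<rho>"
  shows "\<gamma> (\<rho> * t) = dilate \<beta> \<rho> (\<gamma> t)"
proof -
  have "\<bar>\<rho> * t\<bar> powr e = \<rho> powr e * \<bar>t\<bar> powr e" for e
    using assms by (simp add: abs_mult powr_mult)
  moreover have "0 < \<rho> * t \<longleftrightarrow> 0 < t" using assms by (simp add: zero_less_mult_iff)
  ultimately show ?thesis
    by (cases "0 < t")
      (simp_all only: monomial_curve_def dilate_def if_True if_False fst_conv snd_conv mult.left_commute)
qed

text \<open>This is where the two branches of the curve must differ. If they coincided, the contributions
  of \<open>t\<close> and \<open>- t\<close> to the Hilbert transform would cancel; as they do not, the signs of both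
  coordinates of \<open>\<gamma> t\<close> together reveal the sign of \<open>t\<close>.\<close>

lemma curve_in_first_quadrant:
  assumes "0 < fst \<epsilon> * fst (\<gamma> t)" "0 < snd \<epsilon> * snd (\<gamma> t)"
  shows "0 < t"
proof (rule ccontr)
  assume "\<not> 0 < t"
  then have "0 < (fst \<epsilon> * fst \<delta>) * \<bar>t\<bar> powr fst \<beta>" "0 < (snd \<epsilon> * snd \<delta>) * \<bar>t\<bar> powr snd \<beta>"
    using assms by (auto simp: monomial_curve_def mult.assoc)
  then have "0 < fst \<epsilon> * fst \<delta>" "0 < snd \<epsilon> * snd \<delta>"
    using zero_less_mult_pos2 by (smt (verit) powr_ge_zero mult_nonpos_nonneg)+
  then show False using data by (auto simp: monomial_data_def)
qed

text \<open>A point of the curve near \<open>\<gamma> t0\<close> has the signs of \<open>\<gamma> t0\<close>, hence a positive parameter, which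
  is then determined by the first coordinate alone.\<close>

lemma curve_near:
  assumes near: "\<bar>fst (\<gamma> t) - fst (\<gamma> t0)\<bar> \<le> e" "\<bar>snd (\<gamma> t) - snd (\<gamma> t0)\<bar> \<le> e"
    and t0: "1 \<le> t0" and e: "e < 1" 
    and a: "0 < a" "a powr fst \<beta> \<le> t0 powr fst \<beta> - e" and c: "0 < c" "t0 powr fst \<beta> + e \<le> c powr fst \<beta>"
  shows "t \<in> {a..c}"
proof -
  have g0: "fst (\<gamma> t0) = fst \<epsilon> * t0 powr fst \<beta>" "snd (\<gamma> t0) = snd \<epsilon> * t0 powr snd \<beta>"
    using t0 by (auto simp: curve_pos)
  have ge: "1 \<le> t0 powr fst \<beta>" "1 \<le> t0 powr snd \<beta>" using t0 exponents by (auto intro: ge_one_powr_ge_zero)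
  have sg: "fst \<epsilon> = 1 \<or> fst \<epsilon> = -1" "snd \<epsilon> = 1 \<or> snd \<epsilon> = -1" using signs by linarith+
  have "0 < fst \<epsilon> * fst (\<gamma> t)" "0 < snd \<epsilon> * snd (\<gamma> t)" using near e ge sg unfolding g0 by auto
  then have t: "0 < t" by (rule curve_in_first_quadrant)
  then have gt: "fst (\<gamma> t) = fst \<epsilon> * t powr fst \<beta>" by (auto simp: curve_pos)
  have "\<bar>t powr fst \<beta> - t0 powr fst \<beta>\<bar> \<le> e"
    using near(1) sg unfolding gt g0 by auto
  then have "a powr fst \<beta> \<le> t powr fst \<beta>" "t powr fst \<beta> \<le> c powr fst \<beta>" using a c by auto
  then show ?thesis using t a c exponents
    by (metis atLeastAtMost_iff less_imp_le not_le powr_less_mono2)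
qed

definition wedge :: "plane set" where "wedge = {(t, s). 0 < t \<and> t < s}"

definition double_step :: "plane \<Rightarrow> plane" where "double_step z = \<gamma> (fst z) + \<gamma> (snd z)"

lemma open_wedge: "open wedge"
proof -
  have "wedge = {z. 0 < fst z} \<inter> {z. fst z < snd z}" by (auto simp: wedge_def)
  moreover have "open \<dots>" by (intro open_Int open_Collect_less continuous_intros)
  ultimately show ?thesis by simp
qed

lemma inj_on_double_step: "inj_on double_step wedge"
proof (rule inj_onI)
  fix z z' assume z: "z \<in> wedge" "z' \<in> wedge" "double_step z = double_step z'"
  obtain t s t' s' where zz: "z = (t, s)" "z' = (t', s')" by fastforce
  have pos: "0 < t" "t < s" "0 < t'" "t' < s'" using z zz by (auto simp: wedge_def)
  have "fst \<epsilon> * (t powr fst \<beta> + s powr fst \<beta>) = fst \<epsilon> * (t' powr fst \<beta> + s' powr fst \<beta>)"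
     "snd \<epsilon> * (t powr snd \<beta> + s powr snd \<beta>) = snd \<epsilon> * (t' powr snd \<beta> + s' powr snd \<beta>)"
    using z(3) pos by (auto simp: double_step_def zz curve_pos distrib_left)
  then have "t powr fst \<beta> + s powr fst \<beta> = t' powr fst \<beta> + s' powr fst \<beta>"
     "t powr snd \<beta> + s powr snd \<beta> = t' powr snd \<beta> + s' powr snd \<beta>"
    using signs by auto
  then show "z = z'" using powr_pair_sum_unique[OF exponents(1,2) pos] zz by simp
qed

lemma curve_has_derivative:
  assumes "0 < t"
  shows "(\<gamma> has_derivative (\<lambda>h. ((fst \<beta> * fst (\<gamma> t) / t) * h, (snd \<beta> * snd (\<gamma> t) / t) * h))) (at t)"
proof -
  have "((\<lambda>t. (fst \<epsilon> * t powr fst \<beta>, snd \<epsilon> * t powr snd \<beta>)) has_derivative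
     (\<lambda>h. ((fst \<beta> * fst (\<gamma> t) / t) * h, (snd \<beta> * snd (\<gamma> t) / t) * h))) (at t)"
    using assms
    by (auto intro!: derivative_eq_intros simp: curve_pos powr_diff field_simps)
  then show ?thesis
    by (rule has_derivative_transform_within_open[where s="{0<..}"]) (use assms in \<open>auto simp: curve_pos\<close>)
qed

lemma double_step_has_derivative:
  assumes "z \<in> wedge"
  shows "(double_step has_derivative
     (\<lambda>h. ((fst \<beta> * fst (\<gamma> (fst z)) / fst z) * fst h, (snd \<beta> * snd (\<gamma> (fst z)) / fst z) * fst h)
        + ((fst \<beta> * fst (\<gamma> (snd z)) / snd z) * snd h, (snd \<beta> * snd (\<gamma> (snd z)) / snd z) * snd h))) (at z)"
proof -
  have p: "0 < fst z" "0 < snd z" using assms by (auto simp: wedge_def)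
  have 1: "((\<lambda>z. \<gamma> (fst z)) has_derivative (\<lambda>h. ((fst \<beta> * fst (\<gamma> (fst z)) / fst z) * fst h, (snd \<beta> * snd (\<gamma> (fst z)) / fst z) * fst h))) (at z)"
    using has_derivative_compose[OF has_derivative_fst[OF has_derivative_ident] curve_has_derivative[OF p(1)]] .
  have 2: "((\<lambda>z. \<gamma> (snd z)) has_derivative (\<lambda>h. ((fst \<beta> * fst (\<gamma> (snd z)) / snd z) * snd h, (snd \<beta> * snd (\<gamma> (snd z)) / snd z) * snd h))) (at z)"
    using has_derivative_compose[OF has_derivative_snd[OF has_derivative_ident] curve_has_derivative[OF p(2)]] .
  show ?thesis unfolding double_step_def[abs_def] using has_derivative_add[OF 1 2] .
qed

lemma continuous_on_double_step: "continuous_on wedge double_step"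
  by (meson continuous_at_imp_continuous_on double_step_has_derivative has_derivative_continuous)

lemma transversal_triple_dilate:
  assumes T: "transversal_triple \<gamma> a c Q P W" and \<rho>: "0 < \<rho>"
  shows "transversal_triple \<gamma> (\<rho> * a) (\<rho> * c) ((\<lambda>u. z + dilate \<beta> \<rho> u) ` Q)
    ((\<lambda>u. z + dilate \<beta> \<rho> u) ` P) ((\<lambda>u. z + dilate \<beta> \<rho> u) ` W)"
proof -
  define f where "f u = z + dilate \<beta> \<rho> u" for u
  have inj: "f u = f v \<longleftrightarrow> u = v" for u v
    using \<rho> by (auto simp: f_def dilate_def prod_eq_iff)
  have sub: "f u - \<gamma> (\<rho> * t) = f (u - \<gamma> t)" for u t
    using \<rho> by (simp add: f_def curve_dilate) (simp add: dilate_def algebra_simps)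
  have t: "t = \<rho> * (t / \<rho>)" for t using \<rho> by simp
  have sub2: "f u - \<gamma> t \<in> f ` A \<longleftrightarrow> u - \<gamma> (t / \<rho>) \<in> A" for u t A
    by (subst t, subst sub) (auto simp: inj)
  have sub3: "f u - \<gamma> t = f (u - \<gamma> (t / \<rho>))" for u t by (subst t, subst sub) auto
  have "transversal_triple \<gamma> (\<rho> * a) (\<rho> * c) (f ` Q) (f ` P) (f ` W)"
    unfolding transversal_triple_def
  proof (intro conjI ballI allI impI)
    fix x' t assume "x' \<in> f ` Q" "x' - \<gamma> t \<in> f ` P"
    moreover from this obtain x where "x' = f x" "x \<in> Q" by blast
    ultimately have "x \<in> Q" "x - \<gamma> (t / \<rho>) \<in> P" by (simp_all add: sub2)
    then have "t / \<rho> \<in> {a..c}" using T unfolding transversal_triple_def by blast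
    then show "t \<in> {\<rho> * a..\<rho> * c}" using \<rho> by (auto simp: field_simps)
  next
    fix x' t assume "x' \<in> f ` P" "x' - \<gamma> t \<in> f ` W"
    moreover from this obtain x where "x' = f x" "x \<in> P" by blast
    ultimately have "x \<in> P" "x - \<gamma> (t / \<rho>) \<in> W" by (simp_all add: sub2)
    then have "t / \<rho> \<in> {a..c}" using T unfolding transversal_triple_def by blast
    then show "t \<in> {\<rho> * a..\<rho> * c}" using \<rho> by (auto simp: field_simps)
  next
    fix t s x' assume "x' \<in> f ` Q" "x' - \<gamma> t \<in> f ` P" "x' - \<gamma> t - \<gamma> s \<in> f ` W"
    moreover from this obtain x where "x' = f x" "x \<in> Q" by blast
    ultimately have "x \<in> Q" "x - \<gamma> (t / \<rho>) \<in> P" "x - \<gamma> (t / \<rho>) - \<gamma> (s / \<rho>) \<in> W"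
      by (simp_all add: sub2) (simp add: sub3 image_iff inj)
    then have "t / \<rho> < s / \<rho>" using T unfolding transversal_triple_def by blast
    then show "t < s" using \<rho> by (auto simp: field_simps)
  next
    fix x' w' assume "x' \<in> f ` Q" "w' \<in> f ` W"
    then obtain x w where x: "x' = f x" "x \<in> Q" "w' = f w" "w \<in> W" by blast
    then obtain t s where "0 < t" "t < s" "x - \<gamma> t \<in> P" "x - \<gamma> t - \<gamma> s = w"
      using T unfolding transversal_triple_def by blast
    then show "\<exists>t s. 0 < t \<and> t < s \<and> x' - \<gamma> t \<in> f ` P \<and> x' - \<gamma> t - \<gamma> s = w'"
      using \<rho> x by (intro exI[of _ "\<rho> * t"] exI[of _ "\<rho> * s"]) (auto simp: sub)
  qed
  then show ?thesis by (simp add: f_def[abs_def])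
qed

text \<open>The two steps start from the parameters \<open>1\<close> and \<open>2\<close>, where the tangents of the curve are
  transversal. Invariance of domain, applied to the injective map \<open>double_step\<close>, provides the
  open set of end points.\<close>

lemma exists_transversal_triple:
  obtains h pl pu wl wu where "0 < h" "fst wl < fst wu" "snd wl < snd wu"
    "transversal_triple \<gamma> (1/2) 3 (rectangle 0 (h powr fst \<beta>, h powr snd \<beta>))
       (rectangle pl pu) (rectangle wl wu)"
proof -
  let ?b = "fst \<beta>"
  have b: "0 < ?b" using exponents by simp
  have h1: "(1/2) powr ?b < 1" using b using powr_less_mono2[of ?b "1/2" 1] by simp
  have h2: "1 < (3/2::real) powr ?b" "(3/2) powr ?b < 2 powr ?b" "2 powr ?b < 3 powr ?b"
    using b by (auto intro!: powr_less_mono2 simp: gr_one_powr)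
  \<comment> \<open>\<open>e\<close> is so small that points within \<open>e\<close> of \<open>\<gamma> 1\<close> and of \<open>\<gamma> 2\<close> have parameters in
    the intervals \<open>{1/2..m1}\<close> and \<open>{m2..3}\<close>, which \<open>m1 < m2 = 3/2\<close> makes disjoint.\<close>
  define e where "e = Min {1/2, 1 - (1/2) powr ?b, ((3/2) powr ?b - 1)/2, (2 powr ?b - (3/2) powr ?b)/2, 3 powr ?b - 2 powr ?b}"
  have e: "0 < e" "e < 1" "(1/2) powr ?b \<le> 1 - e" "1 + e < (3/2) powr ?b"
    "(3/2) powr ?b < 2 powr ?b - e" "2 powr ?b + e \<le> 3 powr ?b"
  proof -
    show "0 < e" using h1 h2 by (simp add: e_def)
    have "e \<le> 1/2" "e \<le> 1 - (1/2) powr ?b" "e \<le> ((3/2) powr ?b - 1)/2"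
      "e \<le> (2 powr ?b - (3/2) powr ?b)/2" "e \<le> 3 powr ?b - 2 powr ?b"
      unfolding e_def by (rule Min_le; simp)+
    then show "e < 1" "(1/2) powr ?b \<le> 1 - e" "1 + e < (3/2) powr ?b"
    "(3/2) powr ?b < 2 powr ?b - e" "2 powr ?b + e \<le> 3 powr ?b"
      using h1 h2 by (simp_all add: field_simps)
  qed
  obtain m1 m2 where m: "1 + e \<le> m1 powr ?b" "0 < m1" "m1 < m2" "m2 powr ?b \<le> 2 powr ?b - e"
  proof -
    define m1 where "m1 = (1 + e) powr (1 / ?b)"
    show ?thesis
    proof (rule that[of m1 "3/2"])
      have m1: "m1 powr ?b = 1 + e" using b e by (simp add: m1_def powr_powr)
      then show "1 + e \<le> m1 powr ?b" "0 < m1" using e by (auto simp: m1_def)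
      have "0 < m1" using e by (auto simp: m1_def)
      then show "m1 < 3/2" using powr_less_cancel2[of ?b m1 "3/2"] m1 e b by simp
      show "(3/2) powr ?b \<le> 2 powr ?b - e" using e by simp
    qed
  qed
  \<comment> \<open>\<open>P\<close> has to contain \<open>x - \<gamma> t\<close> for the solutions \<open>(t, s)\<close>, so \<open>t\<close> is confined to a
    neighbourhood \<open>|t - 1| < d\<close> before the image of the wedge is taken.\<close>
  have g0: "fst (\<gamma> 1) = fst \<epsilon>" "snd (\<gamma> 1) = snd \<epsilon>" by (auto simp: curve_pos)
  have cont: "isCont \<gamma> 1" using curve_has_derivative[of 1] has_derivative_continuous by force
  then obtain d where d: "0 < d" "\<And>t. dist t 1 < d \<Longrightarrow> dist (\<gamma> t) (\<gamma> 1) < e/2"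
    using e(1) unfolding continuous_at_eps_delta by (metis half_gt_zero)
  define U where "U = wedge \<inter> ({1 - d<..<1 + d} \<times> UNIV)"
  have "open U" unfolding U_def by (intro open_Int open_wedge open_Times) auto
  have opn: "open (double_step ` U)"
  proof (rule invariance_of_domain[OF _ \<open>open U\<close>])
    show "continuous_on U double_step" using continuous_on_double_step by (rule continuous_on_subset) (auto simp: U_def)
    show "inj_on double_step U" using inj_on_double_step by (rule inj_on_subset) (auto simp: U_def)
  qed
  let ?c = "\<gamma> 1 + \<gamma> 2"
  have "(1, 2) \<in> U" using d by (auto simp: U_def wedge_def)
  then have "?c \<in> double_step ` U" by (force simp: double_step_def)
  then obtain r where r: "0 < r" "ball ?c r \<subseteq> double_step ` U" using opn openE by blast
  \<comment> \<open>\<open>e/2\<close> for the variation of \<open>\<gamma> t\<close> plus \<open>k \<le> e/4\<close> for that of \<open>x\<close> fits into \<open>P\<close>, whose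
    half-width is \<open>3e/4\<close>; another \<open>e/4\<close> for \<open>x\<close> or \<open>w\<close> leads to the tolerance \<open>e\<close>.
    The differences \<open>x - w\<close> vary by at most \<open>2k\<close> in each coordinate, within a ball of radius \<open>r\<close>.\<close>
  define k where "k = min (e/4) (r/8)"
  have k: "0 < k" "k \<le> e/4" "4 * k < r" using r e by (auto simp: k_def)
  define h where "h = min (k powr (1 / fst \<beta>)) (k powr (1 / snd \<beta>))"
  have h: "0 < h" "h powr fst \<beta> \<le> k" "h powr snd \<beta> \<le> k"
  proof -
    show h0: "0 < h" using k by (simp add: h_def)
    have "h powr fst \<beta> \<le> (k powr (1 / fst \<beta>)) powr fst \<beta>" using exponents h0 by (intro powr_mono2) (auto simp: h_def)
    then show "h powr fst \<beta> \<le> k" using exponents k by (simp add: powr_powr)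
    have "h powr snd \<beta> \<le> (k powr (1 / snd \<beta>)) powr snd \<beta>" using exponents h0 by (intro powr_mono2) (auto simp: h_def)
    then show "h powr snd \<beta> \<le> k" using exponents k by (simp add: powr_powr)
  qed
  let ?Q = "rectangle 0 (h powr fst \<beta>, h powr snd \<beta>)"
  let ?P = "rectangle (- \<gamma> 1 - (3*e/4, 3*e/4)) (- \<gamma> 1 + (3*e/4, 3*e/4))"
  let ?W = "rectangle (- ?c - (k, k)) (- ?c + (k, k))"
  have Q: "0 \<le> fst x \<and> fst x \<le> k \<and> 0 \<le> snd x \<and> snd x \<le> k" if "x \<in> ?Q" for x
    using that h by (auto simp: rectangle_def)
  have P: "y \<in> ?P \<longleftrightarrow> \<bar>fst y + fst (\<gamma> 1)\<bar> \<le> 3*e/4 \<and> \<bar>snd y + snd (\<gamma> 1)\<bar> \<le> 3*e/4" for y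
    by (rule mem_rectangle_centered)
  have W: "y \<in> ?W \<longleftrightarrow> \<bar>fst y + fst ?c\<bar> \<le> k \<and> \<bar>snd y + snd ?c\<bar> \<le> k" for y
    by (rule mem_rectangle_centered)
  have G1: "t \<in> {1/2..m1}" if "x \<in> ?Q" "x - \<gamma> t \<in> ?P" for x t
  proof (rule curve_near[of _ 1 e])
    show "\<bar>fst (\<gamma> t) - fst (\<gamma> 1)\<bar> \<le> e" "\<bar>snd (\<gamma> t) - snd (\<gamma> 1)\<bar> \<le> e"
      using Q[OF that(1)] that(2)[unfolded P fst_diff snd_diff] k by linarith+
  qed (use e m in auto)
  have G2: "s \<in> {m2..3}" if "y \<in> ?P" "y - \<gamma> s \<in> ?W" for y s
  proof (rule curve_near[of _ 2 e])
    show "\<bar>fst (\<gamma> s) - fst (\<gamma> 2)\<bar> \<le> e" "\<bar>snd (\<gamma> s) - snd (\<gamma> 2)\<bar> \<le> e"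
      using that(1)[unfolded P] that(2)[unfolded W fst_diff snd_diff fst_add snd_add] k by linarith+
  qed (use e m in auto)
  have G4: "\<exists>t s. 0 < t \<and> t < s \<and> x - \<gamma> t \<in> ?P \<and> x - \<gamma> t - \<gamma> s = w" if "x \<in> ?Q" "w \<in> ?W" for x w
  proof -
    have b1: "\<bar>fst (x - w - ?c)\<bar> \<le> 2 * k" "\<bar>snd (x - w - ?c)\<bar> \<le> 2 * k"
      using Q[OF that(1)] that(2)[unfolded W] unfolding fst_diff snd_diff fst_add snd_add by linarith+
    have "norm (x - w - ?c) \<le> \<bar>fst (x - w - ?c)\<bar> + \<bar>snd (x - w - ?c)\<bar>"
      using norm_Pair_le[of "fst (x - w - ?c)" "snd (x - w - ?c)"]
      by (simp only: prod.collapse real_norm_def)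
    also have "\<dots> < r" using b1 k by linarith
    finally have "x - w \<in> ball ?c r" by (simp add: dist_norm norm_minus_commute)
    then have "x - w \<in> double_step ` U" using r(2) by (rule subsetD[rotated])
    then obtain t s where ts: "(t, s) \<in> U" "double_step (t, s) = x - w" by (metis imageE surj_pair)
    have tt: "dist t 1 < d" "0 < t" "t < s" using ts by (auto simp: U_def wedge_def dist_real_def)
    have "dist (\<gamma> t) (\<gamma> 1) < e/2" using d tt by blast
    then have "\<bar>fst (\<gamma> t) - fst (\<gamma> 1)\<bar> \<le> e/2" "\<bar>snd (\<gamma> t) - snd (\<gamma> 1)\<bar> \<le> e/2"
      using dist_fst_le[of "\<gamma> t" "\<gamma> 1"] dist_snd_le[of "\<gamma> t" "\<gamma> 1"] by (auto simp: dist_real_def)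
    then have "x - \<gamma> t \<in> ?P" using Q[OF that(1)] k unfolding P fst_diff snd_diff by linarith
    moreover have "x - \<gamma> t - \<gamma> s = w" using ts(2) by (simp add: double_step_def algebra_simps)
    ultimately show ?thesis using tt by blast
  qed
  have mm: "1/2 \<le> m2" "m1 \<le> 3"
  proof -
    have "m1 powr ?b < m2 powr ?b" using m b by (intro powr_less_mono2) auto
    then have "m1 powr ?b < 3 powr ?b" using m e by linarith
    then show "m1 \<le> 3" using powr_less_cancel2[of ?b m1 3] b m by simp
    have "(1/2) powr ?b < m1 powr ?b" using m e h1 by linarith
    then show "1/2 \<le> m2" using powr_less_cancel2[of ?b "1/2" m1] b m by simp
  qed
  have "transversal_triple \<gamma> (1/2) 3 ?Q ?P ?W"
    unfolding transversal_triple_def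
  proof (intro conjI ballI allI impI)
    fix x t assume "x \<in> ?Q" "x - \<gamma> t \<in> ?P" from G1[OF this] show "t \<in> {1/2..3}" using mm by auto
  next
    fix x t assume "x \<in> ?P" "x - \<gamma> t \<in> ?W" from G2[OF this] show "t \<in> {1/2..3}" using mm by auto
  next
    fix x t s assume "x \<in> ?Q" "x - \<gamma> t \<in> ?P" "x - \<gamma> t - \<gamma> s \<in> ?W"
    then show "t < s" using G1[of x t] G2[of "x - \<gamma> t" s] m by auto
  qed (use G4 in blast)
  with h k show ?thesis by (intro that[of h]) auto
qed

end

section \<open>Integrals along a curve\<close>

lemma distr_lborel_reflect:
  fixes x :: "'a::euclidean_space"
  shows "distr lborel borel (\<lambda>v. x - v) = lborel"
  using lborel_affine[of "-1" x] by (simp add: density_1)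

lemma distr_lborel_shift:
  fixes v :: "'a::euclidean_space"
  shows "distr lborel borel (\<lambda>x. x - v) = lborel"
  using lborel_affine[of 1 "-v"] by (simp add: density_1)

lemma nn_integral_lborel_shift:
  fixes v :: "'a::euclidean_space"
  assumes [measurable]: "f \<in> borel_measurable borel"
  shows "(\<integral>\<^sup>+x. f (x - v) \<partial>lborel) = (\<integral>\<^sup>+x. f x \<partial>lborel)"
  by (subst (2) distr_lborel_shift[of v, symmetric]) (simp add: nn_integral_distr)

text \<open>Tonelli and translation invariance. Averages along the curve are thus controlled for almost
  every starting point, which replaces the pointwise control that a curve, as a null set, does not
  offer.\<close>

lemma nn_integral_curve_average:
  fixes \<gamma> :: "real \<Rightarrow> plane" and k :: "real \<Rightarrow> ennreal"
  assumes [measurable]: "f \<in> borel_measurable borel" "k \<in> borel_measurable borel" "\<gamma> \<in> borel_measurable borel"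
  shows "(\<integral>\<^sup>+x. \<integral>\<^sup>+t. k t * f (x - \<gamma> t) \<partial>lborel \<partial>lborel)
       = (\<integral>\<^sup>+t. k t \<partial>lborel) * (\<integral>\<^sup>+x. f x \<partial>lborel)"
proof -
  have "(\<integral>\<^sup>+x. \<integral>\<^sup>+t. k t * f (x - \<gamma> t) \<partial>lborel \<partial>lborel)
     = (\<integral>\<^sup>+t. \<integral>\<^sup>+x. k t * f (x - \<gamma> t) \<partial>lborel \<partial>lborel)"
    by (rule lborel_pair.Fubini'[symmetric]) measurable
  also have "\<dots> = (\<integral>\<^sup>+t. k t * (\<integral>\<^sup>+x. f x \<partial>lborel) \<partial>lborel)"
    by (intro nn_integral_cong) (simp add: nn_integral_cmult nn_integral_lborel_shift)
  also have "\<dots> = (\<integral>\<^sup>+t. k t \<partial>lborel) * (\<integral>\<^sup>+x. f x \<partial>lborel)"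
    by (simp add: nn_integral_multc)
  finally show ?thesis .
qed

lemma AE_along_curve:
  fixes \<gamma> :: "real \<Rightarrow> plane"
  assumes [measurable]: "\<gamma> \<in> borel_measurable borel" and ae: "AE y in lborel. R y"
  shows "AE x in lborel. AE t in lborel. R (x - \<gamma> t)"
proof -
  obtain N where N: "N \<in> null_sets lborel" "{y. \<not> R y} \<subseteq> N"
    using ae by (auto elim!: AE_E simp: null_sets_def)
  have [measurable]: "N \<in> sets borel" using N by auto
  have "(\<integral>\<^sup>+x. \<integral>\<^sup>+t. 1 * indicator N (x - \<gamma> t) \<partial>lborel \<partial>lborel) = (\<integral>\<^sup>+t. 1 \<partial>(lborel :: real measure)) * (\<integral>\<^sup>+x. indicator N x \<partial>lborel)"
    by (rule nn_integral_curve_average) measurable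
  also have "(\<integral>\<^sup>+x. indicator N x \<partial>lborel) = 0" using N by (simp add: null_sets_def)
  finally have "(\<integral>\<^sup>+x. \<integral>\<^sup>+t. indicator N (x - \<gamma> t) \<partial>lborel \<partial>lborel) = 0" by simp
  then have "AE x in lborel. (\<integral>\<^sup>+t. indicator N (x - \<gamma> t) \<partial>lborel) = 0"
    by (subst (asm) nn_integral_0_iff_AE) measurable
  then show ?thesis
  proof eventually_elim
    case (elim x)
    then have "AE t in lborel. indicator N (x - \<gamma> t) = (0::ennreal)"
      by (subst (asm) nn_integral_0_iff_AE) measurable
    then show ?case by eventually_elim (use N(2) in \<open>auto simp: indicator_def split: if_splits\<close>)
  qed
qed

lemma AE_integrable_along_curve:
  fixes \<gamma> :: "real \<Rightarrow> plane" and b :: "plane \<Rightarrow> complex"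
  assumes [measurable]: "\<gamma> \<in> borel_measurable borel" and b: "integrable lborel b"
  shows "AE x in lborel. integrable lborel (\<lambda>t. indicator {a..c} t *\<^sub>R b (x - \<gamma> t))"
proof -
  have [measurable]: "b \<in> borel_measurable borel" using borel_measurable_integrable[OF b] by simp
  have "(\<integral>\<^sup>+x. \<integral>\<^sup>+t. indicator {a..c} t * ennreal (norm (b (x - \<gamma> t))) \<partial>lborel \<partial>lborel)
      = (\<integral>\<^sup>+t. indicator {a..c} t \<partial>lborel) * (\<integral>\<^sup>+x. ennreal (norm (b x)) \<partial>lborel)"
    by (rule nn_integral_curve_average) measurable
  also have "\<dots> < \<infinity>"
    using b by (auto simp: integrable_iff_bounded ennreal_mult_less_top emeasure_lborel_Icc_eq)
  finally have "AE x in lborel. (\<integral>\<^sup>+t. indicator {a..c} t * ennreal (norm (b (x - \<gamma> t))) \<partial>lborel) \<noteq> \<infinity>"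
    by (intro nn_integral_PInf_AE) auto
  then show ?thesis
  proof eventually_elim
    case (elim x)
    show ?case
    proof (rule integrableI_bounded)
      have "(\<integral>\<^sup>+t. ennreal (norm (indicator {a..c} t *\<^sub>R b (x - \<gamma> t))) \<partial>lborel)
         = (\<integral>\<^sup>+t. indicator {a..c} t * ennreal (norm (b (x - \<gamma> t))) \<partial>lborel)"
        by (intro nn_integral_cong) (auto simp: indicator_def)
      then show "(\<integral>\<^sup>+t. ennreal (norm (indicator {a..c} t *\<^sub>R b (x - \<gamma> t))) \<partial>lborel) < \<infinity>"
        using elim by (simp add: top.not_eq_extremum)
    qed measurable
  qed
qed

lemma integrable_bounded_kernel:
  fixes u :: "real \<Rightarrow> complex"
  assumes u: "integrable lborel (\<lambda>t. indicator {a..c} t *\<^sub>R u t)"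
    and [measurable]: "k \<in> borel_measurable borel" "u \<in> borel_measurable borel"
    and k: "\<And>t. cmod (k t) \<le> K * indicator {a..c} t"
  shows "integrable lborel (\<lambda>t. u t * k t)" "integrable lborel (\<lambda>t. w * k t)"
proof -
  show "integrable lborel (\<lambda>t. u t * k t)"
  proof (rule Bochner_Integration.integrable_bound[of _ "\<lambda>t. K *\<^sub>R (indicator {a..c} t *\<^sub>R u t)"])
    show "AE t in lborel. norm (u t * k t) \<le> norm (K *\<^sub>R indicator {a..c} t *\<^sub>R u t)"
    proof (intro AE_I2)
      fix t
      have "norm (u t * k t) \<le> norm (u t) * (K * indicator {a..c} t)"
        unfolding norm_mult using k by (intro mult_left_mono) auto
      also have "\<dots> \<le> norm (u t) * (\<bar>K\<bar> * indicator {a..c} t)"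
        by (intro mult_left_mono mult_right_mono) auto
      finally show "norm (u t * k t) \<le> norm (K *\<^sub>R indicator {a..c} t *\<^sub>R u t)"
        by (simp add: mult_ac abs_mult)
    qed
    show "integrable lborel (\<lambda>t. K *\<^sub>R (indicator {a..c} t *\<^sub>R u t))"
      using u by (rule integrable_scaleR_right)
  qed measurable
  show "integrable lborel (\<lambda>t. w * k t)"
  proof (rule Bochner_Integration.integrable_bound[of _ "\<lambda>t. (cmod w * K) * indicator {a..c} t"])
    show "integrable lborel (\<lambda>t. (cmod w * K) * indicator {a..c} t)"
      by (intro integrable_mult_right integrable_real_indicator) (auto simp: emeasure_lborel_Icc_eq)
    show "AE t in lborel. norm (w * k t) \<le> norm (cmod w * K * indicator {a..c} t)"
    proof (intro AE_I2)
      fix t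
      have "norm (w * k t) \<le> norm w * (K * indicator {a..c} t)"
        unfolding norm_mult using k by (intro mult_left_mono) auto
      then show "norm (w * k t) \<le> norm (cmod w * K * indicator {a..c} t)"
        by (simp add: mult_ac)
    qed
  qed measurable
qed

text \<open>For \<open>m = 1\<close> this is the value of the commutator \<open>[b, H\<^sub>\<gamma>] f\<close> at \<open>x\<close>, provided that
  \<open>f (x - \<gamma> t)\<close> vanishes for \<open>t\<close> near \<open>0\<close>. The multiplier \<open>m\<close> will be a coordinate of \<open>\<gamma>\<close>.\<close>

definition curve_osc :: "(real \<Rightarrow> plane) \<Rightarrow> (plane \<Rightarrow> complex) \<Rightarrow> (plane \<Rightarrow> complex) \<Rightarrow> (real \<Rightarrow> real) \<Rightarrow> plane \<Rightarrow> complex" where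
  "curve_osc \<gamma> b f m x = (\<integral>t. (b x - b (x - \<gamma> t)) * (f (x - \<gamma> t) * complex_of_real (m t / t)) \<partial>lborel)"

lemma integrable_curve_osc:
  fixes \<gamma> :: "real \<Rightarrow> plane" and b f :: "plane \<Rightarrow> complex"
  assumes [measurable]: "\<gamma> \<in> borel_measurable borel" "b \<in> borel_measurable borel" "f \<in> borel_measurable borel"
      "m \<in> borel_measurable borel"
    and x: "integrable lborel (\<lambda>t. indicator {a..c} t *\<^sub>R b (x - \<gamma> t))"
    and a: "0 < a" and t: "\<And>t. x - \<gamma> t \<in> B \<Longrightarrow> t \<in> {a..c}"
    and f: "\<And>y. cmod (f y) \<le> K * indicator B y" and m: "\<And>t. t \<in> {a..c} \<Longrightarrow> \<bar>m t\<bar> \<le> G"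
  shows "integrable lborel (\<lambda>t. (b x - b (x - \<gamma> t)) * (f (x - \<gamma> t) * complex_of_real (m t / t)))"
proof -
  have bd: "cmod (f (x - \<gamma> t) * complex_of_real (m t / t)) \<le> (\<bar>K\<bar> * (\<bar>G\<bar> / a)) * indicator {a..c} t" for t
  proof (cases "x - \<gamma> t \<in> B")
    case True
    then have tac: "t \<in> {a..c}" using t by blast
    moreover have "cmod (f (x - \<gamma> t)) \<le> \<bar>K\<bar>" using f[of "x - \<gamma> t"] True by auto
    moreover have "\<bar>m t / t\<bar> \<le> \<bar>G\<bar> / a"
      using m[OF tac] tac a by (auto simp: abs_divide intro!: frac_le)
    ultimately show ?thesis by (simp only: norm_mult norm_of_real indicator_simps mult_1_right)
      (intro mult_mono, auto)
  next
    case False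
    then have "f (x - \<gamma> t) = 0" using f[of "x - \<gamma> t"] by auto
    then show ?thesis using a by simp
  qed
  show ?thesis
    unfolding left_diff_distrib
    by (rule Bochner_Integration.integrable_diff; rule integrable_bounded_kernel[OF x _ _ bd]) measurable
qed

text \<open>A coordinate \<open>\<pi> (\<gamma> t) = \<pi> x - \<pi> (x - \<gamma> t)\<close> splits into a function of \<open>x\<close>, which leaves the
  integral, and a function of \<open>x - \<gamma> t\<close>, which is absorbed into \<open>f\<close>. Subtracting the reference
  value \<open>o0\<close> from both makes these functions as small as the diameter of the configuration.\<close>

lemma curve_osc_coordinate_bound:
  fixes \<gamma> :: "real \<Rightarrow> plane" and b f :: "plane \<Rightarrow> complex" and \<pi> :: "plane \<Rightarrow> real"
  assumes \<gamma> [measurable]: "\<gamma> \<in> borel_measurable borel" and b: "integrable lborel b"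
    and \<pi>: "linear \<pi>" and [measurable]: "\<pi> \<in> borel_measurable borel" "A \<in> sets borel" "B \<in> sets borel"
    and D: "\<And>v. v \<in> A \<union> B \<Longrightarrow> \<bar>\<pi> v - o0\<bar> \<le> D" "0 \<le> D"
    and a: "0 < a" and t: "\<And>x t. x \<in> A \<Longrightarrow> x - \<gamma> t \<in> B \<Longrightarrow> t \<in> {a..c}"
    and test: "\<And>f M. f \<in> borel_measurable borel \<Longrightarrow> 0 \<le> M \<Longrightarrow> (\<And>y. cmod (f y) \<le> M * indicator B y) \<Longrightarrow>
        (\<integral>\<^sup>+x\<in>A. ennreal (cmod (curve_osc \<gamma> b f (\<lambda>_. 1) x)) \<partial>lborel) \<le> ennreal (M * E)"
    and f[measurable]: "f \<in> borel_measurable borel" and M: "0 \<le> M" "\<And>y. cmod (f y) \<le> M * indicator B y"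
    and E: "0 \<le> E"
  shows "(\<integral>\<^sup>+x\<in>A. ennreal (cmod (curve_osc \<gamma> b f (\<lambda>t. \<pi> (\<gamma> t)) x)) \<partial>lborel) \<le> ennreal (2 * D * M * E)"
proof -
  have [measurable]: "b \<in> borel_measurable borel" using borel_measurable_integrable[OF b] by simp
  define f' where "f' y = f y * complex_of_real (\<pi> y - o0)" for y
  have f'm[measurable]: "f' \<in> borel_measurable borel" unfolding f'_def by measurable
  have f'b: "cmod (f' y) \<le> (D * M) * indicator B y" for y
  proof (cases "y \<in> B")
    case True
    then have "cmod (f y) * \<bar>\<pi> y - o0\<bar> \<le> M * D" using M(1) M(2)[of y] D(1)[of y] by (intro mult_mono) auto
    then show ?thesis using True unfolding f'_def norm_mult norm_of_real by (simp add: mult.commute)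
  qed (use M(2)[of y] in \<open>auto simp: f'_def\<close>)
  have osc_meas [measurable]: "(\<lambda>x. curve_osc \<gamma> b g m x) \<in> borel_measurable borel"
    if [measurable]: "g \<in> borel_measurable borel" "m \<in> borel_measurable borel" for g m
    unfolding curve_osc_def by measurable
  have split: "AE x in lborel. x \<in> A \<longrightarrow> curve_osc \<gamma> b f (\<lambda>t. \<pi> (\<gamma> t)) x
       = complex_of_real (\<pi> x - o0) * curve_osc \<gamma> b f (\<lambda>_. 1) x - curve_osc \<gamma> b f' (\<lambda>_. 1) x"
    using AE_integrable_along_curve[OF \<gamma> b, of a c]
  proof eventually_elim
    case (elim x)
    show ?case
    proof
      assume x: "x \<in> A"
      have int: "integrable lborel (\<lambda>t. (b x - b (x - \<gamma> t)) * (g (x - \<gamma> t) * complex_of_real (1 / t)))"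
        if "g \<in> borel_measurable borel" "\<And>y. cmod (g y) \<le> K * indicator B y" for g K
        using elim a t[OF x] that by (intro integrable_curve_osc[where G=1 and B=B]) auto
      have "complex_of_real (\<pi> x - o0) * curve_osc \<gamma> b f (\<lambda>_. 1) x - curve_osc \<gamma> b f' (\<lambda>_. 1) x
        = (\<integral>t. complex_of_real (\<pi> x - o0) * ((b x - b (x - \<gamma> t)) * (f (x - \<gamma> t) * complex_of_real (1 / t)))
            - (b x - b (x - \<gamma> t)) * (f' (x - \<gamma> t) * complex_of_real (1 / t)) \<partial>lborel)"
        unfolding curve_osc_def
        by (simp only: Bochner_Integration.integral_diff[OF integrable_mult_right[OF int[OF f M(2)]] int[OF f'm f'b]]
            integral_mult_right_zero)
      also have "\<dots> = curve_osc \<gamma> b f (\<lambda>t. \<pi> (\<gamma> t)) x"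
        unfolding curve_osc_def
      proof (rule Bochner_Integration.integral_cong[OF refl])
        fix t
        have "\<pi> (\<gamma> t) = (\<pi> x - o0) - (\<pi> (x - \<gamma> t) - o0)" using \<pi> by (simp add: linear_diff)
        then have \<pi>t: "complex_of_real (\<pi> (\<gamma> t) / t) =
            (complex_of_real (\<pi> x - o0) - complex_of_real (\<pi> (x - \<gamma> t) - o0)) * complex_of_real (1 / t)"
          by (simp flip: of_real_diff of_real_mult of_real_divide)
        show "complex_of_real (\<pi> x - o0) * ((b x - b (x - \<gamma> t)) * (f (x - \<gamma> t) * complex_of_real (1 / t)))
            - (b x - b (x - \<gamma> t)) * (f' (x - \<gamma> t) * complex_of_real (1 / t))
            = (b x - b (x - \<gamma> t)) * (f (x - \<gamma> t) * complex_of_real (\<pi> (\<gamma> t) / t))"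
          unfolding f'_def \<pi>t by (simp only: algebra_simps)
      qed
      finally show "curve_osc \<gamma> b f (\<lambda>t. \<pi> (\<gamma> t)) x
         = complex_of_real (\<pi> x - o0) * curve_osc \<gamma> b f (\<lambda>_. 1) x - curve_osc \<gamma> b f' (\<lambda>_. 1) x" ..
    qed
  qed
  have "(\<integral>\<^sup>+x\<in>A. ennreal (cmod (curve_osc \<gamma> b f (\<lambda>t. \<pi> (\<gamma> t)) x)) \<partial>lborel)
     \<le> (\<integral>\<^sup>+x. ennreal D * (ennreal (cmod (curve_osc \<gamma> b f (\<lambda>_. 1) x)) * indicator A x)
         + ennreal (cmod (curve_osc \<gamma> b f' (\<lambda>_. 1) x)) * indicator A x \<partial>lborel)"
  proof (rule nn_integral_mono_AE, use split in eventually_elim)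
    case (elim x)
    show ?case
    proof (cases "x \<in> A")
      case True
      have "cmod (curve_osc \<gamma> b f (\<lambda>t. \<pi> (\<gamma> t)) x) \<le> \<bar>\<pi> x - o0\<bar> * cmod (curve_osc \<gamma> b f (\<lambda>_. 1) x)
          + cmod (curve_osc \<gamma> b f' (\<lambda>_. 1) x)"
        using elim True norm_triangle_ineq4 by (metis norm_mult norm_of_real real_norm_def)
      also have "\<dots> \<le> D * cmod (curve_osc \<gamma> b f (\<lambda>_. 1) x) + cmod (curve_osc \<gamma> b f' (\<lambda>_. 1) x)"
        using D(1)[of x] True by (intro add_right_mono mult_right_mono) auto
      finally show ?thesis using True D(2) by (simp add: ennreal_mult[symmetric] ennreal_plus[symmetric] ennreal_leI del: ennreal_plus)
    qed simp
  qed
  also have "\<dots> = ennreal D * (\<integral>\<^sup>+x\<in>A. ennreal (cmod (curve_osc \<gamma> b f (\<lambda>_. 1) x)) \<partial>lborel)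
         + (\<integral>\<^sup>+x\<in>A. ennreal (cmod (curve_osc \<gamma> b f' (\<lambda>_. 1) x)) \<partial>lborel)"
    by (subst nn_integral_add) (auto simp: nn_integral_cmult)
  also have "\<dots> \<le> ennreal D * ennreal (M * E) + ennreal ((D * M) * E)"
    using test[OF f M] test[OF f'm _ f'b] D(2) M(1) by (intro add_mono mult_left_mono) auto
  also have "\<dots> = ennreal (2 * D * M * E)"
    using D(2) M(1) E by (simp add: ennreal_mult[symmetric] ennreal_plus[symmetric] del: ennreal_plus)
  finally show ?thesis .
qed

section \<open>Two steps sweep out area\<close>

lemma borel_measurable_plane_coordinates [measurable (raw)]:
  fixes f :: "'a \<Rightarrow> plane"
  assumes "f \<in> borel_measurable M"
  shows "(\<lambda>x. fst (f x)) \<in> borel_measurable M" "(\<lambda>x. snd (f x)) \<in> borel_measurable M"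
  by (auto intro!: measurable_compose[OF assms] borel_measurable_continuous_onI continuous_intros)

context monomial
begin

text \<open>Up to the factor \<open>fst \<beta> * snd \<beta>\<close> this is the Jacobian of \<open>double_step\<close>, because
  \<open>\<gamma>\<^sub>i'(t) = \<beta>\<^sub>i \<gamma>\<^sub>i(t) / t\<close>.\<close>

definition area_kernel :: "real \<Rightarrow> real \<Rightarrow> real" where
  "area_kernel t s = (fst (\<gamma> t) * snd (\<gamma> s) - snd (\<gamma> t) * fst (\<gamma> s)) / (t * s)"

text \<open>The factor by which \<open>area_kernel\<close> becomes the absolute value of the Jacobian on the wedge.\<close>

definition orientation :: real where "orientation = fst \<epsilon> * snd \<epsilon> * fst \<beta> * snd \<beta>"

lemma orientation_abs: "\<bar>orientation\<bar> = fst \<beta> * snd \<beta>" "orientation \<noteq> 0"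
  using signs exponents by (auto simp: orientation_def abs_mult)

lemma orientation_area_kernel_nonneg:
  assumes "0 < t" "t < s"
  shows "0 \<le> orientation * area_kernel t s"
proof -
  have sq: "fst \<epsilon> * fst \<epsilon> = 1" "snd \<epsilon> * snd \<epsilon> = 1"
    using signs by (metis abs_mult_self_eq mult_1)+
  have "t powr snd \<beta> * s powr fst \<beta> \<le> t powr fst \<beta> * s powr snd \<beta>"
  proof -
    have "t powr snd \<beta> = t powr fst \<beta> * t powr (snd \<beta> - fst \<beta>)"
      "s powr snd \<beta> = s powr fst \<beta> * s powr (snd \<beta> - fst \<beta>)" by (simp_all flip: powr_add)
    moreover have "t powr (snd \<beta> - fst \<beta>) \<le> s powr (snd \<beta> - fst \<beta>)"
      using assms exponents by (intro powr_mono2) auto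
    ultimately show ?thesis by (simp add: mult_ac mult_left_mono)
  qed
  moreover have "orientation * area_kernel t s
      = fst \<beta> * snd \<beta> * (t powr fst \<beta> * s powr snd \<beta> - t powr snd \<beta> * s powr fst \<beta>) / (t * s)"
  proof -
    have "orientation * area_kernel t s
      = fst \<beta> * snd \<beta> * ((fst \<epsilon> * fst \<epsilon>) * (snd \<epsilon> * snd \<epsilon>)) * (t powr fst \<beta> * s powr snd \<beta> - t powr snd \<beta> * s powr fst \<beta>) / (t * s)"
      using assms by (simp add: orientation_def area_kernel_def curve_pos algebra_simps)
    then show ?thesis by (simp add: sq)
  qed
  ultimately show ?thesis using assms exponents by simp
qed

lemma borel_measurable_area_kernel [measurable]:
  assumes [measurable]: "f \<in> borel_measurable M" "g \<in> borel_measurable M"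
  shows "(\<lambda>z. area_kernel (f z) (g z)) \<in> borel_measurable M"
  unfolding area_kernel_def by measurable

lemma borel_measurable_double_step [measurable]: "double_step \<in> borel_measurable borel"
  unfolding double_step_def by measurable

text \<open>The change of variables \<open>w = x - \<gamma> t - \<gamma> s\<close>. For \<open>x \<in> Q\<close> and \<open>w \<in> W\<close> the condition
  \<open>x - \<gamma> t \<in> P\<close>, which is a test function at the intermediate point, singles out exactly the wedge
  \<open>0 < t < s\<close> on which the map is injective and its Jacobian has a constant sign.\<close>

lemma has_bochner_integral_double_step:
  fixes F :: "plane \<Rightarrow> complex"
  assumes T: "transversal_triple \<gamma> a c Q P W" and a: "0 < a"
    and W [measurable]: "W \<in> sets borel" "emeasure lborel W < \<infinity>" and P [measurable]: "P \<in> sets borel"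
    and x: "x \<in> Q" and F: "integrable lborel F"
  shows "has_bochner_integral lborel
      (\<lambda>z. (indicator P (x - \<gamma> (fst z)) * indicator W (x - double_step z) * area_kernel (fst z) (snd z)) *\<^sub>R F (x - double_step z))
      ((LINT w:W|lborel. F w) /\<^sub>R orientation)"
proof -
  have [measurable]: "F \<in> borel_measurable borel" using borel_measurable_integrable[OF F] by simp
  define C where "C = {v. x - v \<in> W}"
  have C[measurable]: "C \<in> sets borel" unfolding C_def by measurable
  have indC: "indicator C v = indicator W (x - v)" for v :: plane by (simp add: C_def indicator_def)
  have emC: "emeasure lborel C = emeasure lborel W"
  proof -
    have "emeasure lborel W = emeasure (distr lborel borel (\<lambda>v. x - v)) W" by (simp add: distr_lborel_reflect)
    also have "\<dots> = emeasure lborel C" by (subst emeasure_distr) (auto simp: C_def vimage_def)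
    finally show ?thesis ..
  qed
  define \<Phi>' where "\<Phi>' z h = ((fst \<beta> * fst (\<gamma> (fst z)) / fst z) * fst h, (snd \<beta> * snd (\<gamma> (fst z)) / fst z) * fst h)
        + ((fst \<beta> * fst (\<gamma> (snd z)) / snd z) * snd h, (snd \<beta> * snd (\<gamma> (snd z)) / snd z) * snd h)" for z h :: plane
  have jac: "jacobian2 (\<Phi>' z) = fst \<beta> * snd \<beta> * area_kernel (fst z) (snd z)" for z
    by (simp add: jacobian2_def \<Phi>'_def area_kernel_def field_simps diff_divide_distrib)
  have CU: "C \<subseteq> double_step ` wedge"
  proof
    fix v assume "v \<in> C"
    then have "x - v \<in> W" by (simp add: C_def)
    then obtain t s where ts: "0 < t" "t < s" "x - \<gamma> t - \<gamma> s = x - v"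
      using T x unfolding transversal_triple_def by blast
    then have "double_step (t, s) = v" by (simp add: double_step_def algebra_simps)
    then show "v \<in> double_step ` wedge" using ts by (auto simp: wedge_def image_iff)
  qed
  have wb[measurable]: "wedge \<in> sets borel" using open_wedge by auto
  let ?d = "\<lambda>z. indicator wedge z * indicator C (double_step z) * \<bar>jacobian2 (\<Phi>' z)\<bar>"
  have dist: "distr (density lborel (\<lambda>z. ennreal (?d z))) borel double_step = density lborel (indicator C)"
  proof (rule distr_density_jacobian2[OF wb C _ CU _ inj_on_double_step])
    show "emeasure lborel C < \<infinity>" using W by (simp add: emC)
    show "(double_step has_derivative \<Phi>' z) (at z)" if "z \<in> wedge" for z
      unfolding \<Phi>'_def using double_step_has_derivative[OF that] .
    show "(\<lambda>z. jacobian2 (\<Phi>' z)) \<in> borel_measurable borel" unfolding jac by measurable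
  qed measurable
  have [measurable]: "(\<lambda>z. jacobian2 (\<Phi>' z)) \<in> borel_measurable borel" unfolding jac by measurable
  have d_eq: "?d z = orientation * (indicator P (x - \<gamma> (fst z)) * indicator W (x - double_step z) * area_kernel (fst z) (snd z))" for z
  proof (cases "x - double_step z \<in> W")
    case inW: True
    obtain t s where z: "z = (t, s)" by fastforce
    have w: "x - double_step z = x - \<gamma> t - \<gamma> s" by (simp add: double_step_def z)
    have iff: "z \<in> wedge \<longleftrightarrow> x - \<gamma> t \<in> P"
    proof
      assume zw: "z \<in> wedge"
      obtain t' s' where ts: "0 < t'" "t' < s'" "x - \<gamma> t' \<in> P" "x - \<gamma> t' - \<gamma> s' = x - double_step z"
        using T x inW unfolding transversal_triple_def by blast
      then have "double_step (t', s') = double_step z" "(t', s') \<in> wedge"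
        by (simp_all add: double_step_def wedge_def algebra_simps)
      then have "(t', s') = z" using zw inj_on_double_step by (auto dest: inj_onD)
      then show "x - \<gamma> t \<in> P" using ts z by simp
    next
      assume "x - \<gamma> t \<in> P"
      then have "t \<in> {a..c}" "t < s" using T x inW unfolding transversal_triple_def w by blast+
      then show "z \<in> wedge" using a by (simp add: wedge_def z)
    qed
    show ?thesis
    proof (cases "z \<in> wedge")
      case True
      then have "0 \<le> orientation * area_kernel t s"
        using orientation_area_kernel_nonneg by (auto simp: wedge_def z)
      then have "\<bar>orientation\<bar> * \<bar>area_kernel t s\<bar> = orientation * area_kernel t s"
        by (simp flip: abs_mult)
      then have "\<bar>fst \<beta> * snd \<beta> * area_kernel t s\<bar> = orientation * area_kernel t s"
        using exponents by (simp add: abs_mult orientation_abs)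
      then show ?thesis using True iff inW by (simp add: z indC jac)
    qed (use iff in \<open>auto simp: z\<close>)
  qed (simp add: indC)
  have "has_bochner_integral lborel (\<lambda>v. indicator W v *\<^sub>R F v) (LINT w:W|lborel. F w)"
    using integrable_mult_indicator[OF _ F, of W] 
    by (simp add: has_bochner_integral_iff set_lebesgue_integral_def)
  then have "has_bochner_integral (distr lborel borel (\<lambda>v. x - v)) (\<lambda>v. indicator W v *\<^sub>R F v) (LINT w:W|lborel. F w)"
    by (simp add: distr_lborel_reflect)
  then have "has_bochner_integral lborel (\<lambda>v. indicator W (x - v) *\<^sub>R F (x - v)) (LINT w:W|lborel. F w)"
    by (subst (asm) has_bochner_integral_iff) (auto simp: has_bochner_integral_iff integrable_distr_eq integral_distr)
  then have "has_bochner_integral lborel (\<lambda>v. indicator C v *\<^sub>R F (x - v)) (LINT w:W|lborel. F w)"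
    by (simp add: indC)
  then have "has_bochner_integral (density lborel (\<lambda>v. ennreal (indicator C v))) (\<lambda>v. F (x - v)) (LINT w:W|lborel. F w)"
    by (subst has_bochner_integral_density) auto
  then have "has_bochner_integral (distr (density lborel (\<lambda>z. ennreal (?d z))) borel double_step) (\<lambda>v. F (x - v)) (LINT w:W|lborel. F w)"
    by (simp only: dist ennreal_indicator)
  then have "has_bochner_integral (density lborel (\<lambda>z. ennreal (?d z))) (\<lambda>z. F (x - double_step z)) (LINT w:W|lborel. F w)"
    by (subst (asm) has_bochner_integral_iff) (auto simp: has_bochner_integral_iff integrable_distr_eq integral_distr)
  then have "has_bochner_integral lborel (\<lambda>z. ?d z *\<^sub>R F (x - double_step z)) (LINT w:W|lborel. F w)"
    by (auto simp: has_bochner_integral_iff integrable_density integral_density)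
  then have "has_bochner_integral lborel (\<lambda>z. inverse orientation *\<^sub>R (?d z *\<^sub>R F (x - double_step z)))
     (inverse orientation *\<^sub>R (LINT w:W|lborel. F w))"
    by (rule has_bochner_integral_scaleR_right)
  then show ?thesis
    using orientation_abs(2) by (simp add: d_eq mult.assoc[symmetric])
qed

end

section \<open>Oscillation in terms of two commutator integrals\<close>

lemma integrable_tensor:
  fixes U :: "real \<Rightarrow> complex" and V :: "real \<Rightarrow> real"
  assumes U: "integrable lborel U" and V: "integrable lborel V"
  shows "integrable (lborel \<Otimes>\<^sub>M lborel) (\<lambda>(t, s). V s *\<^sub>R U t)"
proof (rule lborel_pair.Fubini_integrable)
  have [measurable]: "U \<in> borel_measurable borel" "V \<in> borel_measurable borel"
    using U V by (auto dest: borel_measurable_integrable)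
  show "(\<lambda>(t, s). V s *\<^sub>R U t) \<in> borel_measurable (lborel \<Otimes>\<^sub>M lborel)" by measurable
  show "integrable lborel (\<lambda>t. \<integral>s. norm (case (t, s) of (t, s) \<Rightarrow> V s *\<^sub>R U t) \<partial>lborel)"
    using U V by (simp add: integrable_norm)
qed (use V in auto)

lemma norm_integral_le_nn_integral:
  fixes f :: "'a \<Rightarrow> 'b::{banach, second_countable_topology}"
  shows "ennreal (norm (integral\<^sup>L M f)) \<le> (\<integral>\<^sup>+x. ennreal (norm (f x)) \<partial>M)"
  by (cases "integrable M f") (auto simp: integral_norm_bound_ennreal not_integrable_integral_eq)

lemma nn_integral_reciprocal_le:
  fixes a c :: real
  assumes "0 < a" "a \<le> c"
  shows "(\<integral>\<^sup>+t. ennreal (indicator {a..c} t / t) \<partial>lborel) \<le> ennreal ((c - a) / a)"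
proof -
  have "(\<integral>\<^sup>+t. ennreal (indicator {a..c} t / t) \<partial>lborel) \<le> (\<integral>\<^sup>+t. ennreal (1 / a) * indicator {a..c} t \<partial>lborel)"
    by (intro nn_integral_mono) (use assms in \<open>auto simp: indicator_def intro!: ennreal_leI frac_le\<close>)
  also have "\<dots> = ennreal ((c - a) / a)"
    using assms by (simp add: nn_integral_cmult_indicator ennreal_mult[symmetric])
  finally show ?thesis .
qed

lemma curve_kernel_integral:
  fixes \<gamma> :: "real \<Rightarrow> plane"
  assumes [measurable]: "\<gamma> \<in> borel_measurable borel" "W \<in> sets borel" "m \<in> borel_measurable borel"
    and s: "\<And>s. y - \<gamma> s \<in> W \<Longrightarrow> s \<in> {a..c}" and m: "\<And>s. s \<in> {a..c} \<Longrightarrow> \<bar>m s\<bar> \<le> G"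
    and a: "0 < a" "a \<le> c"
  shows "integrable lborel (\<lambda>s. indicator W (y - \<gamma> s) * (m s / s) :: real)"
    and "\<bar>\<integral>s. indicator W (y - \<gamma> s) * (m s / s) \<partial>lborel\<bar> \<le> G * ((c - a) / a)"
proof -
  have G: "0 \<le> G" using m[of a] a by auto
  have bd: "norm (indicator W (y - \<gamma> s) * (m s / s) :: real) \<le> (G / a) * indicator {a..c} s" for s
  proof (cases "y - \<gamma> s \<in> W")
    case True
    then have tac: "s \<in> {a..c}" using s by blast
    then have "\<bar>m s / s\<bar> \<le> G / a" using m[OF tac] a G by (auto simp: abs_divide intro!: frac_le)
    then show ?thesis using True tac by simp
  qed (use G a in simp)
  have i: "integrable lborel (\<lambda>s. (G / a) * indicator {a..c} s)"
    by (intro integrable_mult_right integrable_real_indicator) (auto simp: emeasure_lborel_Icc_eq)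
  show I: "integrable lborel (\<lambda>s. indicator W (y - \<gamma> s) * (m s / s) :: real)"
    by (rule Bochner_Integration.integrable_bound[OF i]) (measurable, use bd G a in \<open>auto intro!: AE_I2\<close>)
  have "norm (\<integral>s. indicator W (y - \<gamma> s) * (m s / s) \<partial>lborel) \<le> (\<integral>s. (G / a) * indicator {a..c} s \<partial>lborel)"
    by (rule Bochner_Integration.integral_norm_bound_integral[OF I i bd])
  also have "\<dots> = G * ((c - a) / a)" using a by simp
  finally show "\<bar>\<integral>s. indicator W (y - \<gamma> s) * (m s / s) \<partial>lborel\<bar> \<le> G * ((c - a) / a)" by simp
qed

context monomial
begin

lemma abs_curve_le:
  assumes "t \<in> {a..c}" "0 < a"
  shows "\<bar>fst (\<gamma> t)\<bar> \<le> c powr fst \<beta>" "\<bar>snd (\<gamma> t)\<bar> \<le> c powr snd \<beta>"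
  using assms exponents by (auto simp: abs_curve intro!: powr_mono2)

lemma area_kernel_eq:
  "area_kernel t s = (fst (\<gamma> t) / t) * (snd (\<gamma> s) / s) - (snd (\<gamma> t) / t) * (fst (\<gamma> s) / s)"
  by (simp add: area_kernel_def diff_divide_distrib)

text \<open>The exact formula behind the theorem. Insert \<open>F = b x\<close> and \<open>F = b\<close> into the change of
  variables, subtract, and pass through the intermediate point. In the first difference
  \<open>b x - b y\<close> the variable \<open>s\<close> is integrated out into the bounded functions \<open>K\<close>; in the second
  difference \<open>b y - b w\<close> the inner integral over \<open>s\<close> is itself of commutator type, namely \<open>N\<close>
  at the point \<open>y\<close>.\<close>

lemma oscillation_decomposition:
  fixes b :: "plane \<Rightarrow> complex"
  assumes T: "transversal_triple \<gamma> a c Q P W" and a: "0 < a" "a \<le> c"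
    and W [measurable]: "W \<in> sets borel" "emeasure lborel W < \<infinity>" and P [measurable]: "P \<in> sets borel"
    and b: "integrable lborel b"
  defines "K \<equiv> \<lambda>\<pi> y. complex_of_real (indicator P y * (\<integral>s. indicator W (y - \<gamma> s) * (\<pi> (\<gamma> s) / s) \<partial>lborel))"
    and "N \<equiv> \<lambda>\<pi>. curve_osc \<gamma> b (indicator W) (\<lambda>s. \<pi> (\<gamma> s))"
  shows "AE x in lborel. x \<in> Q \<longrightarrow>
     measure lborel W *\<^sub>R b x - (LINT w:W|lborel. b w) = orientation *\<^sub>R
       (curve_osc \<gamma> b (K snd) (\<lambda>t. fst (\<gamma> t)) x - curve_osc \<gamma> b (K fst) (\<lambda>t. snd (\<gamma> t)) x
        + (\<integral>t. indicator P (x - \<gamma> t) *\<^sub>R ((fst (\<gamma> t) / t) *\<^sub>R N snd (x - \<gamma> t)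
              - (snd (\<gamma> t) / t) *\<^sub>R N fst (x - \<gamma> t)) \<partial>lborel))"
    (is "AE x in lborel. x \<in> Q \<longrightarrow> ?id x")
  using AE_integrable_along_curve[OF borel_measurable_curve b, of a c]
    AE_along_curve[OF borel_measurable_curve AE_integrable_along_curve[OF borel_measurable_curve b, of a c]]
proof eventually_elim
  case (elim x)
  note gx = elim(1) and gxt = elim(2)
  show ?case
  proof
    assume x: "x \<in> Q"
    have [measurable]: "b \<in> borel_measurable borel" using borel_measurable_integrable[OF b] by simp
    have t: "t \<in> {a..c}" if "x - \<gamma> t \<in> P" for t using T x that unfolding transversal_triple_def by blast
    have s: "s \<in> {a..c}" if "y \<in> P" "y - \<gamma> s \<in> W" for y s using T that unfolding transversal_triple_def by blast
    have Km [measurable]: "K \<pi> \<in> borel_measurable borel" if [measurable]: "\<pi> \<in> borel_measurable borel" for \<pi>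
      unfolding K_def by measurable
    have Nm: "N \<pi> \<in> borel_measurable borel" if [measurable]: "\<pi> \<in> borel_measurable borel" for \<pi>
      unfolding N_def curve_osc_def by measurable
    have [measurable]: "N fst \<in> borel_measurable borel" "N snd \<in> borel_measurable borel" by (auto intro!: Nm)
    have Kb: "cmod (K fst y) \<le> (c powr fst \<beta> * ((c - a) / a)) * indicator P y"
      "cmod (K snd y) \<le> (c powr snd \<beta> * ((c - a) / a)) * indicator P y" for y
    proof -
      have "\<bar>\<integral>s. indicator W (y - \<gamma> s) * (fst (\<gamma> s) / s) \<partial>lborel\<bar> \<le> c powr fst \<beta> * ((c - a) / a)" if "y \<in> P"
        by (rule curve_kernel_integral(2)[OF _ _ _ _ abs_curve_le(1)]) (use a s[OF that] in auto)
      moreover have "\<bar>\<integral>s. indicator W (y - \<gamma> s) * (snd (\<gamma> s) / s) \<partial>lborel\<bar> \<le> c powr snd \<beta> * ((c - a) / a)" if "y \<in> P"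
        by (rule curve_kernel_integral(2)[OF _ _ _ _ abs_curve_le(2)]) (use a s[OF that] in auto)
      ultimately show "cmod (K fst y) \<le> (c powr fst \<beta> * ((c - a) / a)) * indicator P y"
        "cmod (K snd y) \<le> (c powr snd \<beta> * ((c - a) / a)) * indicator P y"
        by (auto simp: K_def indicator_def)
    qed
    define \<kappa> where "\<kappa> z = indicator P (x - \<gamma> (fst z)) * indicator W (x - double_step z) * area_kernel (fst z) (snd z)" for z
    have \<kappa>m [measurable]: "\<kappa> \<in> borel_measurable borel" unfolding \<kappa>_def by measurable
    define G where "G = 2 * (c powr fst \<beta> / a * (c powr snd \<beta> / a))"
    have \<kappa>b: "\<bar>\<kappa> z\<bar> \<le> G * indicator {a..c} (fst z) * indicator {a..c} (snd z)" for z
    proof (cases "x - \<gamma> (fst z) \<in> P \<and> x - double_step z \<in> W")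
      case True
      then have ts: "fst z \<in> {a..c}" "snd z \<in> {a..c}"
        using t s[of "x - \<gamma> (fst z)" "snd z"] by (auto simp: double_step_def algebra_simps)
      have q: "\<bar>fst (\<gamma> t) / t\<bar> \<le> c powr fst \<beta> / a" "\<bar>snd (\<gamma> t) / t\<bar> \<le> c powr snd \<beta> / a" if "t \<in> {a..c}" for t
        using abs_curve_le[OF that a(1)] that a by (auto simp: abs_divide intro!: frac_le)
      have "\<bar>(fst (\<gamma> (fst z)) / fst z) * (snd (\<gamma> (snd z)) / snd z)\<bar> \<le> c powr fst \<beta> / a * (c powr snd \<beta> / a)"
        "\<bar>(snd (\<gamma> (fst z)) / fst z) * (fst (\<gamma> (snd z)) / snd z)\<bar> \<le> c powr snd \<beta> / a * (c powr fst \<beta> / a)"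
        unfolding abs_mult using a
        by (auto intro!: mult_mono q ts simp del: times_divide_times_eq times_divide_eq_left times_divide_eq_right abs_divide)
      then have "\<bar>area_kernel (fst z) (snd z)\<bar> \<le> G"
        unfolding area_kernel_eq G_def by (simp only: mult.commute[of "c powr snd \<beta> / a"])
      then show ?thesis using True ts by (simp add: \<kappa>_def)
    next
      case False
      have "0 \<le> G" using a by (simp add: G_def)
      then show ?thesis using False by (auto simp: \<kappa>_def)
    qed
    have I1: "has_bochner_integral lborel (\<lambda>z. \<kappa> z *\<^sub>R b (x - double_step z)) ((LINT w:W|lborel. b w) /\<^sub>R orientation)"
      unfolding \<kappa>_def by (rule has_bochner_integral_double_step[OF T a(1) W P x b])
    have I0: "has_bochner_integral lborel (\<lambda>z. \<kappa> z *\<^sub>R b x) ((measure lborel W *\<^sub>R b x) /\<^sub>R orientation)"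
    proof -
      have "integrable lborel (\<lambda>w. indicator W w *\<^sub>R b x)"
        using W by (intro integrable_indicator) auto
      from has_bochner_integral_double_step[OF T a(1) W P x this]
      have "has_bochner_integral lborel (\<lambda>z. \<kappa> z *\<^sub>R (indicator W (x - double_step z) *\<^sub>R b x))
         ((LINT w:W|lborel. indicator W w *\<^sub>R b x) /\<^sub>R orientation)" unfolding \<kappa>_def .
      moreover have "(LINT w:W|lborel. indicator W w *\<^sub>R b x) = measure lborel W *\<^sub>R b x"
      proof -
        have "(LINT w:W|lborel. indicator W w *\<^sub>R b x) = (LINT w|lborel. indicator W w *\<^sub>R b x)"
          unfolding set_lebesgue_integral_def by (intro Bochner_Integration.integral_cong) (auto simp: indicator_def)
        then show ?thesis using W by simp
      qed
      moreover have "\<kappa> z * indicator W (x - double_step z) = \<kappa> z" for z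
        by (auto simp: \<kappa>_def indicator_def)
      ultimately show ?thesis by simp
    qed
    have I2: "integrable lborel (\<lambda>z. \<kappa> z *\<^sub>R b (x - \<gamma> (fst z)))"
    proof (rule Bochner_Integration.integrable_bound)
      have "integrable lborel (indicator {a..c} :: real \<Rightarrow> real)"
        by (intro integrable_real_indicator) (auto simp: emeasure_lborel_Icc_eq)
      from integrable_tensor[OF gx this]
      show "integrable lborel (\<lambda>z. G *\<^sub>R (indicator {a..c} (snd z) *\<^sub>R (indicator {a..c} (fst z) *\<^sub>R b (x - \<gamma> (fst z)))))"
        by (intro integrable_scaleR_right) (simp add: lborel_prod case_prod_beta')
      show "AE z in lborel. norm (\<kappa> z *\<^sub>R b (x - \<gamma> (fst z))) \<le> norm (G *\<^sub>R (indicator {a..c} (snd z) *\<^sub>R (indicator {a..c} (fst z) *\<^sub>R b (x - \<gamma> (fst z)))))"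
      proof (rule AE_I2)
        fix z
        have G: "0 \<le> G" using a by (simp add: G_def)
        have "norm (\<kappa> z *\<^sub>R b (x - \<gamma> (fst z))) \<le> (G * indicator {a..c} (fst z) * indicator {a..c} (snd z)) * cmod (b (x - \<gamma> (fst z)))"
          unfolding norm_scaleR by (intro mult_right_mono \<kappa>b) auto
        also have "\<dots> = norm (G *\<^sub>R (indicator {a..c} (snd z) *\<^sub>R (indicator {a..c} (fst z) *\<^sub>R b (x - \<gamma> (fst z)))))"
          using G by (simp add: mult_ac)
        finally show "norm (\<kappa> z *\<^sub>R b (x - \<gamma> (fst z))) \<le> norm (G *\<^sub>R (indicator {a..c} (snd z) *\<^sub>R (indicator {a..c} (fst z) *\<^sub>R b (x - \<gamma> (fst z)))))" .
      qed
    qed measurable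
    have iA: "integrable lborel (\<lambda>z. \<kappa> z *\<^sub>R (b x - b (x - \<gamma> (fst z))))"
      unfolding scaleR_diff_right
      using I0 I2 by (intro Bochner_Integration.integrable_diff) (auto simp: has_bochner_integral_iff)
    have iB: "integrable lborel (\<lambda>z. \<kappa> z *\<^sub>R (b (x - \<gamma> (fst z)) - b (x - double_step z)))"
      unfolding scaleR_diff_right
      using I1 I2 by (intro Bochner_Integration.integrable_diff) (auto simp: has_bochner_integral_iff)
    have "(measure lborel W *\<^sub>R b x - (LINT w:W|lborel. b w)) /\<^sub>R orientation
       = (LINT z|lborel. \<kappa> z *\<^sub>R b x) - (LINT z|lborel. \<kappa> z *\<^sub>R b (x - double_step z))"
      using I0 I1 by (simp add: has_bochner_integral_iff scaleR_diff_right)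
    also have "\<dots> = (LINT z|lborel. \<kappa> z *\<^sub>R (b x - b (x - \<gamma> (fst z))))
       + (LINT z|lborel. \<kappa> z *\<^sub>R (b (x - \<gamma> (fst z)) - b (x - double_step z)))"
      using I0 I1 I2 by (simp add: has_bochner_integral_iff scaleR_diff_right)
    also have "(LINT z|lborel. \<kappa> z *\<^sub>R (b x - b (x - \<gamma> (fst z))))
       = (LINT t|lborel. LINT s|lborel. \<kappa> (t, s) *\<^sub>R (b x - b (x - \<gamma> t)))"
      using lborel_pair.integral_fst'[of "\<lambda>z. \<kappa> z *\<^sub>R (b x - b (x - \<gamma> (fst z)))"] iA by (simp add: lborel_prod)
    also have "(LINT z|lborel. \<kappa> z *\<^sub>R (b (x - \<gamma> (fst z)) - b (x - double_step z)))
       = (LINT t|lborel. LINT s|lborel. \<kappa> (t, s) *\<^sub>R (b (x - \<gamma> t) - b (x - \<gamma> t - \<gamma> s)))"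
      using lborel_pair.integral_fst'[of "\<lambda>z. \<kappa> z *\<^sub>R (b (x - \<gamma> (fst z)) - b (x - double_step z))"] iB
      by (simp add: lborel_prod double_step_def diff_diff_eq)
    also have "(LINT t|lborel. LINT s|lborel. \<kappa> (t, s) *\<^sub>R (b x - b (x - \<gamma> t)))
       = curve_osc \<gamma> b (K snd) (\<lambda>t. fst (\<gamma> t)) x - curve_osc \<gamma> b (K fst) (\<lambda>t. snd (\<gamma> t)) x"
    proof -
      have "(LINT s|lborel. \<kappa> (t, s) *\<^sub>R (b x - b (x - \<gamma> t)))
        = (b x - b (x - \<gamma> t)) * (K snd (x - \<gamma> t) * complex_of_real (fst (\<gamma> t) / t))
          - (b x - b (x - \<gamma> t)) * (K fst (x - \<gamma> t) * complex_of_real (snd (\<gamma> t) / t))" for t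
      proof (cases "x - \<gamma> t \<in> P")
        case True
        have i1: "integrable lborel (\<lambda>s. indicator W (x - \<gamma> t - \<gamma> s) * (fst (\<gamma> s) / s) :: real)"
          by (rule curve_kernel_integral(1)[OF _ _ _ _ abs_curve_le(1)]) (use a s[OF True] in auto)
        have i2: "integrable lborel (\<lambda>s. indicator W (x - \<gamma> t - \<gamma> s) * (snd (\<gamma> s) / s) :: real)"
          by (rule curve_kernel_integral(1)[OF _ _ _ _ abs_curve_le(2)]) (use a s[OF True] in auto)
        have eq: "\<kappa> (t, s) = (fst (\<gamma> t) / t) * (indicator W (x - \<gamma> t - \<gamma> s) * (snd (\<gamma> s) / s))
            - (snd (\<gamma> t) / t) * (indicator W (x - \<gamma> t - \<gamma> s) * (fst (\<gamma> s) / s))" for s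
          using True by (simp add: \<kappa>_def area_kernel_eq double_step_def diff_diff_eq right_diff_distrib mult_ac)
        have i3: "integrable lborel (\<lambda>s. \<kappa> (t, s))" unfolding eq by (intro Bochner_Integration.integrable_diff integrable_mult_right i1 i2)
        have k: "(LINT s|lborel. \<kappa> (t, s)) = (fst (\<gamma> t) / t) * (LINT s|lborel. indicator W (x - \<gamma> t - \<gamma> s) * (snd (\<gamma> s) / s))
            - (snd (\<gamma> t) / t) * (LINT s|lborel. indicator W (x - \<gamma> t - \<gamma> s) * (fst (\<gamma> s) / s))"
          unfolding eq by (simp only: Bochner_Integration.integral_diff[OF integrable_mult_right[OF i2] integrable_mult_right[OF i1]]
              integral_mult_right_zero)
        have "(LINT s|lborel. \<kappa> (t, s) *\<^sub>R (b x - b (x - \<gamma> t))) = (LINT s|lborel. \<kappa> (t, s)) *\<^sub>R (b x - b (x - \<gamma> t))"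
          by (rule integral_scaleR_left) (rule i3)
        then show ?thesis using True unfolding k K_def
          by (simp only: scaleR_conv_of_real of_real_diff of_real_mult indicator_simps of_real_1) (simp only: algebra_simps mult_1_left)
      qed (simp add: K_def \<kappa>_def)
      moreover have "integrable lborel (\<lambda>t. (b x - b (x - \<gamma> t)) * (K snd (x - \<gamma> t) * complex_of_real (fst (\<gamma> t) / t)))"
        by (rule integrable_curve_osc[OF _ _ _ _ gx a(1) t Kb(2) abs_curve_le(1)]) (use a Km in auto)
      moreover have "integrable lborel (\<lambda>t. (b x - b (x - \<gamma> t)) * (K fst (x - \<gamma> t) * complex_of_real (snd (\<gamma> t) / t)))"
        by (rule integrable_curve_osc[OF _ _ _ _ gx a(1) t Kb(1) abs_curve_le(2)]) (use a Km in auto)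
      ultimately show ?thesis by (simp only: curve_osc_def Bochner_Integration.integral_diff)
    qed
    also have "(LINT t|lborel. LINT s|lborel. \<kappa> (t, s) *\<^sub>R (b (x - \<gamma> t) - b (x - \<gamma> t - \<gamma> s)))
       = (\<integral>t. indicator P (x - \<gamma> t) *\<^sub>R ((fst (\<gamma> t) / t) *\<^sub>R N snd (x - \<gamma> t)
                - (snd (\<gamma> t) / t) *\<^sub>R N fst (x - \<gamma> t)) \<partial>lborel)"
    proof (rule integral_cong_AE)
      show "AE t in lborel. (LINT s|lborel. \<kappa> (t, s) *\<^sub>R (b (x - \<gamma> t) - b (x - \<gamma> t - \<gamma> s)))
         = indicator P (x - \<gamma> t) *\<^sub>R ((fst (\<gamma> t) / t) *\<^sub>R N snd (x - \<gamma> t) - (snd (\<gamma> t) / t) *\<^sub>R N fst (x - \<gamma> t))"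
        using gxt
      proof eventually_elim
        case (elim t)
        show ?case
        proof (cases "x - \<gamma> t \<in> P")
          case True
          define y where "y = x - \<gamma> t"
          have i1: "integrable lborel (\<lambda>s. (b y - b (y - \<gamma> s)) * (indicator W (y - \<gamma> s) * complex_of_real (fst (\<gamma> s) / s)))"
            by (rule integrable_curve_osc[OF _ _ _ _ elim[folded y_def] a(1) s[OF True[folded y_def]] _ abs_curve_le(1), where K=1])
              (use a in \<open>auto simp: indicator_def\<close>)
          have i2: "integrable lborel (\<lambda>s. (b y - b (y - \<gamma> s)) * (indicator W (y - \<gamma> s) * complex_of_real (snd (\<gamma> s) / s)))"
            by (rule integrable_curve_osc[OF _ _ _ _ elim[folded y_def] a(1) s[OF True[folded y_def]] _ abs_curve_le(2), where K=1])
              (use a in \<open>auto simp: indicator_def\<close>)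
          have "(LINT s|lborel. \<kappa> (t, s) *\<^sub>R (b y - b (y - \<gamma> s)))
            = (LINT s|lborel. complex_of_real (fst (\<gamma> t) / t) * ((b y - b (y - \<gamma> s)) * (indicator W (y - \<gamma> s) * complex_of_real (snd (\<gamma> s) / s)))
               - complex_of_real (snd (\<gamma> t) / t) * ((b y - b (y - \<gamma> s)) * (indicator W (y - \<gamma> s) * complex_of_real (fst (\<gamma> s) / s))))"
          proof (rule Bochner_Integration.integral_cong[OF refl])
            fix s
            have "\<kappa> (t, s) = indicator W (y - \<gamma> s) * area_kernel t s"
              using True by (simp add: \<kappa>_def double_step_def diff_diff_eq y_def)
            moreover have "complex_of_real (indicator W (y - \<gamma> s)) = indicator W (y - \<gamma> s)" by (simp add: indicator_def)
            ultimately show "\<kappa> (t, s) *\<^sub>R (b y - b (y - \<gamma> s))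
              = complex_of_real (fst (\<gamma> t) / t) * ((b y - b (y - \<gamma> s)) * (indicator W (y - \<gamma> s) * complex_of_real (snd (\<gamma> s) / s)))
               - complex_of_real (snd (\<gamma> t) / t) * ((b y - b (y - \<gamma> s)) * (indicator W (y - \<gamma> s) * complex_of_real (fst (\<gamma> s) / s)))"
              unfolding area_kernel_eq scaleR_conv_of_real
              by (simp only: of_real_diff of_real_mult) (simp only: algebra_simps)
          qed
          also have "\<dots> = (fst (\<gamma> t) / t) *\<^sub>R N snd y - (snd (\<gamma> t) / t) *\<^sub>R N fst y"
            unfolding N_def curve_osc_def scaleR_conv_of_real
            by (simp only: Bochner_Integration.integral_diff[OF integrable_mult_right[OF i2] integrable_mult_right[OF i1]]
              integral_mult_right_zero)
          finally show ?thesis using True by (simp add: y_def)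
        qed (simp add: \<kappa>_def)
      qed
    qed (use Nm in measurable)
    finally have "(measure lborel W *\<^sub>R b x - (LINT w:W|lborel. b w)) /\<^sub>R orientation = 
         curve_osc \<gamma> b (K snd) (\<lambda>t. fst (\<gamma> t)) x - curve_osc \<gamma> b (K fst) (\<lambda>t. snd (\<gamma> t)) x +
         (\<integral>t. indicator P (x - \<gamma> t) *\<^sub>R ((fst (\<gamma> t) / t) *\<^sub>R N snd (x - \<gamma> t)
                - (snd (\<gamma> t) / t) *\<^sub>R N fst (x - \<gamma> t)) \<partial>lborel)" .
    then show "?id x"
      using orientation_abs(2) by (metis (no_types, lifting) scaleR_one scaleR_scaleR right_inverse)
  qed
qed

end

context monomial
begin

text \<open>The information on \<open>b\<close> that a bounded commutator provides, with \<open>E\<close> in the role of the operator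
  norm; it concerns functions \<open>f\<close> supported in \<open>B\<close> and points of \<open>A\<close>.\<close>

definition curve_tests :: "(plane \<Rightarrow> complex) \<Rightarrow> plane set \<Rightarrow> plane set \<Rightarrow> real \<Rightarrow> bool" where
  "curve_tests b A B E \<longleftrightarrow> (\<forall>f M. f \<in> borel_measurable borel \<longrightarrow> 0 \<le> M \<longrightarrow>
     (\<forall>y. cmod (f y) \<le> M * indicator B y) \<longrightarrow>
     (\<integral>\<^sup>+x\<in>A. ennreal (cmod (curve_osc \<gamma> b f (\<lambda>_. 1) x)) \<partial>lborel) \<le> ennreal (M * E))"

text \<open>All terms of the decomposition are tests, either from \<open>Q\<close> to \<open>P\<close> or from \<open>P\<close> to \<open>W\<close>; the
  average over \<open>t\<close> in the last term costs only the mass \<open>\<integral> dt/t\<close> of the interval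
  \<open>{a..c}\<close>.\<close>

lemma oscillation_le_curve_tests:
  fixes b :: "plane \<Rightarrow> complex"
  assumes T: "transversal_triple \<gamma> a c Q P W" and a: "0 < a" "a \<le> c"
    and W [measurable]: "W \<in> sets borel" "emeasure lborel W < \<infinity>" and P [measurable]: "P \<in> sets borel"
    and Q [measurable]: "Q \<in> sets borel"
    and b: "integrable lborel b"
    and D: "\<And>v. v \<in> Q \<union> P \<union> W \<Longrightarrow> \<bar>fst v - o1\<bar> \<le> D1" "0 \<le> D1"
           "\<And>v. v \<in> Q \<union> P \<union> W \<Longrightarrow> \<bar>snd v - o2\<bar> \<le> D2" "0 \<le> D2"
    and tests: "curve_tests b Q P E" "curve_tests b P W E" and E: "0 \<le> E"
  shows "(\<integral>\<^sup>+x\<in>Q. ennreal (cmod (measure lborel W *\<^sub>R b x - (LINT w:W|lborel. b w))) \<partial>lborel)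
     \<le> ennreal (4 * (fst \<beta> * snd \<beta>) * ((c - a) / a) * (D1 * c powr snd \<beta> + D2 * c powr fst \<beta>) * E)"
proof -
  have [measurable]: "b \<in> borel_measurable borel" using borel_measurable_integrable[OF b] by simp
  define L where "L = (c - a) / a"
  define G1 where "G1 = c powr fst \<beta>"
  define G2 where "G2 = c powr snd \<beta>"
  have nn: "0 \<le> L" "0 \<le> G1" "0 \<le> G2" using a by (auto simp: L_def G1_def G2_def)
  have t: "t \<in> {a..c}" if "x \<in> Q" "x - \<gamma> t \<in> P" for x t using T that unfolding transversal_triple_def by blast
  have s: "s \<in> {a..c}" if "y \<in> P" "y - \<gamma> s \<in> W" for y s using T that unfolding transversal_triple_def by blast
  define K where "K \<pi> y = complex_of_real (indicator P y * (\<integral>s. indicator W (y - \<gamma> s) * (\<pi> (\<gamma> s) / s) \<partial>lborel))" for \<pi> :: "plane \<Rightarrow> real" and y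
  define N where "N \<pi> = curve_osc \<gamma> b (indicator W) (\<lambda>s. \<pi> (\<gamma> s))" for \<pi> :: "plane \<Rightarrow> real"
  define R where "R x = (\<integral>t. indicator P (x - \<gamma> t) *\<^sub>R ((fst (\<gamma> t) / t) *\<^sub>R N snd (x - \<gamma> t)
              - (snd (\<gamma> t) / t) *\<^sub>R N fst (x - \<gamma> t)) \<partial>lborel)" for x
  have Km [measurable]: "K fst \<in> borel_measurable borel" "K snd \<in> borel_measurable borel"
    unfolding K_def by measurable
  have Nm [measurable]: "N fst \<in> borel_measurable borel" "N snd \<in> borel_measurable borel"
    unfolding N_def curve_osc_def by measurable
  have Rm [measurable]: "R \<in> borel_measurable borel" unfolding R_def by measurable
  have Om [measurable]: "curve_osc \<gamma> b (K snd) (\<lambda>t. fst (\<gamma> t)) \<in> borel_measurable borel"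
    "curve_osc \<gamma> b (K fst) (\<lambda>t. snd (\<gamma> t)) \<in> borel_measurable borel"
    unfolding curve_osc_def by measurable
  have Kb: "cmod (K fst y) \<le> (G1 * L) * indicator P y" "cmod (K snd y) \<le> (G2 * L) * indicator P y" for y
  proof -
    have "\<bar>\<integral>s. indicator W (y - \<gamma> s) * (fst (\<gamma> s) / s) \<partial>lborel\<bar> \<le> G1 * L" if "y \<in> P"
      unfolding G1_def L_def
      by (rule curve_kernel_integral(2)[OF _ _ _ _ abs_curve_le(1)]) (use a s[OF that] in auto)
    moreover have "\<bar>\<integral>s. indicator W (y - \<gamma> s) * (snd (\<gamma> s) / s) \<partial>lborel\<bar> \<le> G2 * L" if "y \<in> P"
      unfolding G2_def L_def
      by (rule curve_kernel_integral(2)[OF _ _ _ _ abs_curve_le(2)]) (use a s[OF that] in auto)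
    ultimately show "cmod (K fst y) \<le> (G1 * L) * indicator P y" "cmod (K snd y) \<le> (G2 * L) * indicator P y"
      by (auto simp: K_def indicator_def)
  qed
  have lin: "linear (fst :: plane \<Rightarrow> real)" "linear (snd :: plane \<Rightarrow> real)"
    by (simp_all add: linear_fst linear_snd)
  note bound = curve_osc_coordinate_bound[OF borel_measurable_curve b _ _ _ _ _ _ a(1) _ _ _ _ _ E]
  have 1: "(\<integral>\<^sup>+x\<in>Q. ennreal (cmod (curve_osc \<gamma> b (K snd) (\<lambda>t. fst (\<gamma> t)) x)) \<partial>lborel) \<le> ennreal (2 * D1 * (G2 * L) * E)"
  proof (rule bound[where B=P and ?o0.0=o1 and c=c])
    show "\<bar>fst v - o1\<bar> \<le> D1" if "v \<in> Q \<union> P" for v using that D(1) by blast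
    show "(\<integral>\<^sup>+x\<in>Q. ennreal (cmod (curve_osc \<gamma> b f (\<lambda>_. 1) x)) \<partial>lborel) \<le> ennreal (M * E)"
      if "f \<in> borel_measurable borel" "0 \<le> M" "\<And>y. cmod (f y) \<le> M * indicator P y" for f M
      using tests(1) that unfolding curve_tests_def by blast
  qed (use D lin nn in \<open>simp_all add: Kb t del: atLeastAtMost_iff\<close>)
  have 2: "(\<integral>\<^sup>+x\<in>Q. ennreal (cmod (curve_osc \<gamma> b (K fst) (\<lambda>t. snd (\<gamma> t)) x)) \<partial>lborel) \<le> ennreal (2 * D2 * (G1 * L) * E)"
  proof (rule bound[where B=P and ?o0.0=o2 and c=c])
    show "\<bar>snd v - o2\<bar> \<le> D2" if "v \<in> Q \<union> P" for v using that D(3) by blast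
    show "(\<integral>\<^sup>+x\<in>Q. ennreal (cmod (curve_osc \<gamma> b f (\<lambda>_. 1) x)) \<partial>lborel) \<le> ennreal (M * E)"
      if "f \<in> borel_measurable borel" "0 \<le> M" "\<And>y. cmod (f y) \<le> M * indicator P y" for f M
      using tests(1) that unfolding curve_tests_def by blast
  qed (use D lin nn in \<open>simp_all add: Kb t del: atLeastAtMost_iff\<close>)

  have 3: "(\<integral>\<^sup>+x\<in>P. ennreal (cmod (N fst x)) \<partial>lborel) \<le> ennreal (2 * D1 * 1 * E)"
    unfolding N_def
  proof (rule bound[where B=W and ?o0.0=o1 and c=c])
    show "\<bar>fst v - o1\<bar> \<le> D1" if "v \<in> P \<union> W" for v using that D(1) by blast
    show "(\<integral>\<^sup>+x\<in>P. ennreal (cmod (curve_osc \<gamma> b f (\<lambda>_. 1) x)) \<partial>lborel) \<le> ennreal (M * E)"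
      if "f \<in> borel_measurable borel" "0 \<le> M" "\<And>y. cmod (f y) \<le> M * indicator W y" for f M
      using tests(2) that unfolding curve_tests_def by blast
  qed (use D lin nn in \<open>simp_all add: indicator_def s del: atLeastAtMost_iff\<close>)
  have 4: "(\<integral>\<^sup>+x\<in>P. ennreal (cmod (N snd x)) \<partial>lborel) \<le> ennreal (2 * D2 * 1 * E)"
    unfolding N_def
  proof (rule bound[where B=W and ?o0.0=o2 and c=c])
    show "\<bar>snd v - o2\<bar> \<le> D2" if "v \<in> P \<union> W" for v using that D(3) by blast
    show "(\<integral>\<^sup>+x\<in>P. ennreal (cmod (curve_osc \<gamma> b f (\<lambda>_. 1) x)) \<partial>lborel) \<le> ennreal (M * E)"
      if "f \<in> borel_measurable borel" "0 \<le> M" "\<And>y. cmod (f y) \<le> M * indicator W y" for f M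
      using tests(2) that unfolding curve_tests_def by blast
  qed (use D lin nn in \<open>simp_all add: indicator_def s del: atLeastAtMost_iff\<close>)
  define h where "h y = ennreal G1 * (ennreal (cmod (N snd y)) * indicator P y) + ennreal G2 * (ennreal (cmod (N fst y)) * indicator P y)" for y
  have hm [measurable]: "h \<in> borel_measurable borel" unfolding h_def by measurable
  have 5: "(\<integral>\<^sup>+x\<in>Q. ennreal (cmod (R x)) \<partial>lborel) \<le> ennreal (L * (G1 * (2 * D2 * E) + G2 * (2 * D1 * E)))"
  proof -
    have "(\<integral>\<^sup>+x\<in>Q. ennreal (cmod (R x)) \<partial>lborel) \<le> (\<integral>\<^sup>+x. \<integral>\<^sup>+t. ennreal (indicator {a..c} t / t) * h (x - \<gamma> t) \<partial>lborel \<partial>lborel)"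
    proof (rule nn_integral_mono)
      fix x
      show "ennreal (cmod (R x)) * indicator Q x \<le> (\<integral>\<^sup>+t. ennreal (indicator {a..c} t / t) * h (x - \<gamma> t) \<partial>lborel)"
      proof (cases "x \<in> Q")
        case True
        have "ennreal (cmod (R x)) \<le> (\<integral>\<^sup>+t. ennreal (norm (indicator P (x - \<gamma> t) *\<^sub>R ((fst (\<gamma> t) / t) *\<^sub>R N snd (x - \<gamma> t)
              - (snd (\<gamma> t) / t) *\<^sub>R N fst (x - \<gamma> t)))) \<partial>lborel)"
          unfolding R_def by (rule norm_integral_le_nn_integral)
        also have "\<dots> \<le> (\<integral>\<^sup>+t. ennreal (indicator {a..c} t / t) * h (x - \<gamma> t) \<partial>lborel)"
        proof (rule nn_integral_mono)
          fix t
          show "ennreal (norm (indicator P (x - \<gamma> t) *\<^sub>R ((fst (\<gamma> t) / t) *\<^sub>R N snd (x - \<gamma> t)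
              - (snd (\<gamma> t) / t) *\<^sub>R N fst (x - \<gamma> t)))) \<le> ennreal (indicator {a..c} t / t) * h (x - \<gamma> t)"
          proof (cases "x - \<gamma> t \<in> P")
            case inP: True
            then have tac: "t \<in> {a..c}" using t True by blast
            then have tp: "0 < t" using a by simp
            have "norm ((fst (\<gamma> t) / t) *\<^sub>R N snd (x - \<gamma> t) - (snd (\<gamma> t) / t) *\<^sub>R N fst (x - \<gamma> t))
               \<le> \<bar>fst (\<gamma> t)\<bar> / t * cmod (N snd (x - \<gamma> t)) + \<bar>snd (\<gamma> t)\<bar> / t * cmod (N fst (x - \<gamma> t))"
              by (rule order_trans[OF norm_triangle_ineq4]) (use tp in \<open>simp add: abs_divide\<close>)
            also have "\<dots> \<le> G1 / t * cmod (N snd (x - \<gamma> t)) + G2 / t * cmod (N fst (x - \<gamma> t))"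
              unfolding G1_def G2_def using abs_curve_le[OF tac a(1)] tp
              by (intro add_mono mult_right_mono divide_right_mono) auto
            also have "\<dots> = 1 / t * (G1 * cmod (N snd (x - \<gamma> t)) + G2 * cmod (N fst (x - \<gamma> t)))"
              by (simp add: algebra_simps add_divide_distrib)
            finally show ?thesis using inP tac tp nn
              by (simp add: h_def ennreal_mult[symmetric] ennreal_plus[symmetric] ennreal_leI del: ennreal_plus)
          qed simp
        qed
        finally show ?thesis using True by simp
      qed simp
    qed
    also have "\<dots> = (\<integral>\<^sup>+t. ennreal (indicator {a..c} t / t) \<partial>lborel) * (\<integral>\<^sup>+y. h y \<partial>lborel)"
      by (rule nn_integral_curve_average) measurable
    also have "(\<integral>\<^sup>+y. h y \<partial>lborel) = ennreal G1 * (\<integral>\<^sup>+x\<in>P. ennreal (cmod (N snd x)) \<partial>lborel) + ennreal G2 * (\<integral>\<^sup>+x\<in>P. ennreal (cmod (N fst x)) \<partial>lborel)"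
      unfolding h_def by (subst nn_integral_add) (auto simp: nn_integral_cmult)
    also have "(\<integral>\<^sup>+t. ennreal (indicator {a..c} t / t) \<partial>lborel) * \<dots> \<le> ennreal L * (ennreal G1 * ennreal (2 * D2 * 1 * E) + ennreal G2 * ennreal (2 * D1 * 1 * E))"
      using nn_integral_reciprocal_le[OF a] 3 4 unfolding L_def[symmetric] by (intro mult_mono add_mono) auto
    also have "\<dots> = ennreal (L * (G1 * (2 * D2 * E) + G2 * (2 * D1 * E)))"
      using nn D E by (simp add: ennreal_mult[symmetric] ennreal_plus[symmetric] del: ennreal_plus)
    finally show ?thesis .
  qed
  let ?o = "fst \<beta> * snd \<beta>"
  have o: "0 \<le> ?o" using exponents by simp
  have "(\<integral>\<^sup>+x\<in>Q. ennreal (cmod (measure lborel W *\<^sub>R b x - (LINT w:W|lborel. b w))) \<partial>lborel)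
     \<le> (\<integral>\<^sup>+x. ennreal ?o * (ennreal (cmod (curve_osc \<gamma> b (K snd) (\<lambda>t. fst (\<gamma> t)) x)) * indicator Q x
         + ennreal (cmod (curve_osc \<gamma> b (K fst) (\<lambda>t. snd (\<gamma> t)) x)) * indicator Q x + ennreal (cmod (R x)) * indicator Q x) \<partial>lborel)"
  proof (rule nn_integral_mono_AE)
    show "AE x in lborel. ennreal (cmod (measure lborel W *\<^sub>R b x - (LINT w:W|lborel. b w))) * indicator Q x
      \<le> ennreal ?o * (ennreal (cmod (curve_osc \<gamma> b (K snd) (\<lambda>t. fst (\<gamma> t)) x)) * indicator Q x
         + ennreal (cmod (curve_osc \<gamma> b (K fst) (\<lambda>t. snd (\<gamma> t)) x)) * indicator Q x + ennreal (cmod (R x)) * indicator Q x)"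
      using oscillation_decomposition[OF T a W P b]
    proof eventually_elim
      case (elim x)
      show ?case
      proof (cases "x \<in> Q")
        case True
        have eq: "measure lborel W *\<^sub>R b x - (LINT w:W|lborel. b w) = orientation *\<^sub>R
          (curve_osc \<gamma> b (K snd) (\<lambda>t. fst (\<gamma> t)) x - curve_osc \<gamma> b (K fst) (\<lambda>t. snd (\<gamma> t)) x + R x)"
          using elim True unfolding K_def[abs_def] N_def[abs_def] R_def by blast
        have "cmod (measure lborel W *\<^sub>R b x - (LINT w:W|lborel. b w))
           \<le> ?o * (cmod (curve_osc \<gamma> b (K snd) (\<lambda>t. fst (\<gamma> t)) x) + cmod (curve_osc \<gamma> b (K fst) (\<lambda>t. snd (\<gamma> t)) x) + cmod (R x))"
          unfolding eq norm_scaleR orientation_abs(1)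
          by (intro mult_left_mono[OF _ o] order_trans[OF norm_triangle_ineq] add_right_mono norm_triangle_ineq4)
        then show ?thesis using True o
          by (simp add: ennreal_mult[symmetric] ennreal_plus[symmetric] ennreal_leI del: ennreal_plus)
      qed simp
    qed
  qed
  also have "\<dots> = ennreal ?o * ((\<integral>\<^sup>+x\<in>Q. ennreal (cmod (curve_osc \<gamma> b (K snd) (\<lambda>t. fst (\<gamma> t)) x)) \<partial>lborel)
      + (\<integral>\<^sup>+x\<in>Q. ennreal (cmod (curve_osc \<gamma> b (K fst) (\<lambda>t. snd (\<gamma> t)) x)) \<partial>lborel)
      + (\<integral>\<^sup>+x\<in>Q. ennreal (cmod (R x)) \<partial>lborel))"
    by (simp add: nn_integral_cmult nn_integral_add)
  also have "\<dots> \<le> ennreal ?o * (ennreal (2 * D1 * (G2 * L) * E) + ennreal (2 * D2 * (G1 * L) * E)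
      + ennreal (L * (G1 * (2 * D2 * E) + G2 * (2 * D1 * E))))"
    by (intro mult_left_mono add_mono 1 2 5) auto
  also have "\<dots> = ennreal (?o * (2 * D1 * (G2 * L) * E + 2 * D2 * (G1 * L) * E
      + L * (G1 * (2 * D2 * E) + G2 * (2 * D1 * E))))"
    using nn D E o by (simp add: ennreal_mult[symmetric] ennreal_plus[symmetric] del: ennreal_plus)
  also have "\<dots> = ennreal (4 * ?o * L * (D1 * G2 + D2 * G1) * E)"
    by (simp add: algebra_simps)
  finally show ?thesis unfolding L_def G1_def G2_def .
qed

end

section \<open>Weights\<close>

lemma Youngs_inequality_3:
  fixes x y z a b c :: real
  assumes abc: "0 < a" "0 < b" "0 < c" "a + b + c = 1" and nn: "0 \<le> x" "0 \<le> y" "0 \<le> z"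
  shows "x powr a * y powr b * z powr c \<le> a * x + b * y + c * z"
proof (cases "x = 0 \<or> y = 0 \<or> z = 0")
  case True
  then show ?thesis using abc nn by auto
next
  case False
  then have pos: "0 < x" "0 < y" "0 < z" using nn by auto
  define w where "w = y powr (b / (b + c)) * z powr (c / (b + c))"
  have bc: "0 < b + c" using abc by simp
  have w: "0 < w" using pos by (simp add: w_def)
  have "w \<le> b / (b + c) * y + c / (b + c) * z"
    unfolding w_def using abc pos bc by (intro Youngs_inequality_0) (auto simp flip: add_divide_distrib)
  then have "w \<le> (b * y + c * z) / (b + c)" by (simp add: add_divide_distrib)
  then have "(b + c) * w \<le> b * y + c * z" using bc by (simp add: pos_le_divide_eq mult.commute)
  moreover have "x powr a * w powr (b + c) \<le> a * x + (b + c) * w"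
    using abc pos w by (intro Youngs_inequality_0) auto
  moreover have "w powr (b + c) = y powr b * z powr c"
    using bc pos by (simp add: w_def powr_mult powr_powr)
  ultimately show ?thesis by (simp add: mult.assoc)
qed

lemma nn_integral_Hoelder_3:
  fixes f g h :: "'a \<Rightarrow> real" and a b c :: real
  assumes abc: "0 < a" "0 < b" "0 < c" "a + b + c = 1"
    and meas [measurable]: "f \<in> borel_measurable M" "g \<in> borel_measurable M" "h \<in> borel_measurable M"
    and nn: "\<And>x. 0 \<le> f x" "\<And>x. 0 \<le> g x" "\<And>x. 0 \<le> h x"
    and le: "(\<integral>\<^sup>+x. ennreal (f x) \<partial>M) \<le> ennreal A" "(\<integral>\<^sup>+x. ennreal (g x) \<partial>M) \<le> ennreal B" "(\<integral>\<^sup>+x. ennreal (h x) \<partial>M) \<le> ennreal C"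
    and ABC: "0 \<le> A" "0 \<le> B" "0 \<le> C"
  shows "(\<integral>\<^sup>+x. ennreal (f x powr a * g x powr b * h x powr c) \<partial>M) \<le> ennreal (A powr a * B powr b * C powr c)"
proof (cases "A = 0 \<or> B = 0 \<or> C = 0")
  case True
  have "AE x in M. f x = 0 \<or> g x = 0 \<or> h x = 0"
  proof -
    have z: "AE x in M. u x = 0" if "u \<in> borel_measurable M" "\<And>x. 0 \<le> u x" "(\<integral>\<^sup>+x. ennreal (u x) \<partial>M) \<le> 0" for u :: "'a \<Rightarrow> real"
    proof -
      have "AE x in M. ennreal (u x) = 0" using that by (subst nn_integral_0_iff_AE[symmetric]) auto
      then show ?thesis by eventually_elim (use that(2) in \<open>auto simp: order.antisym\<close>)
    qed
    show ?thesis
      using True z[of f] z[of g] z[of h] le nn meas by (auto elim!: eventually_mono)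
  qed
  then have "(\<integral>\<^sup>+x. ennreal (f x powr a * g x powr b * h x powr c) \<partial>M) = (\<integral>\<^sup>+x. 0 \<partial>M)"
    by (intro nn_integral_cong_AE) (auto elim!: eventually_mono)
  then show ?thesis by simp
next
  case False
  then have pos: "0 < A" "0 < B" "0 < C" using ABC by auto
  let ?k = "A powr a * B powr b * C powr c"
  have k: "0 < ?k" using pos by simp
  have pt: "f x powr a * g x powr b * h x powr c \<le> ?k * (a / A * f x + b / B * g x + c / C * h x)" for x
  proof -
    have "f x powr a * g x powr b * h x powr c = ?k * ((f x / A) powr a * (g x / B) powr b * (h x / C) powr c)"
      using pos nn by (simp add: powr_divide)
    also have "\<dots> \<le> ?k * (a * (f x / A) + b * (g x / B) + c * (h x / C))"
      using abc nn pos k by (intro mult_left_mono Youngs_inequality_3) auto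
    finally show ?thesis by simp
  qed
  have "(\<integral>\<^sup>+x. ennreal (f x powr a * g x powr b * h x powr c) \<partial>M)
    \<le> (\<integral>\<^sup>+x. ennreal ?k * (ennreal (a / A) * ennreal (f x) + ennreal (b / B) * ennreal (g x) + ennreal (c / C) * ennreal (h x)) \<partial>M)"
  proof (rule nn_integral_mono)
    fix x
    have "ennreal (f x powr a * g x powr b * h x powr c) \<le> ennreal (?k * (a / A * f x + b / B * g x + c / C * h x))"
      by (rule ennreal_leI) (rule pt)
    also have "\<dots> = ennreal ?k * (ennreal (a / A) * ennreal (f x) + ennreal (b / B) * ennreal (g x) + ennreal (c / C) * ennreal (h x))"
      using abc pos nn k by (simp add: ennreal_mult[symmetric] ennreal_plus[symmetric] del: ennreal_plus)
    finally show "ennreal (f x powr a * g x powr b * h x powr c) \<le> ennreal ?k * (ennreal (a / A) * ennreal (f x) + ennreal (b / B) * ennreal (g x) + ennreal (c / C) * ennreal (h x))" .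
  qed
  also have "\<dots> = ennreal ?k * (ennreal (a / A) * (\<integral>\<^sup>+x. ennreal (f x) \<partial>M) + ennreal (b / B) * (\<integral>\<^sup>+x. ennreal (g x) \<partial>M)
     + ennreal (c / C) * (\<integral>\<^sup>+x. ennreal (h x) \<partial>M))"
    by (simp add: nn_integral_cmult nn_integral_add)
  also have "\<dots> \<le> ennreal ?k * (ennreal (a / A) * ennreal A + ennreal (b / B) * ennreal B + ennreal (c / C) * ennreal C)"
    by (intro mult_left_mono add_mono le) auto
  also have "\<dots> = ennreal ?k"
    using abc pos k by (simp add: ennreal_mult[symmetric] ennreal_plus[symmetric] del: ennreal_plus)
  finally show ?thesis .
qed

lemma gamma_cube_facts:
  assumes "Q \<in> gamma_cubes \<beta>"
  shows "compact Q" "Q \<in> sets borel" "0 < measure lebesgue Q" "emeasure lebesgue Q = ennreal (measure lebesgue Q)"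
    "emeasure lborel Q = ennreal (measure lborel Q)" "measure lebesgue Q = measure lborel Q"
proof -
  obtain a1 b1 a2 b2 where Q: "Q = {a1..b1} \<times> {a2..b2}" "a1 < b1" "a2 < b2"
    using assms by (auto simp: gamma_cubes_def)
  have cb: "Q = cbox (a1, a2) (b1, b2)" by (auto simp: Q cbox_Pair_eq cbox_interval)
  show "compact Q" "Q \<in> sets borel" by (auto simp: cb)
  show eq: "measure lebesgue Q = measure lborel Q" by (simp add: cb)
  show "emeasure lborel Q = ennreal (measure lborel Q)" "emeasure lebesgue Q = ennreal (measure lebesgue Q)"
    using emeasure_lborel_cbox_finite[of "(a1, a2)" "(b1, b2)"]
    by (auto simp: cb emeasure_eq_ennreal_measure less_top[symmetric])
  have B: "Basis = {(1,0), (0,1::real)::plane}" by (auto simp: Basis_prod_def)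
  show "0 < measure lebesgue Q"
    using Q(2,3) content_pos_lt[of "(a1, a2)" "(b1, b2)"] unfolding eq by (simp add: cb B)
qed

lemma weight_measurable_on:
  assumes w: "weight w" and K: "compact K"
  shows "(\<lambda>x. indicator K x * (w x powr e)) \<in> borel_measurable lebesgue"
proof -
  have "set_integrable lebesgue K w" using assms by (auto simp: weight_def locally_integrable_def)
  then have "(\<lambda>x. indicator K x *\<^sub>R w x) \<in> borel_measurable lebesgue"
    unfolding set_integrable_def by (rule borel_measurable_integrable)
  then have "(\<lambda>x. (indicator K x *\<^sub>R w x) powr e) \<in> borel_measurable lebesgue" by measurable
  moreover have "(\<lambda>x. (indicator K x *\<^sub>R w x) powr e) = (\<lambda>x. indicator K x * (w x powr e))"
    by (auto simp: indicator_def)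
  ultimately show ?thesis by simp
qed

lemma weight_integral_pos:
  assumes w: "weight w" and Q: "Q \<in> gamma_cubes \<beta>"
  shows "(\<integral>\<^sup>+x\<in>Q. ennreal (w x powr e) \<partial>lebesgue) \<noteq> 0"
proof
  assume z: "(\<integral>\<^sup>+x\<in>Q. ennreal (w x powr e) \<partial>lebesgue) = 0"
  note Qf = gamma_cube_facts[OF Q]
  have eq: "(\<lambda>x. ennreal (w x powr e) * indicator Q x) = (\<lambda>x. ennreal (indicator Q x * (w x powr e)))"
    by (auto simp: indicator_def)
  have "AE x in lebesgue. ennreal (indicator Q x * (w x powr e)) = 0"
    using z weight_measurable_on[OF w Qf(1), of e] unfolding eq by (subst (asm) nn_integral_0_iff_AE) auto
  moreover have "0 < w x" for x using w unfolding weight_def by blast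
  ultimately have "AE x in lebesgue. x \<notin> Q"
    by (auto elim!: eventually_mono simp: indicator_def less_le split: if_splits)
  then have "emeasure lebesgue Q = 0"
    using Qf(2) by (subst (asm) AE_iff_measurable[where N=Q]) auto
  then show False using Qf(3,4) by (simp add: ennreal_eq_0_iff)
qed

lemma ennreal_powr_ennreal: "0 \<le> r \<Longrightarrow> ennreal_powr (ennreal r) s = ennreal (r powr s)"
  by (simp add: ennreal_powr_def)

lemma ennreal_powr_pos: "a \<noteq> 0 \<Longrightarrow> ennreal_powr a s \<noteq> 0"
  by (cases a) (auto simp: ennreal_powr_def)

text \<open>Both integrals are nonzero since weights are positive, so the finiteness of their product in the
  \<open>A\<^sub>p\<close> constant makes each of them finite. Adding \<open>1\<close> to that constant keeps the bound
  positive.\<close>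

lemma A_class_bound:
  assumes w: "w \<in> A_class \<beta> p" and p: "1 < p"
  obtains a where "0 < a" "\<And>Q. Q \<in> gamma_cubes \<beta> \<Longrightarrow>
     \<exists>m1 m2. 0 < m1 \<and> 0 < m2 \<and> (\<integral>\<^sup>+x\<in>Q. ennreal (w x powr p) \<partial>lebesgue) = ennreal m1
       \<and> (\<integral>\<^sup>+x\<in>Q. ennreal (w x powr (- conj_exponent p)) \<partial>lebesgue) = ennreal m2
       \<and> m1 powr (1 / p) * m2 powr (1 / conj_exponent p) \<le> a * measure lborel Q"
proof -
  let ?p' = "conj_exponent p"
  have p': "1 / p + 1 / ?p' = 1" "0 < 1 / p" "0 < 1 / ?p'"
    using p by (auto simp: conj_exponent_def field_simps)
  have wt: "weight w" and A: "A_const \<beta> p w < \<infinity>" using w by (auto simp: A_class_def)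
  define a where "a = enn2real (A_const \<beta> p w) + 1"
  have a: "0 < a" "A_const \<beta> p w \<le> ennreal a"
    using A by (auto simp: a_def add_nonneg_pos intro!: order_trans[OF _ ennreal_leI[of "enn2real (A_const \<beta> p w)"]])
  show ?thesis
  proof (rule that[OF a(1)])
    fix Q assume Q: "Q \<in> gamma_cubes \<beta>"
    note Qf = gamma_cube_facts[OF Q]
    let ?V = "measure lborel Q"
    have V: "0 < ?V" using Qf by simp
    define I1 where "I1 = (\<integral>\<^sup>+x\<in>Q. ennreal (w x powr p) \<partial>lebesgue)"
    define I2 where "I2 = (\<integral>\<^sup>+x\<in>Q. ennreal (w x powr (- ?p')) \<partial>lebesgue)"
    have nz: "I1 \<noteq> 0" "I2 \<noteq> 0" unfolding I1_def I2_def using weight_integral_pos[OF wt Q] by auto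
    have prod: "ennreal_powr (I1 / ennreal ?V) (1 / p) * ennreal_powr (I2 / ennreal ?V) (1 / ?p') \<le> ennreal a"
    proof -
      have "ennreal_powr (nn_average Q (\<lambda>x. w x powr p)) (1 / p) *
         ennreal_powr (nn_average Q (\<lambda>x. w x powr (- ?p'))) (1 / ?p') \<le> A_const \<beta> p w"
        unfolding A_const_def using Q by (rule SUP_upper)
      then show ?thesis using a(2) Qf by (simp add: nn_average_def I1_def I2_def)
    qed
    have nzd: "I / ennreal ?V \<noteq> 0" if "I \<noteq> 0" for I
      using that by (simp add: ennreal_divide_eq_0_iff)
    have fin: "I1 \<noteq> \<infinity>" "I2 \<noteq> \<infinity>"
    proof -
      show "I1 \<noteq> \<infinity>"
      proof
        assume "I1 = \<infinity>"
        then have "ennreal_powr (I1 / ennreal ?V) (1 / p) = \<infinity>"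
          by (simp add: ennreal_powr_def ennreal_top_divide)
        then show False using prod ennreal_powr_pos[OF nzd[OF nz(2)]] by (simp add: ennreal_top_mult top_unique)
      qed
      show "I2 \<noteq> \<infinity>"
      proof
        assume "I2 = \<infinity>"
        then have "ennreal_powr (I2 / ennreal ?V) (1 / ?p') = \<infinity>"
          by (simp add: ennreal_powr_def ennreal_top_divide)
        then show False using prod ennreal_powr_pos[OF nzd[OF nz(1)]] by (simp add: ennreal_mult_top top_unique)
      qed
    qed
    define m1 where "m1 = enn2real I1"
    define m2 where "m2 = enn2real I2"
    have m: "I1 = ennreal m1" "I2 = ennreal m2" "0 < m1" "0 < m2"
      using fin nz by (auto simp: m1_def m2_def enn2real_positive_iff ennreal_enn2real_if zero_less_iff_neq_zero top.not_eq_extremum)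
    have "ennreal ((m1 / ?V) powr (1 / p) * (m2 / ?V) powr (1 / ?p')) \<le> ennreal a"
      using prod m V by (simp add: divide_ennreal ennreal_powr_ennreal ennreal_mult)
    then have "(m1 / ?V) powr (1 / p) * (m2 / ?V) powr (1 / ?p') \<le> a"
      using a by (simp add: ennreal_le_iff)
    moreover have "(m1 / ?V) powr (1 / p) * (m2 / ?V) powr (1 / ?p') = m1 powr (1 / p) * m2 powr (1 / ?p') / ?V"
    proof -
      have "?V powr (1 / p) * ?V powr (1 / ?p') = ?V" using V p' by (simp flip: powr_add)
      then show ?thesis using m V by (simp add: powr_divide)
    qed
    ultimately have "m1 powr (1 / p) * m2 powr (1 / ?p') \<le> a * ?V" using V by (simp add: field_simps)
    then show "\<exists>m1 m2. 0 < m1 \<and> 0 < m2 \<and> (\<integral>\<^sup>+x\<in>Q. ennreal (w x powr p) \<partial>lebesgue) = ennreal m1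
       \<and> (\<integral>\<^sup>+x\<in>Q. ennreal (w x powr (- conj_exponent p)) \<partial>lebesgue) = ennreal m2
       \<and> m1 powr (1 / p) * m2 powr (1 / conj_exponent p) \<le> a * measure lborel Q"
      using m unfolding I1_def I2_def by blast
  qed
qed

text \<open>Write \<open>p'\<close>, \<open>q'\<close> for the conjugate exponents. Since \<open>\<mu> powr (- 1) * lam * \<nu> powr s = 1\<close> and the
  exponents satisfy \<open>1/p' + 1/q + s = 2\<close>, Hoelder's inequality for the square roots of the three
  factors bounds \<open>|Q|\<^sup>2\<close> by the product of the integrals of \<open>\<mu> powr (- p')\<close>, \<open>lam powr q\<close> and
  \<open>\<nu>\<close> over \<open>Q\<close>, raised to the powers \<open>1/p'\<close>, \<open>1/q\<close> and \<open>s\<close>. Enlarging the domain of the first two to \<open>R\<close> and applying the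
  \<open>A\<^sub>p\<close> conditions there exchanges them for \<open>\<mu> powr p\<close> and \<open>lam powr (- q')\<close>; the loss is the
  square of \<open>|R| / |Q|\<close>.\<close>

lemma weight_product_bound:
  fixes \<mu> lam \<nu> :: "plane \<Rightarrow> real"
  assumes \<mu>: "\<mu> \<in> A_class \<beta> p" and lam: "lam \<in> A_class \<beta> q" and p: "1 < p" and q: "1 < q"
    and s: "s = 1 + (1 / p - 1 / q)" and \<nu>: "\<nu> = (\<lambda>x. (\<mu> x / lam x) powr inverse s)"
  obtains C where "0 < C" "\<And>Q R. Q \<in> gamma_cubes \<beta> \<Longrightarrow> R \<in> gamma_cubes \<beta> \<Longrightarrow> Q \<subseteq> R \<Longrightarrow> set_integrable lebesgue Q \<nu> \<Longrightarrow>
     \<exists>m l. 0 < m \<and> 0 < l \<and> (\<integral>\<^sup>+x\<in>R. ennreal (\<mu> x powr p) \<partial>lebesgue) = ennreal m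
       \<and> (\<integral>\<^sup>+x\<in>R. ennreal (lam x powr (- conj_exponent q)) \<partial>lebesgue) = ennreal l
       \<and> m powr (1 / p) * l powr (1 / conj_exponent q)
          \<le> C * (measure lborel R / measure lborel Q)\<^sup>2 * (LINT x:Q|lebesgue. \<nu> x) powr s"
proof -
  let ?p' = "conj_exponent p" and ?q' = "conj_exponent q"
  obtain A1 where A1: "0 < A1" "\<And>Q. Q \<in> gamma_cubes \<beta> \<Longrightarrow>
     \<exists>m1 m2. 0 < m1 \<and> 0 < m2 \<and> (\<integral>\<^sup>+x\<in>Q. ennreal (\<mu> x powr p) \<partial>lebesgue) = ennreal m1
       \<and> (\<integral>\<^sup>+x\<in>Q. ennreal (\<mu> x powr (- ?p')) \<partial>lebesgue) = ennreal m2
       \<and> m1 powr (1 / p) * m2 powr (1 / ?p') \<le> A1 * measure lborel Q"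
    using A_class_bound[OF \<mu> p] by blast
  obtain A2 where A2: "0 < A2" "\<And>Q. Q \<in> gamma_cubes \<beta> \<Longrightarrow>
     \<exists>m1 m2. 0 < m1 \<and> 0 < m2 \<and> (\<integral>\<^sup>+x\<in>Q. ennreal (lam x powr q) \<partial>lebesgue) = ennreal m1
       \<and> (\<integral>\<^sup>+x\<in>Q. ennreal (lam x powr (- ?q')) \<partial>lebesgue) = ennreal m2
       \<and> m1 powr (1 / q) * m2 powr (1 / ?q') \<le> A2 * measure lborel Q"
    using A_class_bound[OF lam q] by blast
  have w: "weight \<mu>" "weight lam" using \<mu> lam by (auto simp: A_class_def)
  have pos: "0 < \<mu> x" "0 < lam x" for x using w unfolding weight_def by blast+
  have p': "?p' > 0" "1 / p + 1 / ?p' = 1" using p by (auto simp: conj_exponent_def field_simps)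
  have q': "?q' > 0" "1 / q + 1 / ?q' = 1" using q by (auto simp: conj_exponent_def field_simps)
  have s0: "0 < s"
  proof -
    have "1 / q < 1" "0 < 1 / p" using p q by auto
    then show ?thesis unfolding s by linarith
  qed
  show ?thesis
  proof (rule that[of "A1 * A2"])
    show "0 < A1 * A2" using A1 A2 by simp
    fix Q R assume Q: "Q \<in> gamma_cubes \<beta>" and R: "R \<in> gamma_cubes \<beta>" and QR: "Q \<subseteq> R" and int: "set_integrable lebesgue Q \<nu>"
    note Qf = gamma_cube_facts[OF Q] and Rf = gamma_cube_facts[OF R]
    obtain m1 m2 where m: "0 < m1" "0 < m2" "(\<integral>\<^sup>+x\<in>R. ennreal (\<mu> x powr p) \<partial>lebesgue) = ennreal m1"
       "(\<integral>\<^sup>+x\<in>R. ennreal (\<mu> x powr (- ?p')) \<partial>lebesgue) = ennreal m2"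
       "m1 powr (1 / p) * m2 powr (1 / ?p') \<le> A1 * measure lborel R" using A1(2)[OF R] by blast
    obtain l1 l2 where l: "0 < l1" "0 < l2" "(\<integral>\<^sup>+x\<in>R. ennreal (lam x powr q) \<partial>lebesgue) = ennreal l1"
       "(\<integral>\<^sup>+x\<in>R. ennreal (lam x powr (- ?q')) \<partial>lebesgue) = ennreal l2"
       "l1 powr (1 / q) * l2 powr (1 / ?q') \<le> A2 * measure lborel R" using A2(2)[OF R] by blast
    let ?n = "LINT x:Q|lebesgue. \<nu> x"
    have n0: "0 \<le> ?n" unfolding set_lebesgue_integral_def
      by (rule Bochner_Integration.integral_nonneg) (simp add: \<nu> indicator_def)
    define f where "f x = indicator Q x * (\<mu> x powr (- ?p'))" for x
    define g where "g x = indicator Q x * (lam x powr q)" for x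
    define h where "h x = indicator Q x * \<nu> x" for x
    have "(\<integral>\<^sup>+x. ennreal (f x powr (1 / (2 * ?p')) * g x powr (1 / (2 * q)) * h x powr (s / 2)) \<partial>lebesgue)
       \<le> ennreal (m2 powr (1 / (2 * ?p')) * l1 powr (1 / (2 * q)) * ?n powr (s / 2))"
    proof (rule nn_integral_Hoelder_3)
      show "0 < 1 / (2 * ?p')" "0 < 1 / (2 * q)" "0 < s / 2" using p' q s0 by auto
      show "1 / (2 * ?p') + 1 / (2 * q) + s / 2 = 1"
      proof -
        have "x / 2 + y / 2 + (1 + (z - y)) / 2 = (z + x + 1) / 2" for x y z :: real by (simp add: field_simps)
        from this[of "1 / ?p'" "1 / q" "1 / p"] show ?thesis using p'(2) by (simp add: s)
      qed
      show "f \<in> borel_measurable lebesgue" "g \<in> borel_measurable lebesgue"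
        unfolding f_def g_def using weight_measurable_on Qf(1) w by auto
      show "h \<in> borel_measurable lebesgue" unfolding h_def using int
        by (auto simp: set_integrable_def dest: borel_measurable_integrable)
      show "0 \<le> f x" "0 \<le> g x" "0 \<le> h x" for x by (auto simp: f_def g_def h_def \<nu>)
      have "(\<integral>\<^sup>+x. ennreal (f x) \<partial>lebesgue) \<le> (\<integral>\<^sup>+x\<in>R. ennreal (\<mu> x powr (- ?p')) \<partial>lebesgue)"
        using QR by (intro nn_integral_mono) (auto simp: f_def indicator_def)
      then show "(\<integral>\<^sup>+x. ennreal (f x) \<partial>lebesgue) \<le> ennreal m2" using m by simp
      have "(\<integral>\<^sup>+x. ennreal (g x) \<partial>lebesgue) \<le> (\<integral>\<^sup>+x\<in>R. ennreal (lam x powr q) \<partial>lebesgue)"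
        using QR by (intro nn_integral_mono) (auto simp: g_def indicator_def)
      then show "(\<integral>\<^sup>+x. ennreal (g x) \<partial>lebesgue) \<le> ennreal l1" using l by simp
      have "(\<integral>\<^sup>+x. ennreal (h x) \<partial>lebesgue) = ennreal ?n"
        unfolding set_lebesgue_integral_def h_def
        by (subst nn_integral_eq_integral[symmetric]) (use int in \<open>auto simp: set_integrable_def \<nu>\<close>)
      then show "(\<integral>\<^sup>+x. ennreal (h x) \<partial>lebesgue) \<le> ennreal ?n" by simp
    qed (use m l n0 in auto)
    moreover have "f x powr (1 / (2 * ?p')) * g x powr (1 / (2 * q)) * h x powr (s / 2) = indicator Q x" for x
    proof (cases "x \<in> Q")
      case True
      have "f x powr (1 / (2 * ?p')) = \<mu> x powr (- 1 / 2)" using True p' by (simp add: f_def powr_powr)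
      moreover have "g x powr (1 / (2 * q)) = lam x powr (1 / 2)" using True q by (simp add: g_def powr_powr)
      moreover have "h x powr (s / 2) = \<mu> x powr (1 / 2) / lam x powr (1 / 2)"
        using True s0 pos[of x] by (simp add: h_def \<nu> powr_powr powr_divide)
      moreover have "\<mu> x powr (- 1 / 2) * \<mu> x powr (1 / 2) = 1" using pos[of x] by (simp flip: powr_add)
      ultimately show ?thesis using True pos(2)[of x] by simp
    qed (use p' in \<open>simp add: f_def\<close>)
    ultimately have "ennreal (measure lborel Q) \<le> ennreal (m2 powr (1 / (2 * ?p')) * l1 powr (1 / (2 * q)) * ?n powr (s / 2))"
      using Qf by (simp add: ennreal_indicator)
    then have V: "measure lborel Q \<le> m2 powr (1 / (2 * ?p')) * l1 powr (1 / (2 * q)) * ?n powr (s / 2)"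
      by (simp add: ennreal_le_iff)
    have sq: "(x powr (e / 2))\<^sup>2 = x powr e" for x e :: real
      by (simp add: power2_eq_square flip: powr_add)
    have "(measure lborel Q)\<^sup>2 \<le> (m2 powr (1 / (2 * ?p')) * l1 powr (1 / (2 * q)) * ?n powr (s / 2))\<^sup>2"
      using V by (intro power_mono) auto
    also have "\<dots> = m2 powr (1 / ?p') * l1 powr (1 / q) * ?n powr s"
      using sq[of m2 "1 / ?p'"] sq[of l1 "1 / q"] sq[of ?n s]
      by (simp add: power_mult_distrib mult.commute[of 2])
    finally have V2: "(measure lborel Q)\<^sup>2 \<le> m2 powr (1 / ?p') * l1 powr (1 / q) * ?n powr s" .
    have "m1 powr (1 / p) * l2 powr (1 / ?q') * (measure lborel Q)\<^sup>2
      \<le> m1 powr (1 / p) * l2 powr (1 / ?q') * (m2 powr (1 / ?p') * l1 powr (1 / q) * ?n powr s)"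
      using V2 by (intro mult_left_mono) auto
    also have "\<dots> = (m1 powr (1 / p) * m2 powr (1 / ?p')) * (l1 powr (1 / q) * l2 powr (1 / ?q')) * ?n powr s"
      by (simp add: mult_ac)
    also have "\<dots> \<le> (A1 * measure lborel R) * (A2 * measure lborel R) * ?n powr s"
      using A1(1) by (intro mult_right_mono mult_mono[OF m(5) l(5)]) auto
    finally have "m1 powr (1 / p) * l2 powr (1 / ?q') \<le> (A1 * measure lborel R) * (A2 * measure lborel R) * ?n powr s / (measure lborel Q)\<^sup>2"
      using Qf(3,6) by (simp add: pos_le_divide_eq)
    also have "\<dots> = A1 * A2 * (measure lborel R / measure lborel Q)\<^sup>2 * ?n powr s"
      by (simp add: power2_eq_square)
    finally show "\<exists>m l. 0 < m \<and> 0 < l \<and> (\<integral>\<^sup>+x\<in>R. ennreal (\<mu> x powr p) \<partial>lebesgue) = ennreal m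
       \<and> (\<integral>\<^sup>+x\<in>R. ennreal (lam x powr (- conj_exponent q)) \<partial>lebesgue) = ennreal l
       \<and> m powr (1 / p) * l powr (1 / conj_exponent q)
          \<le> A1 * A2 * (measure lborel R / measure lborel Q)\<^sup>2 * (LINT x:Q|lebesgue. \<nu> x) powr s"
      using m l by blast
  qed
qed

section \<open>The commutator between separated sets\<close>

lemma borel_measurable_completion_cong_AE:
  assumes g: "g \<in> borel_measurable M" and ae: "AE x in M. f x = g x"
  shows "f \<in> borel_measurable (completion M)"
proof (rule measurableI)
  fix S :: "'b set" assume S: "S \<in> sets borel"
  have [measurable]: "g \<in> borel_measurable (completion M)" using g by (rule measurable_completion)
  have 1: "Measurable.pred (completion M) (\<lambda>x. f x \<noteq> g x)" "Measurable.pred (completion M) (\<lambda>x. f x \<in> S \<and> f x \<noteq> g x)"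
    using ae by (auto intro!: sets_completion_AE elim!: eventually_mono)
  note [measurable] = 1 S
  have "Measurable.pred (completion M) (\<lambda>x. (g x \<in> S \<and> \<not> f x \<noteq> g x) \<or> (f x \<in> S \<and> f x \<noteq> g x))"
    by measurable
  also have "(\<lambda>x. (g x \<in> S \<and> \<not> f x \<noteq> g x) \<or> (f x \<in> S \<and> f x \<noteq> g x)) = (\<lambda>x. f x \<in> S)" by auto
  finally show "f -` S \<inter> space (completion M) \<in> sets (completion M)"
    by (simp add: pred_def vimage_def Int_def conj_commute)
qed simp

text \<open>The curve is a null set, and a merely Lebesgue measurable function need not stay measurable when
  composed with it. A Borel version does, and it agrees with the original function almost
  everywhere along the curve through almost every point.\<close>

lemma locally_integrable_borel_version:
  fixes b :: "plane \<Rightarrow> complex"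
  assumes b: "locally_integrable b" and R: "compact R"
  obtains b' where "integrable lborel b'" "AE x in lborel. x \<in> R \<longrightarrow> b x = b' x"
proof -
  define u where "u = (\<lambda>x. indicator R x *\<^sub>R b x)"
  have u: "integrable lebesgue u" using b R by (auto simp: locally_integrable_def set_integrable_def u_def)
  then have um: "u \<in> borel_measurable lebesgue" by (rule borel_measurable_integrable)
  obtain g1 where g1: "g1 \<in> borel_measurable lborel" "AE x in lborel. Re (u x) = g1 x"
    using completion_ex_borel_measurable_real[of "\<lambda>x. Re (u x)" lborel] um by auto
  obtain g2 where g2: "g2 \<in> borel_measurable lborel" "AE x in lborel. Im (u x) = g2 x"
    using completion_ex_borel_measurable_real[of "\<lambda>x. Im (u x)" lborel] um by auto
  define b' where "b' x = complex_of_real (g1 x) + \<i> * complex_of_real (g2 x)" for x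
  have b'm: "b' \<in> borel_measurable lborel" unfolding b'_def using g1(1) g2(1) by measurable
  have ae: "AE x in lborel. u x = b' x" using g1(2) g2(2)
    by eventually_elim (simp add: b'_def complex_eq_iff)
  have "integrable lebesgue b'"
    using u integrable_cong_AE[OF um measurable_completion[OF b'm] AE_completion[OF ae]] by blast
  then have "integrable lborel b'" using integrable_completion[OF b'm] by blast
  moreover have "AE x in lborel. x \<in> R \<longrightarrow> b x = b' x" using ae by eventually_elim (auto simp: u_def)
  ultimately show ?thesis by (rule that)
qed

lemma has_pv_away_from_zero:
  assumes \<phi>: "integrable lebesgue \<phi>" and a: "0 < a" "\<And>t. \<phi> t \<noteq> 0 \<Longrightarrow> t \<in> {a..c}"
  shows "has_pv \<phi> (LINT t|lebesgue. \<phi> t)"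
  unfolding has_pv_def
proof (intro conjI allI impI)
  fix r :: real
  have "{t. r < \<bar>t\<bar>} \<in> sets borel" by measurable
  then show "set_integrable lebesgue {t. r < \<bar>t\<bar>} \<phi>"
    unfolding set_integrable_def using \<phi> by (intro integrable_mult_indicator) auto
next
  have "(LINT t:{t. r < \<bar>t\<bar>}|lebesgue. \<phi> t) = (LINT t|lebesgue. \<phi> t)" if "0 < r" "r < a" for r
    unfolding set_lebesgue_integral_def
  proof (rule Bochner_Integration.integral_cong[OF refl])
    fix t show "indicator {t. r < \<bar>t\<bar>} t *\<^sub>R \<phi> t = \<phi> t"
      using a(2)[of t] a(1) that by (cases "\<phi> t = 0") (auto simp: indicator_def)
  qed
  then have "\<forall>\<^sub>F r in at_right 0. (LINT t:{t. r < \<bar>t\<bar>}|lebesgue. \<phi> t) = (LINT t|lebesgue. \<phi> t)"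
    unfolding eventually_at_right_field using a(1) by blast
  then show "((\<lambda>r. LINT t:{t. r < \<bar>t\<bar>}|lebesgue. \<phi> t) \<longlongrightarrow> (LINT t|lebesgue. \<phi> t)) (at_right 0)"
    by (rule tendsto_eventually)
qed

lemma hilbert_eqI:
  assumes "has_pv (hilbert_integrand \<gamma> f x) I"
  shows "hilbert \<gamma> f x = I"
  unfolding hilbert_def
proof (rule the_equality[of _ I])
  fix J assume "has_pv (hilbert_integrand \<gamma> f x) J"
  then show "J = I" using assms unfolding has_pv_def by (blast intro: tendsto_unique[OF trivial_limit_at_right_real])
qed (fact assms)

text \<open>If \<open>f\<close> is supported in \<open>B\<close> and the curve through \<open>x\<close> meets \<open>B\<close> only at parameters in
  \<open>{a..c}\<close>, both principal values are ordinary integrals. In particular they exist, so \<open>x\<close> lies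
  in the domain of the commutator.\<close>

lemma commutator_eq_curve_osc:
  fixes \<gamma> :: "real \<Rightarrow> plane" and b b' f :: "plane \<Rightarrow> complex"
  assumes [measurable]: "\<gamma> \<in> borel_measurable borel" "b' \<in> borel_measurable borel" "f \<in> borel_measurable borel"
    and int: "integrable lborel (\<lambda>t. indicator {a..c} t *\<^sub>R b' (x - \<gamma> t))"
    and a: "0 < a" and t: "\<And>t. x - \<gamma> t \<in> B \<Longrightarrow> t \<in> {a..c}"
    and f: "\<And>y. cmod (f y) \<le> M * indicator B y"
    and ae: "AE t in lborel. x - \<gamma> t \<in> B \<longrightarrow> b (x - \<gamma> t) = b' (x - \<gamma> t)" and bx: "b x = b' x"
  shows "commutator b \<gamma> f x = curve_osc \<gamma> b' f (\<lambda>_. 1) x"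
proof -
  have f0: "f y = 0" if "y \<notin> B" for y using f[of y] that by simp
  define k where "k t = f (x - \<gamma> t) * complex_of_real (1 / t)" for t
  have km [measurable]: "k \<in> borel_measurable borel" unfolding k_def by measurable
  have kb: "cmod (k t) \<le> (\<bar>M\<bar> / a) * indicator {a..c} t" for t
  proof (cases "x - \<gamma> t \<in> B")
    case True
    then have "t \<in> {a..c}" by (rule t)
    moreover have "cmod (f (x - \<gamma> t)) \<le> \<bar>M\<bar>" using f[of "x - \<gamma> t"] True by auto
    ultimately show ?thesis using a by (auto simp: k_def norm_mult norm_divide intro!: frac_le)
  qed (use a in \<open>simp add: k_def f0\<close>)
  have um: "(\<lambda>t. b' (x - \<gamma> t)) \<in> borel_measurable borel" by measurable
  note ik = integrable_bounded_kernel[OF int km um kb]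
  have k1: "integrable lborel k" using ik(2)[of 1] by simp
  have k2: "integrable lborel (\<lambda>t. b' (x - \<gamma> t) * k t)" by (rule ik(1))
  have nz: "k t \<noteq> 0 \<Longrightarrow> t \<in> {a..c}" for t using kb[of t] by (cases "t \<in> {a..c}") auto
  have h1: "hilbert_integrand \<gamma> f x = k" by (auto simp: hilbert_integrand_def k_def)
  define k' where "k' = hilbert_integrand \<gamma> (\<lambda>y. b y * f y) x"
  have k': "k' t = b (x - \<gamma> t) * k t" for t by (simp add: k'_def hilbert_integrand_def k_def)
  have ae': "AE t in lborel. k' t = b' (x - \<gamma> t) * k t"
    using ae by eventually_elim (auto simp: k' k_def f0)
  have k'm: "k' \<in> borel_measurable lebesgue"
    by (rule borel_measurable_completion_cong_AE[OF _ ae']) measurable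
  have k2l: "integrable lebesgue (\<lambda>t. b' (x - \<gamma> t) * k t)" using k2 by (simp add: integrable_completion)
  have mm: "(\<lambda>t. b' (x - \<gamma> t) * k t) \<in> borel_measurable lebesgue" by (rule measurable_completion) measurable
  have i1: "integrable lebesgue k" using k1 by (simp add: integrable_completion)
  have i2: "integrable lebesgue k'"
    using k2l integrable_cong_AE[OF k'm mm AE_completion[OF ae']] by blast
  have p1: "has_pv (hilbert_integrand \<gamma> f x) (LINT t|lebesgue. k t)"
    unfolding h1 using i1 a nz by (rule has_pv_away_from_zero)
  have p2: "has_pv (hilbert_integrand \<gamma> (\<lambda>y. b y * f y) x) (LINT t|lebesgue. k' t)"
    unfolding k'_def[symmetric] 
  proof (rule has_pv_away_from_zero[OF i2 a])
    show "t \<in> {a..c}" if "k' t \<noteq> 0" for t using nz[of t] that by (auto simp: k')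
  qed
  have "commutator b \<gamma> f x = b x * (LINT t|lebesgue. k t) - (LINT t|lebesgue. k' t)"
    using p1 p2 by (auto simp: commutator_def hilbert_defined_at_def hilbert_eqI)
  also have "(LINT t|lebesgue. k' t) = (LINT t|lebesgue. b' (x - \<gamma> t) * k t)"
    by (rule integral_cong_AE[OF k'm mm AE_completion[OF ae']])
  also have "\<dots> = (LINT t|lborel. b' (x - \<gamma> t) * k t)" by (rule integral_completion) measurable
  also have "(LINT t|lebesgue. k t) = (LINT t|lborel. k t)" by (rule integral_completion) measurable
  also have "b x * (LINT t|lborel. k t) - (LINT t|lborel. b' (x - \<gamma> t) * k t)
     = (LINT t|lborel. b' x * k t - b' (x - \<gamma> t) * k t)"
    using k1 k2 bx by (simp add: integral_diff)
  also have "\<dots> = curve_osc \<gamma> b' f (\<lambda>_. 1) x"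
    by (simp only: curve_osc_def k_def left_diff_distrib)
  finally show ?thesis .
qed

context monomial
begin

text \<open>Dividing \<open>f\<close> by \<open>M * m powr (1 / p)\<close> brings it into the unit ball of \<open>L\<^sup>p\<close> with weight \<open>\<mu>\<close>. The commutator of the
  quotient is then bounded in \<open>L\<^sup>q\<close> with weight \<open>lam\<close>, and Hoelder's inequality on \<open>A\<close>, with the
  factors \<open>lam\<close> and \<open>1 / lam\<close>, passes to \<open>L\<^sup>1\<close>.\<close>

lemma curve_tests_of_op_norm:
  fixes b b' :: "plane \<Rightarrow> complex"
  assumes op: "op_norm p \<mu> q lam (commutator b \<gamma>) \<le> ennreal N" "0 \<le> N" and pq: "1 < p" "1 < q"
    and w: "weight \<mu>" "weight lam" and R: "compact R"
    and m: "0 < m" "(\<integral>\<^sup>+x\<in>R. ennreal (\<mu> x powr p) \<partial>lebesgue) = ennreal m"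
    and l: "0 < l" "(\<integral>\<^sup>+x\<in>R. ennreal (lam x powr (- conj_exponent q)) \<partial>lebesgue) = ennreal l"
    and b': "integrable lborel b'" "AE x in lborel. x \<in> R \<longrightarrow> b x = b' x"
    and A [measurable]: "A \<in> sets borel" and AB: "A \<subseteq> R" "B \<subseteq> R"
    and a: "0 < a" and t: "\<And>x t. x \<in> A \<Longrightarrow> x - \<gamma> t \<in> B \<Longrightarrow> t \<in> {a..c}"
  shows "curve_tests b' A B (N * (m powr (1 / p) * l powr (1 / conj_exponent q)))"
  unfolding curve_tests_def
proof (intro allI impI)
  fix f :: "plane \<Rightarrow> complex" and M :: real
  assume f [measurable]: "f \<in> borel_measurable borel" and M: "0 \<le> M" and fM: "\<forall>y. cmod (f y) \<le> M * indicator B y"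
  let ?q' = "conj_exponent q"
  have q': "?q' > 0" "1 / q + 1 / ?q' = 1" using pq by (auto simp: conj_exponent_def field_simps)
  have pos: "0 < \<mu> x" "0 < lam x" for x using w unfolding weight_def by blast+
  have [measurable]: "b' \<in> borel_measurable borel" using borel_measurable_integrable[OF b'(1)] by simp
  show "(\<integral>\<^sup>+x\<in>A. ennreal (cmod (curve_osc \<gamma> b' f (\<lambda>_. 1) x)) \<partial>lborel) \<le> ennreal (M * (N * (m powr (1 / p) * l powr (1 / ?q'))))"
  proof (cases "M = 0")
    case True
    then have "f y = 0" for y using fM[rule_format, of y] by simp
    then show ?thesis by (simp add: curve_osc_def)
  next
    case False
    define \<kappa> where "\<kappa> = M * m powr (1 / p)"
    have \<kappa>: "0 < \<kappa>" using False M m by (simp add: \<kappa>_def)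
    define f0 where "f0 y = f y / complex_of_real \<kappa>" for y
    have f0m [measurable]: "f0 \<in> borel_measurable borel" unfolding f0_def by measurable
    have f0b: "cmod (f0 y) \<le> (1 / m powr (1 / p)) * indicator B y" for y
    proof -
      have "cmod (f0 y) \<le> (M * indicator B y) / \<kappa>"
        unfolding f0_def norm_divide norm_of_real using \<kappa> fM[rule_format, of y] by (simp add: divide_right_mono)
      also have "\<dots> = (1 / m powr (1 / p)) * indicator B y" using False by (simp add: \<kappa>_def)
      finally show ?thesis .
    qed
    have scale: "curve_osc \<gamma> b' f0 (\<lambda>_. 1) x = curve_osc \<gamma> b' f (\<lambda>_. 1) x / complex_of_real \<kappa>" for x
      unfolding curve_osc_def f0_def by (subst integral_divide_zero[symmetric]) (auto intro!: Bochner_Integration.integral_cong)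
    have "(\<integral>\<^sup>+x. ennreal ((cmod (f0 x) * \<mu> x) powr p) \<partial>lebesgue) \<le> (\<integral>\<^sup>+x. ennreal (1 / m) * (ennreal (indicator R x * (\<mu> x powr p))) \<partial>lebesgue)"
    proof (rule nn_integral_mono)
      fix x
      show "ennreal ((cmod (f0 x) * \<mu> x) powr p) \<le> ennreal (1 / m) * (ennreal (indicator R x * (\<mu> x powr p)))"
      proof (cases "x \<in> R")
        case True
        have "cmod (f0 x) \<le> 1 / m powr (1 / p)" using f0b[of x] by (rule order_trans) (auto simp: indicator_def)
        then have "(cmod (f0 x) * \<mu> x) powr p \<le> ((1 / m powr (1 / p)) * \<mu> x) powr p"
          using pos(1)[of x] pq by (intro powr_mono2 mult_right_mono) auto
        also have "\<dots> = 1 / m * \<mu> x powr p"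
          using m pos(1)[of x] pq by (simp add: powr_mult powr_divide powr_powr)
        finally show ?thesis using True m by (simp add: ennreal_mult[symmetric] ennreal_leI)
      next
        case False
        then have "x \<notin> B" using AB by auto
        then have "f0 x = 0" using f0b[of x] by simp
        then show ?thesis by simp
      qed
    qed
    also have "\<dots> = ennreal (1 / m) * (\<integral>\<^sup>+x. ennreal (indicator R x * (\<mu> x powr p)) \<partial>lebesgue)"
      using weight_measurable_on[OF w(1) R, of p] by (intro nn_integral_cmult) simp
    also have "(\<integral>\<^sup>+x. ennreal (indicator R x * (\<mu> x powr p)) \<partial>lebesgue) = (\<integral>\<^sup>+x\<in>R. ennreal (\<mu> x powr p) \<partial>lebesgue)"
      by (intro nn_integral_cong) (auto simp: indicator_def)
    also have "ennreal (1 / m) * \<dots> = 1"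
      unfolding m(2) using m(1) by (simp add: ennreal_mult[symmetric])
    finally have le1: "(\<integral>\<^sup>+x. ennreal ((cmod (f0 x) * \<mu> x) powr p) \<partial>lebesgue) \<le> 1" .
    then have L1: "Lp_norm p \<mu> f0 \<le> 1"
    proof -
      have "ennreal_powr X (1 / p) \<le> 1" if "X \<le> 1" for X
        using that pq by (cases X) (auto simp: ennreal_powr_ennreal powr_le1 ennreal_powr_def top_unique)
      then show ?thesis unfolding Lp_norm_def using le1 by blast
    qed
    have "f0 \<in> Lp_space p \<mu>" unfolding Lp_space_def
      using L1 f0m by (auto intro: measurable_completion le_less_trans[OF _ ennreal_one_less_top])
    then have "Lp_norm q lam (commutator b \<gamma> f0) \<le> op_norm p \<mu> q lam (commutator b \<gamma>)"
      unfolding op_norm_def using L1 by (intro SUP_upper) auto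
    then have Lq: "Lp_norm q lam (commutator b \<gamma> f0) \<le> ennreal N" using op(1) by (rule order_trans)
    have Lq': "(\<integral>\<^sup>+x. ennreal ((cmod (commutator b \<gamma> f0 x) * lam x) powr q) \<partial>lebesgue) \<le> ennreal (N powr q)"
    proof -
      have "X \<le> ennreal (N powr q)" if X: "ennreal_powr X (1 / q) \<le> ennreal N" for X
      proof (cases X)
        case (real r)
        then have "r powr (1 / q) \<le> N" using X op(2) by (simp add: ennreal_powr_ennreal ennreal_le_iff)
        then have "(r powr (1 / q)) powr q \<le> N powr q" using pq by (intro powr_mono2) auto
        then show ?thesis using real pq by (simp add: powr_powr ennreal_leI)
      next
        case top then show ?thesis using X by (simp add: ennreal_powr_def top_unique)
      qed
      then show ?thesis using Lq unfolding Lp_norm_def by blast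
    qed
    have aec: "AE x in lborel. x \<in> A \<longrightarrow> commutator b \<gamma> f0 x = curve_osc \<gamma> b' f0 (\<lambda>_. 1) x"
      using AE_integrable_along_curve[OF borel_measurable_curve b'(1), of a c] AE_along_curve[OF borel_measurable_curve b'(2)] b'(2)
    proof eventually_elim
      case (elim x)
      show ?case
      proof
        assume x: "x \<in> A"
        show "commutator b \<gamma> f0 x = curve_osc \<gamma> b' f0 (\<lambda>_. 1) x"
        proof (rule commutator_eq_curve_osc[OF _ _ _ elim(1) a t[OF x] f0b])
          show "AE t in lborel. x - \<gamma> t \<in> B \<longrightarrow> b (x - \<gamma> t) = b' (x - \<gamma> t)"
            using elim(2) by eventually_elim (use AB in auto)
        qed (use elim(3) x AB in auto)
      qed
    qed
    define F where "F x = cmod (curve_osc \<gamma> b' f0 (\<lambda>_. 1) x)" for x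
    have Fm [measurable]: "F \<in> borel_measurable borel" unfolding F_def curve_osc_def by measurable
    have F0: "0 \<le> F x" for x by (simp add: F_def)
    define U where "U x = (indicator A x * F x * (indicator R x * (lam x powr 1))) powr q" for x
    define V where "V x = indicator R x * (lam x powr (- ?q'))" for x
    \<comment> \<open>Hoelder's inequality for the two functions \<open>U\<close> and \<open>V\<close>: the exponent \<open>1/q'\<close> of \<open>V\<close> is
      split into two halves to fit the version for three functions.\<close>
    have "(\<integral>\<^sup>+x. ennreal (U x powr (1 / q) * V x powr (1 / (2 * ?q')) * V x powr (1 / (2 * ?q'))) \<partial>lebesgue)
      \<le> ennreal ((N powr q) powr (1 / q) * l powr (1 / (2 * ?q')) * l powr (1 / (2 * ?q')))"
    proof (rule nn_integral_Hoelder_3)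
      have "1 / (2 * ?q') + 1 / (2 * ?q') = 1 / ?q'" by simp
      then show "1 / q + 1 / (2 * ?q') + 1 / (2 * ?q') = 1" using q'(2) by (simp only: add.assoc)
      have "(\<lambda>x. indicator A x * F x) \<in> borel_measurable lebesgue" by (rule measurable_completion) measurable
      then show "U \<in> borel_measurable lebesgue" unfolding U_def
        using weight_measurable_on[OF w(2) R, of 1] by measurable
      show Vm: "V \<in> borel_measurable lebesgue" unfolding V_def using w(2) R by (rule weight_measurable_on)
      then show "V \<in> borel_measurable lebesgue" .
      have "(\<integral>\<^sup>+x. ennreal (U x) \<partial>lebesgue) \<le> (\<integral>\<^sup>+x. ennreal ((cmod (commutator b \<gamma> f0 x) * lam x) powr q) \<partial>lebesgue)"
      proof (rule nn_integral_mono_AE)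
        show "AE x in lebesgue. ennreal (U x) \<le> ennreal ((cmod (commutator b \<gamma> f0 x) * lam x) powr q)"
          using AE_completion[OF aec]
        proof eventually_elim
          case (elim x)
          show ?case
            using elim pos(2)[of x] AB by (cases "x \<in> A") (auto simp: U_def F_def)
        qed
      qed
      then show "(\<integral>\<^sup>+x. ennreal (U x) \<partial>lebesgue) \<le> ennreal (N powr q)" using Lq' by (rule order_trans)
      show Vl: "(\<integral>\<^sup>+x. ennreal (V x) \<partial>lebesgue) \<le> ennreal l"
        unfolding l(2)[symmetric] V_def by (intro nn_integral_mono) (auto simp: indicator_def)
      then show "(\<integral>\<^sup>+x. ennreal (V x) \<partial>lebesgue) \<le> ennreal l" .
      show "0 \<le> V x" "0 \<le> V x" for x by (simp_all add: V_def)
      show "0 \<le> U x" for x by (simp add: U_def)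
    qed (use q' pq l in auto)
    also have "(N powr q) powr (1 / q) * l powr (1 / (2 * ?q')) * l powr (1 / (2 * ?q')) = N * l powr (1 / ?q')"
      using pq op(2) by (simp add: powr_powr mult.assoc flip: powr_add)
    also have "(\<integral>\<^sup>+x. ennreal (U x powr (1 / q) * V x powr (1 / (2 * ?q')) * V x powr (1 / (2 * ?q'))) \<partial>lebesgue)
       = (\<integral>\<^sup>+x\<in>A. ennreal (F x) \<partial>lebesgue)"
    proof (rule nn_integral_cong)
      fix x
      show "ennreal (U x powr (1 / q) * V x powr (1 / (2 * ?q')) * V x powr (1 / (2 * ?q'))) = ennreal (F x) * indicator A x"
      proof (cases "x \<in> A")
        case True
        then have xR: "x \<in> R" using AB by auto
        have "U x powr (1 / q) = F x * lam x" using True xR pq F0[of x] pos(2)[of x]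
          by (simp add: U_def powr_powr)
        moreover have "V x powr (1 / (2 * ?q')) * V x powr (1 / (2 * ?q')) = lam x powr (- 1)"
          using xR q' by (simp add: V_def powr_powr flip: powr_add)
        ultimately show ?thesis using True pos(2)[of x] by (simp add: mult.assoc powr_minus)
      qed (use pq in \<open>simp add: U_def\<close>)
    qed
    finally have FA: "(\<integral>\<^sup>+x\<in>A. ennreal (F x) \<partial>lborel) \<le> ennreal (N * l powr (1 / ?q'))"
      by (simp add: nn_integral_completion)
    have "(\<integral>\<^sup>+x\<in>A. ennreal (cmod (curve_osc \<gamma> b' f (\<lambda>_. 1) x)) \<partial>lborel) = (\<integral>\<^sup>+x. ennreal \<kappa> * (ennreal (F x) * indicator A x) \<partial>lborel)"
      using \<kappa> by (intro nn_integral_cong) (auto simp: F_def scale norm_divide indicator_def ennreal_mult[symmetric])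
    also have "\<dots> = ennreal \<kappa> * (\<integral>\<^sup>+x\<in>A. ennreal (F x) \<partial>lborel)" by (rule nn_integral_cmult) measurable
    also have "\<dots> \<le> ennreal \<kappa> * ennreal (N * l powr (1 / ?q'))" using FA by (rule mult_left_mono) simp
    also have "\<dots> = ennreal (M * (N * (m powr (1 / p) * l powr (1 / ?q'))))"
      using \<kappa> op(2) by (simp add: ennreal_mult[symmetric] \<kappa>_def mult_ac)
    finally show ?thesis .
  qed
qed

end

text \<open>The average is, up to the factor \<open>2\<close>, the best constant approximation in the mean; here it is
  compared with the constant \<open>v / \<omega>\<close>.\<close>

lemma mean_oscillation_le:
  fixes b b' :: "plane \<Rightarrow> complex"
  assumes b: "locally_integrable b" and Q: "Q \<in> gamma_cubes \<beta>"
    and ae: "AE x in lborel. x \<in> Q \<longrightarrow> b x = b' x" and [measurable]: "b' \<in> borel_measurable borel"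
    and \<omega>: "0 < \<omega>" and E: "0 \<le> E"
    and le: "(\<integral>\<^sup>+x\<in>Q. ennreal (cmod (\<omega> *\<^sub>R b' x - v)) \<partial>lborel) \<le> ennreal E"
  shows "(LINT x:Q|lebesgue. cmod (b x - average Q b)) \<le> 2 * E / \<omega>"
proof -
  note Qf = gamma_cube_facts[OF Q]
  have [measurable]: "Q \<in> sets borel" by (rule Qf(2))
  have bi: "set_integrable lebesgue Q b" using b Qf(1) by (auto simp: locally_integrable_def)
  define u where "u = v /\<^sub>R \<omega>"
  let ?V = "measure lebesgue Q"
  have ci: "set_integrable lebesgue Q (\<lambda>_. z)" for z :: complex
    unfolding set_integrable_def using Qf(2,4) by (intro integrable_indicator) auto
  have di: "set_integrable lebesgue Q (\<lambda>x. b x - z)" for z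
    using set_integral_diff(1)[OF bi ci] .
  have ni: "set_integrable lebesgue Q (\<lambda>x. cmod (b x - z))" for z
    using set_integrable_norm[OF di] .
  have cc: "(LINT x:Q|lebesgue. z) = ?V *\<^sub>R z" for z :: "'z::{banach,second_countable_topology}"
    unfolding set_lebesgue_integral_def using Qf(2,4) by simp
  have I: "(LINT x:Q|lebesgue. cmod (b x - u)) \<le> E / \<omega>"
  proof -
    have "ennreal (LINT x:Q|lebesgue. cmod (b x - u)) = (\<integral>\<^sup>+x. ennreal (indicator Q x *\<^sub>R cmod (b x - u)) \<partial>lebesgue)"
      unfolding set_lebesgue_integral_def using ni[of u]
      by (intro nn_integral_eq_integral[symmetric]) (auto simp: set_integrable_def)
    also have "\<dots> = (\<integral>\<^sup>+x. ennreal (indicator Q x *\<^sub>R cmod (b x - u)) \<partial>lborel)" by (rule nn_integral_completion)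
    also have "\<dots> = (\<integral>\<^sup>+x. ennreal (1 / \<omega>) * (ennreal (cmod (\<omega> *\<^sub>R b' x - v)) * indicator Q x) \<partial>lborel)"
    proof (rule nn_integral_cong_AE, use ae in eventually_elim)
      case (elim x)
      show ?case
      proof (cases "x \<in> Q")
        case True
        have "\<omega> *\<^sub>R b' x - v = \<omega> *\<^sub>R (b x - u)" using elim True \<omega> by (simp add: u_def scaleR_diff_right)
        then have "cmod (\<omega> *\<^sub>R b' x - v) = \<omega> * cmod (b x - u)" using \<omega> by simp
        then show ?thesis using True \<omega> by (simp add: ennreal_mult[symmetric])
      qed simp
    qed
    also have "\<dots> = ennreal (1 / \<omega>) * (\<integral>\<^sup>+x\<in>Q. ennreal (cmod (\<omega> *\<^sub>R b' x - v)) \<partial>lborel)"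
      by (rule nn_integral_cmult) measurable
    also have "\<dots> \<le> ennreal (1 / \<omega>) * ennreal E" using le by (rule mult_left_mono) simp
    also have "\<dots> = ennreal (E / \<omega>)" using \<omega> E by (simp add: ennreal_mult[symmetric])
    finally show ?thesis using \<omega> E by (simp add: ennreal_le_iff)
  qed
  have "average Q b - u = (LINT x:Q|lebesgue. b x - u) /\<^sub>R ?V"
    using Qf(3) by (simp add: set_integral_diff(2)[OF bi ci] cc average_def scaleR_diff_right)
  then have "?V * cmod (average Q b - u) = cmod (LINT x:Q|lebesgue. b x - u)"
    using Qf(3) by simp
  also have "\<dots> \<le> (LINT x:Q|lebesgue. cmod (b x - u))"
    using set_integral_norm_bound[OF di] .
  finally have avg: "?V * cmod (average Q b - u) \<le> (LINT x:Q|lebesgue. cmod (b x - u))" .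
  have "(LINT x:Q|lebesgue. cmod (b x - average Q b)) \<le> (LINT x:Q|lebesgue. cmod (b x - u) + cmod (average Q b - u))"
  proof (rule set_integral_mono[OF ni])
    have "set_integrable lebesgue Q (\<lambda>_. cmod (average Q b - u))"
      unfolding set_integrable_def using Qf(2,4) by (intro integrable_indicator) auto
    then show "set_integrable lebesgue Q (\<lambda>x. cmod (b x - u) + cmod (average Q b - u))"
      by (intro set_integral_add(1) ni)
    show "cmod (b x - average Q b) \<le> cmod (b x - u) + cmod (average Q b - u)" for x
      using norm_triangle_ineq4[of "b x - u" "average Q b - u"] by simp
  qed
  also have "\<dots> = (LINT x:Q|lebesgue. cmod (b x - u)) + ?V * cmod (average Q b - u)"
  proof -
    have "set_integrable lebesgue Q (\<lambda>_. cmod (average Q b - u))"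
      unfolding set_integrable_def using Qf(2,4) by (intro integrable_indicator) auto
    then show ?thesis by (simp add: set_integral_add(2)[OF ni] cc)
  qed
  also have "\<dots> \<le> 2 * E / \<omega>" using avg I by simp
  finally show ?thesis .
qed

section \<open>The lower bound for the commutator norm\<close>

lemma rectangle_facts:
  assumes "fst l \<le> fst u" "snd l \<le> snd u"
  shows "compact (rectangle l u)" "rectangle l u \<in> sets borel" "emeasure lborel (rectangle l u) < \<infinity>"
    "measure lborel (rectangle l u) = (fst u - fst l) * (snd u - snd l)"
proof -
  have cb: "rectangle l u = cbox l u"
    unfolding rectangle_def by (metis cbox_Pair_eq cbox_interval prod.collapse)
  have B: "Basis = {(1,0), (0,1::real)::plane}" by (auto simp: Basis_prod_def)
  show "compact (rectangle l u)" "rectangle l u \<in> sets borel" by (auto simp: cb)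
  show "emeasure lborel (rectangle l u) < \<infinity>" unfolding cb by (rule emeasure_lborel_cbox_finite)
  show "measure lborel (rectangle l u) = (fst u - fst l) * (snd u - snd l)"
    unfolding cb using assms by (subst content_cbox') (auto simp: B box_ne_empty inner_prod_def)
qed

lemma dilate_rectangle:
  assumes "0 < \<rho>"
  shows "(\<lambda>u. z + dilate \<beta> \<rho> u) ` rectangle l u = rectangle (z + dilate \<beta> \<rho> l) (z + dilate \<beta> \<rho> u)"
proof -
  have p: "0 < \<rho> powr e" for e using assms by simp
  show ?thesis
  proof (intro set_eqI iffI)
    fix x assume "x \<in> (\<lambda>u. z + dilate \<beta> \<rho> u) ` rectangle l u"
    then show "x \<in> rectangle (z + dilate \<beta> \<rho> l) (z + dilate \<beta> \<rho> u)"
      using assms by (auto simp: rectangle_def dilate_def plus_prod_def)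
  next
    fix x assume x: "x \<in> rectangle (z + dilate \<beta> \<rho> l) (z + dilate \<beta> \<rho> u)"
    define y where "y = ((fst x - fst z) / \<rho> powr fst \<beta>, (snd x - snd z) / \<rho> powr snd \<beta>)"
    have "x = z + dilate \<beta> \<rho> y" using assms by (simp add: y_def dilate_def prod_eq_iff)
    moreover have "y \<in> rectangle l u"
      using x p[of "fst \<beta>"] p[of "snd \<beta>"]
      by (cases x) (simp add: y_def rectangle_def dilate_def pos_le_divide_eq pos_divide_le_eq mult.commute)
    ultimately show "x \<in> (\<lambda>u. z + dilate \<beta> \<rho> u) ` rectangle l u" by blast
  qed
qed

theorem theorem1p26:
  fixes \<beta> \<epsilon> \<delta> :: plane and p q \<alpha> :: real and \<mu> lam \<nu> :: "plane \<Rightarrow> real"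
    and \<gamma> :: "real \<Rightarrow> plane"
  assumes "monomial_data \<beta> \<epsilon> \<delta>"
    and "\<gamma> = monomial_curve \<beta> \<epsilon> \<delta>"
    and "1 < p" and "1 < q"
    and "\<mu> \<in> A_class \<beta> p" and "lam \<in> A_class \<beta> q"
    and "\<alpha> / homdim \<beta> = 1 / p - 1 / q"
    and "\<nu> = (\<lambda>x. (\<mu> x / lam x) powr (inverse (1 + \<alpha> / homdim \<beta>)))"
  shows "\<exists>C>0. \<forall>b :: plane \<Rightarrow> complex. locally_integrable b \<longrightarrow>
           BMO_norm \<beta> \<alpha> \<nu> b \<le> ennreal C * op_norm p \<mu> q lam (commutator b \<gamma>)"
proof -
  interpret monomial \<beta> \<epsilon> \<delta> by unfold_locales (fact assms(1))
  note \<gamma>_def = assms(2)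
  define s where "s = 1 + (1 / p - 1 / q)"
  have \<nu>: "\<nu> = (\<lambda>x. (\<mu> x / lam x) powr inverse s)" using assms(7,8) by (simp add: s_def)
  obtain h pl pu wl wu where h: "0 < h" and wlu: "fst wl < fst wu" "snd wl < snd wu"
    and T0: "transversal_triple \<gamma> (1/2) 3 (rectangle 0 (h powr fst \<beta>, h powr snd \<beta>)) (rectangle pl pu) (rectangle wl wu)"
    using exists_transversal_triple unfolding \<gamma>_def by metis
  let ?Q0 = "rectangle 0 (h powr fst \<beta>, h powr snd \<beta>)" and ?P0 = "rectangle pl pu" and ?W0 = "rectangle wl wu"
  have pl: "fst pl \<le> fst pu" "snd pl \<le> snd pu"
  proof -
    have "0 \<in> ?Q0" "wl \<in> ?W0" using wlu by (auto simp: rectangle_def mem_Times_iff)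
    then obtain t where "0 - \<gamma> t \<in> ?P0" using T0 unfolding transversal_triple_def \<gamma>_def by blast
    then show "fst pl \<le> fst pu" "snd pl \<le> snd pu" by (auto simp: rectangle_def)
  qed
  have hp: "0 \<le> h powr fst \<beta>" "0 \<le> h powr snd \<beta>" by auto
  have "bounded (?Q0 \<union> ?P0 \<union> ?W0)"
    using pl wlu hp by (intro compact_imp_bounded compact_Un rectangle_facts(1)) auto
  then obtain D where D0: "0 < D" and normD: "\<And>u. u \<in> ?Q0 \<union> ?P0 \<union> ?W0 \<Longrightarrow> norm u \<le> D"
    unfolding bounded_pos by blast
  have D: "\<bar>fst u\<bar> \<le> D \<and> \<bar>snd u\<bar> \<le> D" if "u \<in> ?Q0 \<union> ?P0 \<union> ?W0" for u
    using normD[OF that] norm_fst_le[of "fst u" "snd u"] norm_snd_le[of "snd u" "fst u"]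
    by (auto intro: order_trans)
  \<comment> \<open>a side length for which one cube contains the whole model configuration\<close>
  define L where "L = max ((2 * D) powr (1 / fst \<beta>)) ((2 * D) powr (1 / snd \<beta>))"
  have L: "0 < L" "2 * D \<le> L powr fst \<beta>" "2 * D \<le> L powr snd \<beta>"
  proof -
    show "0 < L" using D0 by (simp add: L_def less_max_iff_disj)
    have "((2 * D) powr (1 / fst \<beta>)) powr fst \<beta> \<le> L powr fst \<beta>"
      using exponents by (intro powr_mono2) (auto simp: L_def)
    then show "2 * D \<le> L powr fst \<beta>" using D0 exponents by (simp add: powr_powr)
    have "((2 * D) powr (1 / snd \<beta>)) powr snd \<beta> \<le> L powr snd \<beta>"
      using exponents by (intro powr_mono2) (auto simp: L_def)
    then show "2 * D \<le> L powr snd \<beta>" using D0 exponents by (simp add: powr_powr)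
  qed
  let ?R0 = "rectangle (- D, - D) (- D + L powr fst \<beta>, - D + L powr snd \<beta>)"
  have sub0: "?Q0 \<union> ?P0 \<union> ?W0 \<subseteq> ?R0"
  proof
    fix u assume "u \<in> ?Q0 \<union> ?P0 \<union> ?W0"
    then show "u \<in> ?R0" using D[of u] L(2,3) by (cases u) (auto simp: rectangle_def abs_le_iff)
  qed
  have wle: "fst wl \<le> fst wu" "snd wl \<le> snd wu" using wlu by simp_all
  define \<omega> where "\<omega> = (fst wu - fst wl) * (snd wu - snd wl)"
  have \<omega>: "0 < \<omega>" using wlu by (simp add: \<omega>_def)
  obtain C0 where C0: "0 < C0" "\<And>Q R. Q \<in> gamma_cubes \<beta> \<Longrightarrow> R \<in> gamma_cubes \<beta> \<Longrightarrow> Q \<subseteq> R \<Longrightarrow> set_integrable lebesgue Q \<nu> \<Longrightarrow>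
     \<exists>m l. 0 < m \<and> 0 < l \<and> (\<integral>\<^sup>+x\<in>R. ennreal (\<mu> x powr p) \<partial>lebesgue) = ennreal m
       \<and> (\<integral>\<^sup>+x\<in>R. ennreal (lam x powr (- conj_exponent q)) \<partial>lebesgue) = ennreal l
       \<and> m powr (1 / p) * l powr (1 / conj_exponent q)
          \<le> C0 * (measure lborel R / measure lborel Q)\<^sup>2 * (LINT x:Q|lebesgue. \<nu> x) powr s"
    using weight_product_bound[OF assms(5,6,3,4) s_def \<nu>] by blast
  let ?hd = "homdim \<beta>"
  have powr_hd: "x powr fst \<beta> * x powr snd \<beta> = x powr ?hd" for x :: real by (simp add: homdim_def powr_add)
  define C1 where "C1 = 4 * (fst \<beta> * snd \<beta>) * 5 * (D * (3 powr snd \<beta> + 3 powr fst \<beta>))"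
  have C1: "0 < C1" using D0 exponents by (auto simp: C1_def intro!: mult_pos_pos add_pos_pos)
  define C where "C = 2 * C1 / \<omega> * (C0 * ((L / h) powr ?hd)\<^sup>2)"
  have C: "0 < C" using C0(1) C1 \<omega> L(1) h by (simp add: C_def)
  have wts: "weight \<mu>" "weight lam" using assms(5,6) by (auto simp: A_class_def)
  have main: "BMO_norm \<beta> \<alpha> \<nu> b \<le> ennreal C * op_norm p \<mu> q lam (commutator b \<gamma>)"
    if b: "locally_integrable b" for b
  proof (cases "op_norm p \<mu> q lam (commutator b \<gamma>) = \<infinity>")
    case True
    then show ?thesis using C by (simp add: ennreal_mult_top)
  next
    case False
    define N where "N = enn2real (op_norm p \<mu> q lam (commutator b \<gamma>))"
    have N: "op_norm p \<mu> q lam (commutator b \<gamma>) = ennreal N" "0 \<le> N"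
      using False by (auto simp: N_def ennreal_enn2real_if)
    have cube: "ennreal (n powr (- \<alpha> / ?hd) * (1 / n * (LINT x:Q|lebesgue. cmod (b x - average Q b)))) \<le> ennreal (C * N)"
      if Q: "Q \<in> gamma_cubes \<beta>" and n: "n = (LINT x:Q|lebesgue. \<nu> x)" for Q n
      \<comment> \<open>If \<open>\<nu>\<close> is not integrable over \<open>Q\<close>, its Bochner integral \<open>n\<close> is \<open>0\<close>, and so is the term of
        \<open>Q\<close> in the supremum because of the division by \<open>n\<close>.\<close>
    proof (cases "n = 0")
      case True then show ?thesis by simp
    next
      case False
      have int\<nu>: "set_integrable lebesgue Q \<nu>"
        using False unfolding n set_integrable_def set_lebesgue_integral_def by (metis not_integrable_integral_eq)
      have "0 \<le> n" unfolding n set_lebesgue_integral_def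
        by (rule Bochner_Integration.integral_nonneg) (simp add: \<nu> indicator_def)
      then have n0: "0 < n" using False by simp
      obtain a1 b1 a2 b2 where Qab: "Q = {a1..b1} \<times> {a2..b2}" "a1 < b1" "a2 < b2"
        "(b1 - a1) powr (1 / fst \<beta>) = (b2 - a2) powr (1 / snd \<beta>)"
        using Q by (auto simp: gamma_cubes_def)
      \<comment> \<open>the scale at which the cube of side \<open>h\<close> of the model configuration becomes \<open>Q\<close>\<close>
      define \<rho> where "\<rho> = (b1 - a1) powr (1 / fst \<beta>) / h"
      have \<rho>: "0 < \<rho>" using Qab h by (simp add: \<rho>_def)
      have \<rho>h: "(\<rho> * h) powr fst \<beta> = b1 - a1" "(\<rho> * h) powr snd \<beta> = b2 - a2"
      proof -
        have 1: "\<rho> * h = (b1 - a1) powr (1 / fst \<beta>)" using h by (simp add: \<rho>_def)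
        then show "(\<rho> * h) powr fst \<beta> = b1 - a1" using Qab(2) exponents by (simp add: powr_powr)
        show "(\<rho> * h) powr snd \<beta> = b2 - a2"
          unfolding 1 Qab(4) using Qab(3) exponents by (simp add: powr_powr)
      qed
      define z where "z = (a1, a2)"
      define S where "S = (\<lambda>A. (\<lambda>u. z + dilate \<beta> \<rho> u) ` A)"
      have S_rect: "S (rectangle l u) = rectangle (z + dilate \<beta> \<rho> l) (z + dilate \<beta> \<rho> u)" for l u
        unfolding S_def using \<rho> by (rule dilate_rectangle)
      have S_mono: "A \<subseteq> B \<Longrightarrow> S A \<subseteq> S B" for A B unfolding S_def by (rule image_mono)
      have S_le: "fst (z + dilate \<beta> \<rho> l) \<le> fst (z + dilate \<beta> \<rho> u)" "snd (z + dilate \<beta> \<rho> l) \<le> snd (z + dilate \<beta> \<rho> u)"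
        if "fst l \<le> fst u" "snd l \<le> snd u" for l u
        using that by (auto simp: dilate_def intro!: mult_left_mono)
      note S_facts = rectangle_facts[OF S_le, folded S_rect]
      have S_measure: "measure lborel (S (rectangle l u)) = \<rho> powr ?hd * ((fst u - fst l) * (snd u - snd l))"
        if "fst l \<le> fst u" "snd l \<le> snd u" for l u
        using S_facts(4)[OF that that] by (simp add: dilate_def powr_hd[symmetric] algebra_simps)
      have QS: "Q = S ?Q0"
        using \<rho>h \<rho> h unfolding S_rect unfolding rectangle_def dilate_def z_def Qab(1) by (simp add: powr_mult)
      define P where "P = S ?P0"
      define W where "W = S ?W0"
      define R where "R = S ?R0"
      have sub: "Q \<subseteq> R" "P \<subseteq> R" "W \<subseteq> R"
        unfolding QS P_def W_def R_def using sub0 by (auto intro!: S_mono)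
      have Rcube: "R \<in> gamma_cubes \<beta>"
        unfolding gamma_cubes_def mem_Collect_eq
      proof (intro exI conjI)
        let ?a1 = "a1 - \<rho> powr fst \<beta> * D" and ?a2 = "a2 - \<rho> powr snd \<beta> * D"
        show "R = {?a1..?a1 + (\<rho> * L) powr fst \<beta>} \<times> {?a2..?a2 + (\<rho> * L) powr snd \<beta>}"
          using \<rho> L unfolding R_def S_rect unfolding rectangle_def dilate_def z_def by (simp add: powr_mult algebra_simps)
        show "?a1 < ?a1 + (\<rho> * L) powr fst \<beta>" "?a2 < ?a2 + (\<rho> * L) powr snd \<beta>" using \<rho> L by auto
        show "(?a1 + (\<rho> * L) powr fst \<beta> - ?a1) powr (1 / fst \<beta>) = (?a2 + (\<rho> * L) powr snd \<beta> - ?a2) powr (1 / snd \<beta>)"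
          using exponents by (simp add: powr_powr)
      qed
      have Lp: "0 \<le> L powr e" for e by simp
      have mQ: "measure lborel Q = (\<rho> * h) powr ?hd"
        unfolding QS using hp \<rho> h by (subst S_measure) (auto simp: powr_hd powr_mult)
      have mR: "measure lborel R = (\<rho> * L) powr ?hd"
        unfolding R_def using Lp \<rho> L by (subst S_measure) (auto simp: powr_hd powr_mult)
      have mW: "measure lborel W = \<rho> powr ?hd * \<omega>"
        unfolding W_def \<omega>_def using wlu by (subst S_measure) auto
      have ratio: "measure lborel R / measure lborel Q = (L / h) powr ?hd"
        unfolding mQ mR using \<rho> h L by (simp add: powr_divide powr_mult)
      have rho_pos: "0 < \<rho> powr ?hd" using \<rho> by simp
      note Pf = S_facts[OF pl pl, folded P_def]
      note Wf = S_facts[OF wle wle, folded W_def]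
      note Rf = gamma_cube_facts[OF Rcube] and Qf = gamma_cube_facts[OF Q]
      have T: "transversal_triple \<gamma> (\<rho> * (1/2)) (\<rho> * 3) Q P W"
        unfolding \<gamma>_def QS P_def W_def S_def by (rule transversal_triple_dilate[OF T0[unfolded \<gamma>_def] \<rho>])
      obtain m l where ml: "0 < m" "0 < l" "(\<integral>\<^sup>+x\<in>R. ennreal (\<mu> x powr p) \<partial>lebesgue) = ennreal m"
        "(\<integral>\<^sup>+x\<in>R. ennreal (lam x powr (- conj_exponent q)) \<partial>lebesgue) = ennreal l"
        "m powr (1 / p) * l powr (1 / conj_exponent q) \<le> C0 * (measure lborel R / measure lborel Q)\<^sup>2 * n powr s"
        using C0(2)[OF Q Rcube sub(1) int\<nu>] unfolding n by blast
      obtain b' where b': "integrable lborel b'" "AE x in lborel. x \<in> R \<longrightarrow> b x = b' x"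
        using locally_integrable_borel_version[OF b Rf(1)] by blast
      define E where "E = N * (m powr (1 / p) * l powr (1 / conj_exponent q))"
      have E0: "0 \<le> E" using N by (simp add: E_def)
      note tests = curve_tests_of_op_norm[OF eq_refl[OF N(1)[unfolded \<gamma>_def]] N(2) assms(3,4) wts Rf(1) ml(1,3,2,4) b']
      have tQP: "curve_tests b' Q P E" unfolding E_def
      proof (rule tests[OF Qf(2) sub(1,2)])
        show "0 < \<rho> * (1/2)" using \<rho> by simp
        show "t \<in> {\<rho> * (1/2)..\<rho> * 3}" if "x \<in> Q" "x - monomial_curve \<beta> \<epsilon> \<delta> t \<in> P" for x t
          using T that unfolding transversal_triple_def \<gamma>_def by blast
      qed
      have tPW: "curve_tests b' P W E" unfolding E_def
      proof (rule tests[OF Pf(2) sub(2,3)])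
        show "0 < \<rho> * (1/2)" using \<rho> by simp
        show "t \<in> {\<rho> * (1/2)..\<rho> * 3}" if "x \<in> P" "x - monomial_curve \<beta> \<epsilon> \<delta> t \<in> W" for x t
          using T that unfolding transversal_triple_def \<gamma>_def by blast
      qed
      have near: "\<bar>fst v - fst z\<bar> \<le> \<rho> powr fst \<beta> * D \<and> \<bar>snd v - snd z\<bar> \<le> \<rho> powr snd \<beta> * D" if "v \<in> Q \<union> P \<union> W" for v
      proof -
        have "v \<in> (\<lambda>u. z + dilate \<beta> \<rho> u) ` (?Q0 \<union> ?P0 \<union> ?W0)"
          using that unfolding QS P_def W_def S_def image_Un .
        then obtain u where u: "u \<in> ?Q0 \<union> ?P0 \<union> ?W0" "v = z + dilate \<beta> \<rho> u" by (rule imageE)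
        then show ?thesis using D[OF u(1)] by (auto simp: dilate_def abs_mult intro!: mult_left_mono)
      qed
      have "(\<integral>\<^sup>+x\<in>Q. ennreal (cmod (measure lborel W *\<^sub>R b' x - (LINT w:W|lborel. b' w))) \<partial>lborel)
        \<le> ennreal (4 * (fst \<beta> * snd \<beta>) * ((\<rho> * 3 - \<rho> * (1/2)) / (\<rho> * (1/2)))
             * ((\<rho> powr fst \<beta> * D) * (\<rho> * 3) powr snd \<beta> + (\<rho> powr snd \<beta> * D) * (\<rho> * 3) powr fst \<beta>) * E)"
        by (rule oscillation_le_curve_tests[OF T[unfolded \<gamma>_def] _ _ Wf(2,3) Pf(2) Qf(2) b'(1) _ _ _ _ tQP tPW E0,
              where ?o1.0="fst z" and ?o2.0="snd z"])
          (use \<rho> D0 near in blast | use \<rho> D0 in simp)+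
      also have "4 * (fst \<beta> * snd \<beta>) * ((\<rho> * 3 - \<rho> * (1/2)) / (\<rho> * (1/2)))
             * ((\<rho> powr fst \<beta> * D) * (\<rho> * 3) powr snd \<beta> + (\<rho> powr snd \<beta> * D) * (\<rho> * 3) powr fst \<beta>) * E
         = C1 * \<rho> powr ?hd * E"
      proof -
        have "(\<rho> * 3 - \<rho> * (1/2)) / (\<rho> * (1/2)) = 5" using \<rho> by (simp add: field_simps)
        then show ?thesis using \<rho> by (simp add: C1_def powr_mult powr_hd[symmetric] algebra_simps)
      qed
      finally have "(LINT x:Q|lebesgue. cmod (b x - average Q b)) \<le> 2 * (C1 * \<rho> powr ?hd * E) / measure lborel W"
      proof (rule mean_oscillation_le[OF b Q _ _ _ _, rotated -1])
        show "AE x in lborel. x \<in> Q \<longrightarrow> b x = b' x" using b'(2) by eventually_elim (use sub in auto)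
        show "b' \<in> borel_measurable borel" using borel_measurable_integrable[OF b'(1)] by simp
        show "0 < measure lborel W" using rho_pos \<omega> by (simp add: mW)
        show "0 \<le> C1 * \<rho> powr ?hd * E" using C1 E0 by simp
      qed
      also have "\<dots> = 2 * C1 / \<omega> * E" using rho_pos \<omega> by (simp add: mW)
      also have "\<dots> \<le> 2 * C1 / \<omega> * (N * (C0 * ((L / h) powr ?hd)\<^sup>2 * n powr s))"
        unfolding E_def using ml(5) N(2) C1 \<omega> by (intro mult_left_mono) (auto simp: ratio)
      also have "\<dots> = C * N * n powr s" by (simp add: C_def)
      finally have osc: "(LINT x:Q|lebesgue. cmod (b x - average Q b)) \<le> C * N * n powr s" .
      have "n powr (- \<alpha> / ?hd) * (1 / n * (LINT x:Q|lebesgue. cmod (b x - average Q b)))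
        \<le> n powr (- \<alpha> / ?hd) * (1 / n * (C * N * n powr s))"
        using osc n0 by (intro mult_left_mono) auto
      also have "\<dots> = C * N * (n powr (- \<alpha> / ?hd) * n powr s * n powr (- 1))"
        using n0 by (simp add: powr_minus field_simps)
      also have "n powr (- \<alpha> / ?hd) * n powr s * n powr (- 1) = n powr (- \<alpha> / ?hd + s + - 1)"
        by (simp only: powr_add)
      also have "- \<alpha> / ?hd + s + - 1 = 0" using assms(7) by (simp add: s_def)
      finally show ?thesis using n0 by (intro ennreal_leI) simp
    qed
    have "BMO_norm \<beta> \<alpha> \<nu> b \<le> ennreal (C * N)"
      unfolding BMO_norm_def Let_def by (intro SUP_least cube) auto
    then show ?thesis using N C by (simp add: ennreal_mult)
  qed
  show ?thesis using C main by blast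
qed

end
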